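(* Suppose the random vector $\mathbf{x}$ in $\mathbb{R}^n$ satisfies the sub-Gaussian assumption stated in the context, with $N\ge e^2$ and $n\ge3$. Also assume that for all $i\in[n]$ there is a $k\in[N]$ so that $\delta_i^{(k)}=1$. Then, conditioned on the missing data pattern $\mathbf{\Delta}$, the estimator $$\widehat{\mathbf{\Sigma}}=\frac1N\sum_{k=1}^N\mathbf{y}^{(k)}{\mathbf{y}^{(k)}}^\top\odot\widehat{\mathbf{\Gamma}}$$ satisfies $$\mathbb{E}\left[\Vert\widehat{\mathbf{\Sigma}}-\mathbf{\Sigma}_{\mathcal{E}}\Vert^2\mid\mathbf{\Delta}\right]^{1/2}\le C\Vert\mathbf{\Sigma}\Vert\left(\sqrt{\frac{8e\log(n)\,\mathrm{r}_{\min}(\mathbf{\Sigma},\widehat{\mathbf{P}})}{N}}+\frac{4e^2\log(n)\log(N)\,\mathrm{r}_2(\mathbf{\Sigma},\widehat{\mathbf{P}})}{N}\right),$$ where $C$ is a universal numerical constant, $\mathbf{\Sigma}_{\mathcal{E}}=\mathbb{E}[\widehat{\mathbf{\Sigma}}\mid\mathbf{\Delta}]$, and $$\mathrm{r}_{\min}(\mathbf{\Sigma},\widehat{\mathbf{P}})=\frac1{\Vert\mathbf{\Sigma}\Vert}\max_{j}\sum_{i:(i,j)\in\mathcal{E}}\frac{\Sigma_{ii}}{\hat p_{ij}},\qquad \mathrm{r}_2(\mathbf{\Sigma},\widehat{\mathbf{P}})=\frac1{\Vert\mathbf{\Sigma}\Vert}\sqrt{\sum_{(i,j)\in\mathcal{E}}\frac{\Sigma_{ii}\Sigma_{jj}}{\hat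 p_{ij}^2}}.$$
   Context: Notation: $[n]=\{1,\dots,n\}$; $\odot$ is the entrywise (Hadamard) product; $\Vert\cdot\Vert$ is the Euclidean norm on vectors and the operator norm (largest singular value) on matrices; $\log$ is the natural logarithm. Data: $\mathbf{x}$ is a zero-mean random vector in $\mathbb{R}^n$ with covariance matrix $\mathbf{\Sigma}=\mathbb{E}[\mathbf{x}\mathbf{x}^\top]=(\Sigma_{ij})\neq0$; $\mathbf{x}^{(1)},\dots,\mathbf{x}^{(N)}$ are i.i.d. copies of $\mathbf{x}$, the columns of the $n\times N$ matrix $\mathbf{X}$. Missing data (missing completely at random, unknown distribution): $\mathbf{\Delta}$ is an $n\times N$ random matrix with entries in $\{0,1\}$ and columns $\boldsymbol\delta^{(k)}=(\delta^{(k)}_i)_i$, independent of $\mathbf{X}$. The observations are $\mathbf{y}^{(k)}=\boldsymbol\delta^{(k)}\odot\mathbf{x}^{(k)}$. Set $\widehat{\mathbf{P}}=(\hat p_{ij})=\frac1N\sum_{k=1}^N\boldsymbol\delta^{(k)}{\boldsymbol\delta^{(k)}}^\top$ and $\mathcal{E}=\{(i,j):\hat p_{ij}\neq0\}$. $\widehat{\mathbf{\Gamma}}=(\hat\gamma_{ij})$ is the entrywise inverse of the entrywise maximum $\max(\widehat{\mathbf{P}},\frac1N\mathbf{1}\mathbf{1}^\top)$, so $\hat\gamma_{ij}\hat p_{ij}=1$ if $(i,j)\in\mathcal{E}$ and $\hat\gamma_{ij}\hat p_{ij}=0$ otherwise. $\mathbf{\Sigma}_{\mathcal{E}}$ is the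 matrix whose entries in $\mathcal{E}$ coincide with those of $\mathbf{\Sigma}$ and whose other entries are zero. Sub-Gaussian norm: for a real random variable $z$, $\Vert z\Vert_{\Psi_2}=\inf\{u>0:\mathbb{E}[\exp(|z|^2/u^2)]\le2\}$. A random vector $\mathbf{z}$ is sub-Gaussian if $\sup_{\Vert\mathbf{u}\Vert=1}\Vert\mathbf{u}^\top\mathbf{z}\Vert_{\Psi_2}<\infty$. Sub-Gaussian assumption on $\mathbf{x}$: (i) $\mathbf{x}$ is a sub-Gaussian vector; therefore there is a constant $c$ with $\mathbb{E}[|\mathbf{u}^\top\mathbf{x}|^r]^{1/r}\le c\Vert\mathbf{u}^\top\mathbf{x}\Vert_{\Psi_2}\sqrt r$ for every unit vector $\mathbf{u}\in\mathbb{R}^n$ and every $r\ge1$. (ii) There is a constant $c_0>0$ such that $c_0\Vert\mathbf{u}^\top\mathbf{x}\Vert_{\Psi_2}^2\le\mathbb{E}(\mathbf{u}^\top\mathbf{x})^2$ for all $\mathbf{u}\in\mathbb{R}^n$.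
   Formalization: C may depend on the constant c_0 of part (ii) of the sub-Gaussian assumption (an absolute C is impossible: sparse ±1 coordinates with probability p→0); C is formally chosen per type of sample space, which transferring the joint law of X and Δ to a canonical space removes. *)

theory Defs
  imports "HOL-Probability.Probability"
begin

(* Vectors in R^n are functions nat => real and matrices functions nat => nat => real; only the
   indices in {1..n} matter.  The dimension is a number, not a type, so that one constant can be
   quantified before it. *)

definition inner_on :: "nat \<Rightarrow> (nat \<Rightarrow> real) \<Rightarrow> (nat \<Rightarrow> real) \<Rightarrow> real" where
  "inner_on n u v = (\<Sum>i\<in>{1..n}. u i * v i)"

definition mat_vec :: "nat \<Rightarrow> (nat \<Rightarrow> nat \<Rightarrow> real) \<Rightarrow> (nat \<Rightarrow> real) \<Rightarrow> nat \<Rightarrow> real" where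
  "mat_vec n A v = (\<lambda>i. \<Sum>j\<in>{1..n}. A i j * v j)"

definition op_norm :: "nat \<Rightarrow> (nat \<Rightarrow> nat \<Rightarrow> real) \<Rightarrow> real" where
  "op_norm n A = (SUP v\<in>{v. L2_set v {1..n} = 1}. L2_set (mat_vec n A v) {1..n})"


(* Extended-valued: the infimum of the empty set is infinity, and the nonnegative integral keeps a
   divergent expectation from satisfying the bound 2. *)
definition psi2_norm :: "'a measure \<Rightarrow> ('a \<Rightarrow> real) \<Rightarrow> ennreal" where
  "psi2_norm M z =
     Inf {ennreal u | u. u > 0 \<and> (\<integral>\<^sup>+ \<omega>. ennreal (exp (\<bar>z \<omega>\<bar>\<^sup>2 / u\<^sup>2)) \<partial>M) \<le> 2}"

definition sub_gaussian_vector :: "'a measure \<Rightarrow> nat \<Rightarrow> ('a \<Rightarrow> nat \<Rightarrow> real) \<Rightarrow> bool" where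
  "sub_gaussian_vector M n z \<longleftrightarrow>
     (SUP u\<in>{u. L2_set u {1..n} = 1}. psi2_norm M (\<lambda>\<omega>. inner_on n u (z \<omega>))) < \<infinity>"

(* The moment bound E[|u^T x|^r]^(1/r) <= c * psi2_norm * sqrt r holds with an absolute constant c
   for every real random variable, so it is a consequence and not a condition here. *)
definition sub_gaussian_assumption :: "'a measure \<Rightarrow> nat \<Rightarrow> ('a \<Rightarrow> nat \<Rightarrow> real) \<Rightarrow> real \<Rightarrow> bool" where
  "sub_gaussian_assumption M n x c\<^sub>0 \<longleftrightarrow>
     sub_gaussian_vector M n x \<and>
     (\<forall>u. ennreal c\<^sub>0 * (psi2_norm M (\<lambda>\<omega>. inner_on n u (x \<omega>)))\<^sup>2
            \<le> ennreal (\<integral>\<omega>. (inner_on n u (x \<omega>))\<^sup>2 \<partial>M))"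

definition covariance_matrix :: "'a measure \<Rightarrow> ('a \<Rightarrow> nat \<Rightarrow> real) \<Rightarrow> nat \<Rightarrow> nat \<Rightarrow> real" where
  "covariance_matrix M x i j = (\<integral>\<omega>. x \<omega> i * x \<omega> j \<partial>M)"


abbreviation vec_space :: "nat \<Rightarrow> (nat \<Rightarrow> real) measure" where
  "vec_space n \<equiv> Pi\<^sub>M {1..n} (\<lambda>_. borel)"

(* n x N matrices, given by their N columns *)
abbreviation mat_space :: "nat \<Rightarrow> nat \<Rightarrow> (nat \<Rightarrow> nat \<Rightarrow> real) measure" where
  "mat_space n N \<equiv> Pi\<^sub>M {1..N} (\<lambda>_. vec_space n)"

abbreviation mask_space :: "nat \<Rightarrow> nat \<Rightarrow> (nat \<Rightarrow> nat \<Rightarrow> real) measure" where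
  "mask_space n N \<equiv> Pi\<^sub>M {1..N} (\<lambda>_. Pi\<^sub>M {1..n} (\<lambda>_. count_space {0, 1}))"

(* X w k i is the i-th coordinate of the k-th sample, and D w k i is 1 iff it is observed.  Placing
   x on the same space as the samples is no restriction, as only its law is used. *)
locale missing_data = prob_space M for M :: "'a measure" +
  fixes n N :: nat
    and x :: "'a \<Rightarrow> nat \<Rightarrow> real"
    and X D :: "'a \<Rightarrow> nat \<Rightarrow> nat \<Rightarrow> real"
  assumes x_random: "random_variable (vec_space n) x"
    and x_square_integrable: "\<And>i. i \<in> {1..n} \<Longrightarrow> integrable M (\<lambda>\<omega>. (x \<omega> i)\<^sup>2)"
    and x_zero_mean: "\<And>i. i \<in> {1..n} \<Longrightarrow> expectation (\<lambda>\<omega>. x \<omega> i) = 0"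
    and covariance_nonzero: "\<exists>i\<in>{1..n}. \<exists>j\<in>{1..n}. covariance_matrix M x i j \<noteq> 0"
    and samples_indep: "indep_vars (\<lambda>_. vec_space n) (\<lambda>k \<omega>. X \<omega> k) {1..N}"
    and samples_distr: "\<And>k. k \<in> {1..N} \<Longrightarrow>
          distr M (vec_space n) (\<lambda>\<omega>. X \<omega> k) = distr M (vec_space n) x"
    and mask_indep: "indep_var (mat_space n N) X (mask_space n N) D"


(* In the following, d and a are a realised mask and a realised data matrix, given by columns. *)

definition p_hat :: "nat \<Rightarrow> (nat \<Rightarrow> nat \<Rightarrow> real) \<Rightarrow> nat \<Rightarrow> nat \<Rightarrow> real" where
  "p_hat N d i j = (1 / real N) * (\<Sum>k\<in>{1..N}. d k i * d k j)"

definition observed_pairs :: "nat \<Rightarrow> (nat \<Rightarrow> nat \<Rightarrow> real) \<Rightarrow> (nat \<times> nat) set" where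
  "observed_pairs n P = {(i, j). i \<in> {1..n} \<and> j \<in> {1..n} \<and> P i j \<noteq> 0}"

definition gamma_hat :: "nat \<Rightarrow> (nat \<Rightarrow> nat \<Rightarrow> real) \<Rightarrow> nat \<Rightarrow> nat \<Rightarrow> real" where
  "gamma_hat N d i j = inverse (max (p_hat N d i j) (1 / real N))"

definition observation ::
    "(nat \<Rightarrow> nat \<Rightarrow> real) \<Rightarrow> (nat \<Rightarrow> nat \<Rightarrow> real) \<Rightarrow> nat \<Rightarrow> nat \<Rightarrow> real" where
  "observation d a k i = d k i * a k i"

definition sigma_hat ::
    "nat \<Rightarrow> (nat \<Rightarrow> nat \<Rightarrow> real) \<Rightarrow> (nat \<Rightarrow> nat \<Rightarrow> real) \<Rightarrow> nat \<Rightarrow> nat \<Rightarrow> real" where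
  "sigma_hat N d a i j =
     ((1 / real N) * (\<Sum>k\<in>{1..N}. observation d a k i * observation d a k j)) * gamma_hat N d i j"

definition restrict_mat :: "(nat \<times> nat) set \<Rightarrow> (nat \<Rightarrow> nat \<Rightarrow> real) \<Rightarrow> nat \<Rightarrow> nat \<Rightarrow> real" where
  "restrict_mat E S i j = (if (i, j) \<in> E then S i j else 0)"

definition r_min :: "nat \<Rightarrow> (nat \<Rightarrow> nat \<Rightarrow> real) \<Rightarrow> (nat \<Rightarrow> nat \<Rightarrow> real) \<Rightarrow> real" where
  "r_min n S P =
     (1 / op_norm n S) *
     Max ((\<lambda>j. \<Sum>i | (i, j) \<in> observed_pairs n P. S i i / P i j) ` {1..n})"

definition r_2 :: "nat \<Rightarrow> (nat \<Rightarrow> nat \<Rightarrow> real) \<Rightarrow> (nat \<Rightarrow> nat \<Rightarrow> real) \<Rightarrow> real" where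
  "r_2 n S P =
     (1 / op_norm n S) *
     sqrt (\<Sum>(i, j)\<in>observed_pairs n P. S i i * S j j / (P i j)\<^sup>2)"

end

theory Submission
  imports Defs
begin

text \<open>Given the mask, \<open>N\<close> times the error is the sum of the centred independent symmetric matrices
  \<open>H\<^sub>k - E H\<^sub>k\<close>, where \<open>H\<^sub>k\<close> is the Hadamard product of \<open>y\<^sub>k y\<^sub>k\<^sup>T\<close> with the matrix of inverse
  observation frequencies.  Symmetrisation and the noncommutative Khintchine inequality
  bound its mean square by \<open>ln n\<close> times the mean of \<open>\<parallel>\<Sum>\<^sub>k H\<^sub>k\<^sup>2\<parallel>\<close>; the same argument applied to the matrices
  \<open>H\<^sub>k\<^sup>2\<close> shows that this mean is at most \<open>\<parallel>\<Sum>\<^sub>k E H\<^sub>k\<^sup>2\<parallel>\<close> plus \<open>ln n\<close> times the size of \<open>max\<^sub>k \<parallel>H\<^sub>k\<parallel>\<^sup>2\<close>.  The first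
  term gives \<open>r_min\<close> by comparing fourth with second moments.  The second gives
  \<open>r_2\<close> because the squared Frobenius norm is a weighted sum of the
  \<open>x\<^sub>i\<^sup>2 x\<^sub>j\<^sup>2\<close>, and the maximum of \<open>N\<close> such products is of order \<open>(ln N)\<^sup>2\<close> by exponential integrability.\<close>

section \<open>Matrix inequalities\<close>

text \<open>The whole argument runs on finite real sums: there are no eigenvalues and no positive
  semidefinite order. An even trace moment is \<open>frob\<close> of a matrix power with itself, and
  an inequality between sums of squares of matrices is a bound on quadratic forms for every vector
  \<open>u\<close>. Khintchine comes from a recursion for trace moments. Flipping one sign moves the
  signed sum by twice one summand, so the resulting difference of odd powers telescopes; this is a
  discrete integration by parts. The deviation Z of the sum of the H_k^2 from its mean obeys a
  self-bounding inequality, E Z^2 <= \<kappa> E[m (\<rho> + Z)] with \<kappa> = 64 e ln n. Half of E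
  Z^2 is absorbed on the left, and only the second moment of the maximum m is left to estimate. The
  data enter only through exponential moments of (u . x)^2 at the scale 2 / \<open>c\<^sub>0\<close>
  times its variance. Fourth-order quantities therefore carry 1 / \<open>c\<^sub>0\<close>^2, and
  after the root C is a number divided by \<open>c\<^sub>0\<close>. From n >= 3 follows ln n > 1, so
  rounding ln n up to an integer costs at most a factor 2. From N >= e^2 follows ln N >= 2, which
  absorbs additive constants into powers of ln N.\<close>

definition mat_mult :: "'i set \<Rightarrow> ('i \<Rightarrow> 'i \<Rightarrow> real) \<Rightarrow> ('i \<Rightarrow> 'i \<Rightarrow> real) \<Rightarrow> 'i \<Rightarrow> 'i \<Rightarrow> real" where
  "mat_mult I A B = (\<lambda>i j. \<Sum>l\<in>I. A i l * B l j)"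

text \<open>The trace inner product tr(A^T B). For symmetric X, \<open>frob\<close> of X^m with
  itself is tr X^(2m), visibly a sum of squares.\<close>

definition frob :: "'i set \<Rightarrow> ('i \<Rightarrow> 'i \<Rightarrow> real) \<Rightarrow> ('i \<Rightarrow> 'i \<Rightarrow> real) \<Rightarrow> real" where
  "frob I A B = (\<Sum>i\<in>I. \<Sum>j\<in>I. A i j * B i j)"

text \<open>Entries outside the index set are forced to vanish (in columns too, by symmetry), so
  that the identity cut off to \<open>I\<close> is a genuine unit and identities between powers hold
  as equalities of functions.\<close>

definition sym_mats :: "'i set \<Rightarrow> ('i \<Rightarrow> 'i \<Rightarrow> real) set" where
  "sym_mats I = {A. (\<forall>i j. A i j = A j i) \<and> (\<forall>i j. i \<notin> I \<longrightarrow> A i j = 0)}"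

primrec mat_pow :: "'i set \<Rightarrow> ('i \<Rightarrow> 'i \<Rightarrow> real) \<Rightarrow> nat \<Rightarrow> 'i \<Rightarrow> 'i \<Rightarrow> real" where
  "mat_pow I A 0 = (\<lambda>i j. if i = j \<and> i \<in> I then 1 else 0)"
| "mat_pow I A (Suc q) = mat_mult I A (mat_pow I A q)"

lemma sym_matsD:
  assumes "A \<in> sym_mats I"
  shows "A i j = A j i" "i \<notin> I \<Longrightarrow> A i j = 0" "j \<notin> I \<Longrightarrow> A i j = 0"
  using assms unfolding sym_mats_def by auto

lemma mat_mult_assoc: "mat_mult I (mat_mult I A B) C = mat_mult I A (mat_mult I B C)"
proof (intro ext)
  fix i j
  have "(\<Sum>l\<in>I. (\<Sum>m\<in>I. A i m * B m l) * C l j) = (\<Sum>l\<in>I. \<Sum>m\<in>I. A i m * (B m l * C l j))"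
    by (simp add: sum_distrib_right mult.assoc)
  also have "\<dots> = (\<Sum>m\<in>I. \<Sum>l\<in>I. A i m * (B m l * C l j))" by (rule sum.swap)
  finally show "mat_mult I (mat_mult I A B) C i j = mat_mult I A (mat_mult I B C) i j"
    by (simp add: mat_mult_def sum_distrib_left)
qed

lemma mat_mult_one_left:
  assumes "finite I" "\<And>i j. i \<notin> I \<Longrightarrow> B i j = 0"
  shows "mat_mult I (mat_pow I A 0) B = B"
proof (intro ext)
  fix i j
  have "(\<Sum>l\<in>I. (if i = l \<and> i \<in> I then 1 else 0) * B l j) = (\<Sum>l\<in>I. if l = i then B i j else 0)"
    by (intro sum.cong) auto
  then show "mat_mult I (mat_pow I A 0) B i j = B i j"
    using assms by (simp add: mat_mult_def)
qed

lemma mat_mult_one_right: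
  assumes "finite I" "\<And>i j. j \<notin> I \<Longrightarrow> B i j = 0"
  shows "mat_mult I B (mat_pow I A 0) = B"
proof (intro ext)
  fix i j
  have "(\<Sum>l\<in>I. B i l * (if l = j \<and> l \<in> I then 1 else 0)) = (\<Sum>l\<in>I. if l = j then B i j else 0)"
    by (intro sum.cong) auto
  then show "mat_mult I B (mat_pow I A 0) i j = B i j"
    using assms by (simp add: mat_mult_def)
qed

lemma mat_pow_outside:
  assumes "A \<in> sym_mats I" "i \<notin> I"
  shows "mat_pow I A q i j = 0"
  using assms by (cases q) (auto simp: mat_mult_def sym_matsD)

lemma mat_pow_add:
  assumes "finite I" "A \<in> sym_mats I"
  shows "mat_mult I (mat_pow I A p) (mat_pow I A q) = mat_pow I A (p + q)"
proof (induction p)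
  case 0
  show ?case using mat_mult_one_left[OF assms(1) mat_pow_outside[OF assms(2)]] by simp
next
  case (Suc p)
  then show ?case by (simp add: mat_mult_assoc)
qed

lemma mat_pow_1:
  assumes "finite I" "A \<in> sym_mats I"
  shows "mat_pow I A (Suc 0) = A"
  using mat_mult_one_right[OF assms(1), of A A] assms(2) by (simp add: sym_matsD)

lemma mat_mult_flip:
  assumes "A \<in> sym_mats I" "B \<in> sym_mats I"
  shows "mat_mult I A B i j = mat_mult I B A j i"
  unfolding mat_mult_def by (intro sum.cong) (auto simp: sym_matsD(1)[OF assms(1), of i] sym_matsD(1)[OF assms(2), of _ j])

lemma mat_pow_sym:
  assumes "finite I" "A \<in> sym_mats I"
  shows "mat_pow I A q \<in> sym_mats I"
proof (induction q)
  case 0 show ?case by (auto simp: sym_mats_def)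
next
  case (Suc q)
  \<comment> \<open>A power commutes with its base, while transposing the product exchanges the two
    factors; together this is symmetry.\<close>
  have "mat_mult I A (mat_pow I A q) = mat_mult I (mat_pow I A q) A"
    using mat_pow_add[OF assms, of q "Suc 0"] by (simp add: mat_pow_1[OF assms] del: mat_pow.simps) simp
  then show ?case
    using mat_mult_flip[OF assms(2) Suc] mat_pow_outside[OF assms(2), of _ "Suc q"]
    by (simp add: sym_mats_def) metis
qed

lemma frob_cong:
  assumes "\<And>i j. i \<in> I \<Longrightarrow> j \<in> I \<Longrightarrow> A i j = A' i j" "\<And>i j. i \<in> I \<Longrightarrow> j \<in> I \<Longrightarrow> B i j = B' i j"
  shows "frob I A B = frob I A' B'"
  using assms by (simp add: frob_def)

lemma frob_flip:
  assumes "A \<in> sym_mats I" "B \<in> sym_mats I" "C \<in> sym_mats I" "D \<in> sym_mats I"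
  shows "frob I (mat_mult I A B) (mat_mult I C D) = frob I (mat_mult I B A) (mat_mult I D C)"
  unfolding frob_def mat_mult_flip[OF assms(1,2)] mat_mult_flip[OF assms(3,4)] by (rule sum.swap)

text \<open>Multiplication by a symmetric matrix is self-adjoint for \<open>frob\<close>. This and
  its right-hand version do the work of cyclicity of the trace.\<close>

lemma frob_mult_left:
  assumes "A \<in> sym_mats I"
  shows "frob I (mat_mult I A B) C = frob I B (mat_mult I A C)"
proof -
  have e: "A i l * B l j * C i j = B l j * (A l i * C i j)" for i j l
    by (simp add: sym_matsD(1)[OF assms, of i l])
  have "frob I (mat_mult I A B) C = (\<Sum>i\<in>I. \<Sum>j\<in>I. \<Sum>l\<in>I. A i l * B l j * C i j)"
    by (simp add: frob_def mat_mult_def sum_distrib_right)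
  also have "\<dots> = (\<Sum>i\<in>I. \<Sum>l\<in>I. \<Sum>j\<in>I. A i l * B l j * C i j)"
    by (intro sum.cong refl sum.swap)
  also have "\<dots> = (\<Sum>l\<in>I. \<Sum>i\<in>I. \<Sum>j\<in>I. A i l * B l j * C i j)" by (rule sum.swap)
  also have "\<dots> = (\<Sum>l\<in>I. \<Sum>j\<in>I. \<Sum>i\<in>I. A i l * B l j * C i j)"
    by (intro sum.cong refl sum.swap)
  also have "\<dots> = frob I B (mat_mult I A C)"
    unfolding frob_def mat_mult_def sum_distrib_left by (intro sum.cong refl e)
  finally show ?thesis .
qed

lemma frob_mult_right:
  assumes "A \<in> sym_mats I"
  shows "frob I (mat_mult I B A) C = frob I B (mat_mult I C A)"
proof -
  have e: "B i l * A l j * C i j = B i l * (C i j * A j l)" for i j l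
    by (simp add: sym_matsD(1)[OF assms, of l j])
  have "(\<Sum>j\<in>I. (\<Sum>l\<in>I. B i l * A l j) * C i j) = (\<Sum>l\<in>I. B i l * (\<Sum>j\<in>I. C i j * A j l))" for i
  proof -
    have "(\<Sum>j\<in>I. (\<Sum>l\<in>I. B i l * A l j) * C i j) = (\<Sum>j\<in>I. \<Sum>l\<in>I. B i l * A l j * C i j)"
      by (simp add: sum_distrib_right)
    also have "\<dots> = (\<Sum>l\<in>I. \<Sum>j\<in>I. B i l * A l j * C i j)" by (rule sum.swap)
    also have "\<dots> = (\<Sum>l\<in>I. B i l * (\<Sum>j\<in>I. C i j * A j l))"
      unfolding sum_distrib_left by (intro sum.cong refl e)
    finally show ?thesis .
  qed
  then show ?thesis by (simp add: frob_def mat_mult_def)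
qed

lemma frob_self: "frob I A A = (\<Sum>i\<in>I. \<Sum>j\<in>I. (A i j)\<^sup>2)"
  by (simp add: frob_def power2_eq_square)

lemma frob_self_nonneg: "0 \<le> frob I A A"
  unfolding frob_self by (intro sum_nonneg) auto

lemma frob_am_gm: "2 * frob I A B \<le> frob I A A + frob I B B"
proof -
  have "2 * (A i j * B i j) \<le> A i j * A i j + B i j * B i j" for i j
    using sum_squares_bound[of "A i j" "B i j"] by (simp add: power2_eq_square)
  then show ?thesis
    unfolding frob_def sum_distrib_left sum.distrib[symmetric]
    by (intro sum_mono) auto
qed

text \<open>The leftmost maximiser cannot lie strictly inside: its left neighbour would be strictly
  smaller and its right neighbour no larger, against midpoint convexity.\<close>

lemma midpoint_convex_le_max:
  fixes g :: "nat \<Rightarrow> real"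
  assumes conv: "\<And>s. 0 < s \<Longrightarrow> s < m \<Longrightarrow> 2 * g s \<le> g (s - 1) + g (s + 1)" and "s \<le> m"
  shows "g s \<le> max (g 0) (g m)"
proof -
  define B where "B = Max (g ` {..m})"
  have le: "g t \<le> B" if "t \<le> m" for t using that by (auto simp: B_def)
  have "B \<in> g ` {..m}" unfolding B_def by (intro Max_in) auto
  then obtain t0 where t0: "t0 \<le> m" "g t0 = B" by auto
  define t where "t = (LEAST t. t \<le> m \<and> g t = B)"
  have t: "t \<le> m" "g t = B" using LeastI[of "\<lambda>t. t \<le> m \<and> g t = B" t0] t0 by (auto simp: t_def)
  have "t = 0 \<or> t = m"
  proof (rule ccontr)
    assume "\<not> ?thesis"
    then have "0 < t" "t < m" using t by auto
    have "g (t - 1) \<noteq> B"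
      using not_less_Least[of "t - 1" "\<lambda>t. t \<le> m \<and> g t = B"] \<open>0 < t\<close> \<open>t < m\<close> by (auto simp: t_def)
    then show False using conv[OF \<open>0 < t\<close> \<open>t < m\<close>] le[of "t - 1"] le[of "t + 1"] t \<open>t < m\<close> by fastforce
  qed
  then show ?thesis using t le[OF \<open>s \<le> m\<close>] by auto
qed

text \<open>In an eigenbasis this is the inequality between \<open>\<lambda>\<^sup>a \<mu>\<^sup>b\<close> and \<open>\<lambda>\<^bsup>2m\<^esup> + \<mu>\<^bsup>2m\<^esup>\<close>; the
  Cauchy--Schwarz inequality makes the even-indexed values midpoint convex, which replaces the
  spectral theorem.\<close>

lemma frob_interpolation:
  assumes fin: "finite I" and W: "W \<in> sym_mats I" and Y: "Y \<in> sym_mats I" and ab: "a + b = 2 * m"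
  shows "frob I H (mat_mult I (mat_pow I W a) (mat_mult I H (mat_pow I Y b)))
    \<le> frob I (mat_mult I (mat_pow I W m) H) (mat_mult I (mat_pow I W m) H)
      + frob I (mat_mult I H (mat_pow I Y m)) (mat_mult I H (mat_pow I Y m))"
proof -
  define w where "w = mat_pow I W"
  define y where "y = mat_pow I Y"
  \<comment> \<open>\<open>Z\<close> moves from W^m H at \<open>s = 0\<close> to H Y^m at
    \<open>s = m\<close>. The inner product of \<open>Z s\<close> and \<open>Z t\<close> depends on
    \<open>s + t\<close> only, so Cauchy-Schwarz for \<open>s - 1\<close> and \<open>s + 1\<close>
    is convexity of \<open>g\<close> at \<open>s\<close>.\<close>
  define Z where "Z = (\<lambda>s. mat_mult I (w (m - s)) (mat_mult I H (y s)))"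
  define g where "g = (\<lambda>s. frob I (Z s) (Z s))"
  note sw = mat_pow_sym[OF fin W, folded w_def] and sy = mat_pow_sym[OF fin Y, folded y_def]
  note aw = mat_pow_add[OF fin W, folded w_def] and ay = mat_pow_add[OF fin Y, folded y_def]
  have Zst: "frob I (Z s) (Z t) = frob I H (mat_mult I (w (2 * m - s - t)) (mat_mult I H (y (s + t))))"
    if "s \<le> m" "t \<le> m" for s t
  proof -
    have "frob I (Z s) (Z t) = frob I (mat_mult I H (y s))
        (mat_mult I (mat_mult I (w (m - s)) (w (m - t))) (mat_mult I H (y t)))"
      by (simp add: Z_def frob_mult_left[OF sw] mat_mult_assoc)
    also have "\<dots> = frob I H (mat_mult I (w (m - s + (m - t))) (mat_mult I H (mat_mult I (y t) (y s))))"
      by (simp add: aw frob_mult_right[OF sy] mat_mult_assoc)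
    also have "m - s + (m - t) = 2 * m - s - t" using that by simp
    finally show ?thesis by (simp add: ay add.commute)
  qed
  have mid: "2 * frob I H (mat_mult I (w (2 * m - s - t)) (mat_mult I H (y (s + t)))) \<le> g s + g t"
    if "s \<le> m" "t \<le> m" for s t
    unfolding Zst[OF that, symmetric] g_def by (rule frob_am_gm)
  have gmax: "g s \<le> max (g 0) (g m)" if "s \<le> m" for s
  proof (rule midpoint_convex_le_max[OF _ that])
    fix s assume s: "0 < s" "s < m"
    then have "g s = frob I H (mat_mult I (w (2 * m - (s-1) - (s+1))) (mat_mult I H (y ((s-1) + (s+1)))))"
      unfolding g_def by (subst Zst) (auto simp: mult_2 algebra_simps)
    then show "2 * g s \<le> g (s - 1) + g (s + 1)" using mid[of "s - 1" "s + 1"] s by simp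
  qed
  have g0: "g 0 = frob I (mat_mult I (w m) H) (mat_mult I (w m) H)"
  proof -
    have "mat_mult I H (y 0) i j = H i j" if "j \<in> I" for i j
    proof -
      have "(\<Sum>l\<in>I. H i l * (if l = j \<and> l \<in> I then 1 else 0)) = (\<Sum>l\<in>I. if l = j then H i j else 0)"
        by (intro sum.cong) auto
      then show ?thesis using fin that by (simp add: mat_mult_def y_def)
    qed
    then show ?thesis
      unfolding g_def Z_def by (intro frob_cong) (auto simp: mat_mult_def)
  qed
  have gm: "g m = frob I (mat_mult I H (y m)) (mat_mult I H (y m))"
  proof -
    have "mat_mult I (w 0) B i j = B i j" if "i \<in> I" for i j B
    proof -
      have "(\<Sum>l\<in>I. (if i = l \<and> i \<in> I then 1 else 0) * B l j) = (\<Sum>l\<in>I. if l = i then B i j else 0)"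
        by (intro sum.cong) (use that in auto)
      then show ?thesis using fin that by (simp add: mat_mult_def w_def)
    qed
    then show ?thesis
      unfolding g_def Z_def by (intro frob_cong) auto
  qed
  have nn: "g 0 \<ge> 0" "g m \<ge> 0" by (auto simp: g_def frob_self_nonneg)
  \<comment> \<open>\<open>g\<close> sees only even exponents \<open>2 * s\<close>. A general
    \<open>b\<close>, odd ones included, is reached as the inner product of \<open>Z s\<close> and
    \<open>Z t\<close> with \<open>s + t = b\<close>.\<close>
  obtain s t where st: "s \<le> m" "t \<le> m" "b = s + t"
  proof (cases "b \<le> m")
    case True then show ?thesis using that[of b 0] by auto
  next
    case False then show ?thesis using that[of m "b - m"] ab by auto
  qed
  then have "a = 2 * m - s - t" using ab by auto
  then have "2 * frob I H (mat_mult I (w a) (mat_mult I H (y b))) \<le> g s + g t" using mid st by simp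
  also have "\<dots> \<le> 2 * max (g 0) (g m)" using gmax[OF st(1)] gmax[OF st(2)] by linarith
  also have "\<dots> \<le> 2 * (g 0 + g m)" using nn by auto
  finally show ?thesis unfolding g0 gm by (simp add: w_def y_def)
qed

lemma frob_mult_diff:
  assumes "\<And>i j. X i j - Y i j = c * A i j"
  shows "frob I B (mat_mult I X P) - frob I B (mat_mult I Y P) = c * frob I B (mat_mult I A P)"
proof -
  have X: "X i j = Y i j + c * A i j" for i j using assms[of i j] by simp
  show ?thesis
    by (simp add: frob_def mat_mult_def X algebra_simps sum.distrib sum_distrib_left sum_distrib_right)
qed

text \<open>Telescoping: X^(m+1) - Y^(m+1) is the sum of X^q (X - Y) Y^(m-q). The induction needs an
  arbitrary \<open>B\<close>, because the factor X that is split off is moved onto \<open>B\<close>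
  by self-adjointness.\<close>

lemma frob_pow_diff:
  assumes fin: "finite I" and X: "X \<in> sym_mats I" and A: "A \<in> sym_mats I"
    and XY: "\<And>i j. X i j - Y i j = c * A i j"
  shows "frob I B (mat_pow I X (Suc m)) - frob I B (mat_pow I Y (Suc m)) =
    c * (\<Sum>q\<le>m. frob I B (mat_mult I (mat_pow I X q) (mat_mult I A (mat_pow I Y (m - q)))))"
proof (induction m arbitrary: B)
  case 0
  have "mat_mult I (mat_pow I X 0) (mat_mult I A P) = mat_mult I A P" for P
    by (rule mat_mult_one_left[OF fin]) (simp add: mat_mult_def sym_matsD[OF A])
  then show ?case using frob_mult_diff[OF XY] by simp
next
  case (Suc m)
  have one: "mat_mult I (mat_pow I X 0) (mat_mult I A P) = mat_mult I A P" for P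
    by (rule mat_mult_one_left[OF fin]) (simp add: mat_mult_def sym_matsD[OF A])
  have "frob I B (mat_pow I X (Suc (Suc m))) - frob I B (mat_pow I Y (Suc (Suc m))) =
    (frob I (mat_mult I X B) (mat_pow I X (Suc m)) - frob I (mat_mult I X B) (mat_pow I Y (Suc m)))
    + (frob I B (mat_mult I X (mat_pow I Y (Suc m))) - frob I B (mat_mult I Y (mat_pow I Y (Suc m))))"
    unfolding frob_mult_left[OF X] by simp
  also have "\<dots> = c * (\<Sum>q\<le>m. frob I B (mat_mult I (mat_pow I X (Suc q)) (mat_mult I A (mat_pow I Y (m - q)))))
    + c * frob I B (mat_mult I (mat_pow I X 0) (mat_mult I A (mat_pow I Y (Suc m))))"
    unfolding Suc frob_mult_diff[OF XY] one
    by (simp add: frob_mult_left[OF X] mat_mult_assoc)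
  also have "\<dots> = c * (\<Sum>q\<le>Suc m. frob I B (mat_mult I (mat_pow I X q) (mat_mult I A (mat_pow I Y (Suc m - q)))))"
    by (subst sum.atMost_Suc_shift) (simp add: algebra_simps del: mat_pow.simps)
  finally show ?case .
qed

section \<open>Trace moments of signed sums\<close>

definition sign_of :: "'k set \<Rightarrow> 'k \<Rightarrow> real" where
  "sign_of J k = (if k \<in> J then 1 else -1)"

text \<open>A vector of random signs is encoded by the set \<open>J\<close> where the sign is +1.
  Expectation over the signs is then a sum over \<open>Pow K\<close>, with the normalisation 2^card
  K carried along on the other side.\<close>

definition signed_sum :: "'k set \<Rightarrow> ('k \<Rightarrow> 'i \<Rightarrow> 'i \<Rightarrow> real) \<Rightarrow> 'k set \<Rightarrow> 'i \<Rightarrow> 'i \<Rightarrow> real" where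
  "signed_sum K A J = (\<lambda>i j. \<Sum>k\<in>K. sign_of J k * A k i j)"

lemma signed_sum_sym:
  assumes "\<And>k. k \<in> K \<Longrightarrow> A k \<in> sym_mats I"
  shows "signed_sum K A J \<in> sym_mats I"
proof -
  have "A k i j = A k j i" if "k \<in> K" for i j k
    using sym_matsD(1)[OF assms[OF that]] by blast
  then have "signed_sum K A J i j = signed_sum K A J j i" for i j
    unfolding signed_sum_def by (intro sum.cong refl) metis
  moreover have "signed_sum K A J i j = 0" if "i \<notin> I" for i j
    unfolding signed_sum_def by (intro sum.neutral) (simp add: sym_matsD(2)[OF assms that])
  ultimately show ?thesis by (auto simp: sym_mats_def)
qed

lemma sum_flip:
  assumes "k \<in> K"
  shows "(\<Sum>J\<in>Pow K. f (if k \<in> J then J - {k} else insert k J)) = (\<Sum>J\<in>Pow K. f J)"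
proof -
  define fl where "fl = (\<lambda>J. if k \<in> J then J - {k} else insert k J)"
  have "fl (fl J) = J" "J \<in> Pow K \<Longrightarrow> fl J \<in> Pow K" for J
    using assms by (auto simp: fl_def)
  then have "(\<Sum>J\<in>Pow K. f (fl J)) = (\<Sum>J\<in>Pow K. f J)"
    by (intro sum.reindex_bij_witness[of _ fl fl]) auto
  then show ?thesis by (simp add: fl_def)
qed

lemma signed_sum_flip:
  assumes "finite K" "k \<in> K"
  shows "signed_sum K A J i j - signed_sum K A (if k \<in> J then J - {k} else insert k J) i j
    = (2 * sign_of J k) * A k i j"
proof -
  have "signed_sum K A J i j - signed_sum K A (if k \<in> J then J - {k} else insert k J) i j
    = (\<Sum>l\<in>K. if l = k then 2 * sign_of J k * A k i j else 0)"
    unfolding signed_sum_def sum_subtractf[symmetric]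
  proof (rule sum.cong[OF refl])
    fix l
    show "sign_of J l * A l i j - sign_of (if k \<in> J then J - {k} else insert k J) l * A l i j =
      (if l = k then 2 * sign_of J k * A k i j else 0)"
      by (cases "l = k"; cases "k \<in> J"; simp add: sign_of_def)
  qed
  then show ?thesis using assms by simp
qed

text \<open>The squared Frobenius norm adds up over columns, so the hypothesis is applied with
  \<open>u\<close> running through the columns of \<open>P\<close>.\<close>

lemma sum_frob_mult_le:
  assumes v: "\<And>u. (\<Sum>k\<in>K. \<Sum>i\<in>I. (\<Sum>j\<in>I. A k i j * u j)\<^sup>2) \<le> v * (\<Sum>j\<in>I. (u j)\<^sup>2)"
  shows "(\<Sum>k\<in>K. frob I (mat_mult I (A k) P) (mat_mult I (A k) P)) \<le> v * frob I P P"
proof -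
  have "(\<Sum>k\<in>K. frob I (mat_mult I (A k) P) (mat_mult I (A k) P))
    = (\<Sum>k\<in>K. \<Sum>j\<in>I. \<Sum>i\<in>I. (\<Sum>l\<in>I. A k i l * P l j)\<^sup>2)"
    unfolding frob_self mat_mult_def by (rule sum.cong[OF refl], rule sum.swap)
  also have "\<dots> = (\<Sum>j\<in>I. \<Sum>k\<in>K. \<Sum>i\<in>I. (\<Sum>l\<in>I. A k i l * P l j)\<^sup>2)" by (rule sum.swap)
  also have "\<dots> \<le> (\<Sum>j\<in>I. v * (\<Sum>l\<in>I. (P l j)\<^sup>2))" by (intro sum_mono v)
  also have "\<dots> = v * frob I P P"
    unfolding frob_self sum_distrib_left by (rule sum.swap)
  finally show ?thesis .
qed

text \<open>Write tr X^(2m+2) as the sum over k of sign_k tr(A_k X^(2m+1)), and pair each sign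
  pattern with the one flipped at k, whose signed sum is Y. The difference of the two powers
  telescopes into 2m+1 terms tr(A_k X^q A_k Y^(2m-q)). Interpolation bounds each of them by the
  extreme terms |A_k X^m|^2 + |A_k Y^m|^2, and the sum of these over k is controlled by
  \<open>v\<close>.\<close>

lemma trace_moment_step:
  fixes A :: "'k \<Rightarrow> 'i \<Rightarrow> 'i \<Rightarrow> real"
  assumes K: "finite K" and I: "finite I" and A: "\<And>k. k \<in> K \<Longrightarrow> A k \<in> sym_mats I"
    and v: "\<And>u. (\<Sum>k\<in>K. \<Sum>i\<in>I. (\<Sum>j\<in>I. A k i j * u j)\<^sup>2) \<le> v * (\<Sum>j\<in>I. (u j)\<^sup>2)"
  defines "X \<equiv> signed_sum K A"
  defines "T \<equiv> (\<lambda>m J. frob I (mat_pow I (X J) m) (mat_pow I (X J) m))"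
  shows "(\<Sum>J\<in>Pow K. T (Suc m) J) \<le> 2 * (2 * real m + 1) * v * (\<Sum>J\<in>Pow K. T m J)"
proof -
  note X = signed_sum_sym[of K A I, OF A, folded X_def]
  define fl where "fl = (\<lambda>k J. if k \<in> J then J - {k} else insert k (J::'k set))"
  define Q where "Q = (\<lambda>k J. frob I (mat_mult I (A k) (mat_pow I (X J) m)) (mat_mult I (A k) (mat_pow I (X J) m)))"
  define h where "h = (\<lambda>k J. frob I (A k) (mat_pow I (X J) (Suc (2 * m))))"
  have T: "T (Suc m) J = (\<Sum>k\<in>K. sign_of J k * h k J)" for J
  proof -
    have "T (Suc m) J = frob I (mat_mult I (mat_pow I (X J) m) (mat_pow I (X J) (Suc 0))) (mat_pow I (X J) (Suc m))"
      unfolding T_def by (subst mat_pow_add[OF I X]) (simp_all del: mat_pow.simps)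
    also have "\<dots> = frob I (X J) (mat_mult I (mat_pow I (X J) m) (mat_pow I (X J) (Suc m)))"
      by (simp only: mat_pow_1[OF I X] frob_mult_left[OF mat_pow_sym[OF I X]])
    also have "\<dots> = frob I (X J) (mat_pow I (X J) (Suc (2 * m)))"
      by (subst mat_pow_add[OF I X]) (simp_all add: mult_2 del: mat_pow.simps)
    also have "\<dots> = (\<Sum>i\<in>I. \<Sum>j\<in>I. \<Sum>k\<in>K. sign_of J k * A k i j * mat_pow I (X J) (Suc (2 * m)) i j)"
      by (simp add: frob_def X_def signed_sum_def sum_distrib_right del: mat_pow.simps)
    also have "\<dots> = (\<Sum>i\<in>I. \<Sum>k\<in>K. \<Sum>j\<in>I. sign_of J k * A k i j * mat_pow I (X J) (Suc (2 * m)) i j)"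
      by (intro sum.cong refl sum.swap)
    also have "\<dots> = (\<Sum>k\<in>K. \<Sum>i\<in>I. \<Sum>j\<in>I. sign_of J k * A k i j * mat_pow I (X J) (Suc (2 * m)) i j)"
      by (rule sum.swap)
    also have "\<dots> = (\<Sum>k\<in>K. sign_of J k * h k J)"
      by (simp add: h_def frob_def sum_distrib_left mult.assoc del: mat_pow.simps)
    finally show ?thesis .
  qed
  have pair: "sign_of J k * h k J - sign_of J k * h k (fl k J) \<le> 2 * (2 * real m + 1) * (Q k J + Q k (fl k J))"
    if k: "k \<in> K" for J k
  proof -
    define Y where "Y = X (fl k J)"
    have XY: "X J i j - Y i j = (2 * sign_of J k) * A k i j" for i j
      unfolding X_def Y_def fl_def by (rule signed_sum_flip[OF K k])
    have "h k J - h k (fl k J) = (2 * sign_of J k) *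
        (\<Sum>q\<le>2*m. frob I (A k) (mat_mult I (mat_pow I (X J) q) (mat_mult I (A k) (mat_pow I Y (2 * m - q)))))"
      unfolding h_def Y_def[symmetric] by (rule frob_pow_diff[OF I X A[OF k] XY])
    then have "sign_of J k * h k J - sign_of J k * h k (fl k J) = (2 * (sign_of J k * sign_of J k)) *
        (\<Sum>q\<le>2*m. frob I (A k) (mat_mult I (mat_pow I (X J) q) (mat_mult I (A k) (mat_pow I Y (2 * m - q)))))"
      by (simp add: right_diff_distrib[symmetric])
    also have "sign_of J k * sign_of J k = 1" by (simp add: sign_of_def)
    also have "2 * 1 * (\<Sum>q\<le>2*m. frob I (A k) (mat_mult I (mat_pow I (X J) q) (mat_mult I (A k) (mat_pow I Y (2 * m - q)))))
      \<le> 2 * 1 * (\<Sum>q\<le>2*m. frob I (mat_mult I (mat_pow I (X J) m) (A k)) (mat_mult I (mat_pow I (X J) m) (A k))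
      + frob I (mat_mult I (A k) (mat_pow I Y m)) (mat_mult I (A k) (mat_pow I Y m)))"
      unfolding Y_def by (intro mult_left_mono sum_mono frob_interpolation[OF I X X]) auto
    also have "\<dots> = 2 * (2 * real m + 1) * (Q k J + Q k (fl k J))"
      using frob_flip[OF mat_pow_sym[OF I X] A[OF k] mat_pow_sym[OF I X] A[OF k], of J m J m]
      by (simp add: Q_def Y_def algebra_simps)
    finally show ?thesis .
  qed
  have coord: "(\<Sum>J\<in>Pow K. sign_of J k * h k J) \<le> 2 * (2 * real m + 1) * (\<Sum>J\<in>Pow K. Q k J)"
    if k: "k \<in> K" for k
  proof -
    \<comment> \<open>Reindexing by the flip turns the sign around, so the sum is half a sum of
      differences between paired patterns.\<close>
    have "(\<Sum>J\<in>Pow K. sign_of J k * h k J) = (\<Sum>J\<in>Pow K. sign_of (fl k J) k * h k (fl k J))"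
      unfolding fl_def by (rule sum_flip[OF k, symmetric])
    also have "\<dots> = (\<Sum>J\<in>Pow K. - sign_of J k * h k (fl k J))"
      by (intro sum.cong) (auto simp: fl_def sign_of_def)
    finally have "2 * (\<Sum>J\<in>Pow K. sign_of J k * h k J) =
        (\<Sum>J\<in>Pow K. sign_of J k * h k J - sign_of J k * h k (fl k J))"
      by (simp add: sum_subtractf sum_negf)
    also have "\<dots> \<le> (\<Sum>J\<in>Pow K. 2 * (2 * real m + 1) * (Q k J + Q k (fl k J)))"
      by (intro sum_mono pair[OF k])
    also have "\<dots> = 2 * (2 * real m + 1) * ((\<Sum>J\<in>Pow K. Q k J) + (\<Sum>J\<in>Pow K. Q k (fl k J)))"
      by (simp add: sum_distrib_left sum.distrib[symmetric])
    also have "(\<Sum>J\<in>Pow K. Q k (fl k J)) = (\<Sum>J\<in>Pow K. Q k J)"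
      unfolding fl_def by (rule sum_flip[OF k])
    finally show ?thesis by simp
  qed
  have "(\<Sum>J\<in>Pow K. T (Suc m) J) = (\<Sum>k\<in>K. \<Sum>J\<in>Pow K. sign_of J k * h k J)"
    unfolding T by (rule sum.swap)
  also have "\<dots> \<le> (\<Sum>k\<in>K. 2 * (2 * real m + 1) * (\<Sum>J\<in>Pow K. Q k J))"
    by (intro sum_mono coord)
  also have "\<dots> = 2 * (2 * real m + 1) * (\<Sum>J\<in>Pow K. \<Sum>k\<in>K. Q k J)"
    unfolding sum_distrib_left[symmetric] by (subst sum.swap) (rule refl)
  also have "\<dots> \<le> 2 * (2 * real m + 1) * (\<Sum>J\<in>Pow K. v * T m J)"
    unfolding Q_def T_def by (intro mult_left_mono sum_mono sum_frob_mult_le[OF v]) auto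
  finally show ?thesis by (simp add: sum_distrib_left[symmetric] mult.assoc)
qed

text \<open>For m < p the factor 2 (2m + 1) of one step is at most 4p. The recursion starts at
  tr(identity) = \<open>card I\<close> for each of the 2^card K sign patterns.\<close>

lemma trace_moment_bound:
  fixes A :: "'k \<Rightarrow> 'i \<Rightarrow> 'i \<Rightarrow> real"
  assumes K: "finite K" and I: "finite I" and A: "\<And>k. k \<in> K \<Longrightarrow> A k \<in> sym_mats I"
    and v: "\<And>u. (\<Sum>k\<in>K. \<Sum>i\<in>I. (\<Sum>j\<in>I. A k i j * u j)\<^sup>2) \<le> v * (\<Sum>j\<in>I. (u j)\<^sup>2)"
    and v0: "v \<ge> 0" and mp: "m \<le> p"
  shows "(\<Sum>J\<in>Pow K. frob I (mat_pow I (signed_sum K A J) m) (mat_pow I (signed_sum K A J) m))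
    \<le> 2 ^ card K * real (card I) * (4 * real p * v) ^ m"
  using mp
proof (induction m)
  case 0
  have "frob I (mat_pow I B 0) (mat_pow I B 0) = (\<Sum>i\<in>I. \<Sum>j\<in>I. if j = i then 1 else 0)" for B :: "'i \<Rightarrow> 'i \<Rightarrow> real"
    unfolding frob_def by (intro sum.cong refl) auto
  then have "frob I (mat_pow I B 0) (mat_pow I B 0) = real (card I)" for B :: "'i \<Rightarrow> 'i \<Rightarrow> real"
    using I by simp
  then show ?case using K by (simp add: card_Pow del: mat_pow.simps)
next
  case (Suc m)
  let ?S = "\<lambda>m. \<Sum>J\<in>Pow K. frob I (mat_pow I (signed_sum K A J) m) (mat_pow I (signed_sum K A J) m)"
  have "?S (Suc m) \<le> 2 * (2 * real m + 1) * v * ?S m"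
    by (rule trace_moment_step[OF K I A v])
  also have "\<dots> \<le> (4 * real p * v) * ?S m"
    using Suc.prems v0 by (intro mult_right_mono sum_nonneg frob_self_nonneg) auto
  also have "\<dots> \<le> (4 * real p * v) * (2 ^ card K * real (card I) * (4 * real p * v) ^ m)"
    using Suc v0 by (intro mult_left_mono) auto
  finally show ?case by (simp add: mult_ac del: mat_pow.simps)
qed


section \<open>The operator norm and its comparison with trace moments\<close>

lemma mat_vec_sq_le_frob:
  "(\<Sum>i\<in>{1..n}. (mat_vec n A v i)\<^sup>2) \<le> frob {1..n} A A * (\<Sum>i\<in>{1..n}. (v i)\<^sup>2)"
proof -
  have "(mat_vec n A v i)\<^sup>2 \<le> (\<Sum>j\<in>{1..n}. (A i j)\<^sup>2) * (\<Sum>i\<in>{1..n}. (v i)\<^sup>2)" for i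
    unfolding mat_vec_def by (rule Cauchy_Schwarz_ineq_sum)
  then show ?thesis
    unfolding frob_self sum_distrib_right by (intro sum_mono) auto
qed

lemma L2_set_eq_1_iff: "L2_set v A = 1 \<longleftrightarrow> (\<Sum>i\<in>A. (v i)\<^sup>2) = 1"
  by (simp add: L2_set_def)

lemma unit_vector_exists:
  fixes n :: nat
  assumes "n \<ge> 1"
  shows "{v. L2_set v {1..n} = 1} \<noteq> {}"
proof -
  have "(\<Sum>i\<in>{1..n}. (if i = 1 then 1 else 0 :: real)\<^sup>2) = (\<Sum>i\<in>{1::nat}. (if i = 1 then 1 else 0 :: real)\<^sup>2)"
    by (rule sum.mono_neutral_right) (use assms in auto)
  also have "\<dots> = 1" by simp
  finally have "L2_set (\<lambda>i. if i = 1 then 1 else 0) {1..n} = 1"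
    unfolding L2_set_eq_1_iff .
  then show ?thesis by blast
qed

lemma op_norm_bdd: "bdd_above ((\<lambda>v. L2_set (mat_vec n A v) {1..n}) ` {v. L2_set v {1..n} = 1})"
proof (rule bdd_aboveI2)
  fix v assume "v \<in> {v. L2_set v {1..n} = 1}"
  then show "L2_set (mat_vec n A v) {1..n} \<le> sqrt (frob {1..n} A A)"
    using mat_vec_sq_le_frob[of n A v] by (simp add: L2_set_eq_1_iff L2_set_def[of "mat_vec n A v"])
qed

lemma op_norm_nonneg:
  assumes "n \<ge> 1"
  shows "0 \<le> op_norm n A"
proof -
  obtain v where "v \<in> {v. L2_set v {1..n} = 1}" using unit_vector_exists[OF assms] by auto
  then have "L2_set (mat_vec n A v) {1..n} \<le> op_norm n A"
    unfolding op_norm_def by (intro cSUP_upper op_norm_bdd)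
  then show ?thesis using L2_set_nonneg order_trans by blast
qed

lemma mat_vec_sq_le_op_norm:
  assumes "n \<ge> 1"
  shows "(\<Sum>i\<in>{1..n}. (mat_vec n A v i)\<^sup>2) \<le> (op_norm n A)\<^sup>2 * (\<Sum>i\<in>{1..n}. (v i)\<^sup>2)"
proof (cases "(\<Sum>i\<in>{1..n}. (v i)\<^sup>2) = 0")
  case True
  then show ?thesis using mat_vec_sq_le_frob[of n A v] by simp
next
  case False
  define r where "r = sqrt (\<Sum>i\<in>{1..n}. (v i)\<^sup>2)"
  have r: "r > 0" "r\<^sup>2 = (\<Sum>i\<in>{1..n}. (v i)\<^sup>2)"
    using False sum_nonneg[of "{1..n}" "\<lambda>i. (v i)\<^sup>2"] by (auto simp: r_def less_le)
  have "L2_set (\<lambda>i. v i / r) {1..n} = 1"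
    unfolding L2_set_eq_1_iff power_divide sum_divide_distrib[symmetric] r(2)[symmetric]
    using r(1) by simp
  then have "L2_set (mat_vec n A (\<lambda>i. v i / r)) {1..n} \<le> op_norm n A"
    unfolding op_norm_def by (intro cSUP_upper op_norm_bdd) auto
  then have "(\<Sum>i\<in>{1..n}. (mat_vec n A (\<lambda>i. v i / r) i)\<^sup>2) \<le> (op_norm n A)\<^sup>2"
    unfolding L2_set_def using real_sqrt_le_iff by (metis real_le_lsqrt real_sqrt_unique sqrt_le_D)
  moreover have "mat_vec n A (\<lambda>i. v i / r) i = mat_vec n A v i / r" for i
    by (simp add: mat_vec_def sum_divide_distrib)
  ultimately have "(\<Sum>i\<in>{1..n}. (mat_vec n A v i)\<^sup>2) / r\<^sup>2 \<le> (op_norm n A)\<^sup>2"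
    by (simp add: power_divide sum_divide_distrib[symmetric])
  then show ?thesis unfolding r(2)[symmetric] using r(1) by (simp add: pos_divide_le_eq)
qed

lemma op_norm_sq_le:
  assumes n: "n \<ge> 1" and B: "\<And>v. (\<Sum>i\<in>{1..n}. (v i)\<^sup>2) = 1 \<Longrightarrow> (\<Sum>i\<in>{1..n}. (mat_vec n A v i)\<^sup>2) \<le> B"
  shows "(op_norm n A)\<^sup>2 \<le> B"
proof -
  have "op_norm n A \<le> sqrt B"
    unfolding op_norm_def using unit_vector_exists[OF n]
  proof (rule cSUP_least)
    fix v :: "nat \<Rightarrow> real" assume "v \<in> {v. L2_set v {1..n} = 1}"
    then show "L2_set (mat_vec n A v) {1..n} \<le> sqrt B"
      using B[of v] by (simp add: L2_set_eq_1_iff L2_set_def[of "mat_vec n A v"])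
  qed
  then show ?thesis using op_norm_nonneg[OF n, of A] by (metis order_trans real_sqrt_ge_0_iff sqrt_le_D real_sqrt_unique real_sqrt_le_iff real_sqrt_abs abs_of_nonneg)
qed

lemma op_norm_sq_le_frob: "n \<ge> 1 \<Longrightarrow> (op_norm n A)\<^sup>2 \<le> frob {1..n} A A"
  using mat_vec_sq_le_frob[of n A] by (intro op_norm_sq_le) (auto, metis mult.right_neutral)

lemma mat_vec_mult: "mat_vec n (mat_mult {1..n} A B) v = mat_vec n A (mat_vec n B v)"
proof
  fix i
  have "(\<Sum>j\<in>{1..n}. (\<Sum>l\<in>{1..n}. A i l * B l j) * v j) = (\<Sum>j\<in>{1..n}. \<Sum>l\<in>{1..n}. A i l * (B l j * v j))"
    by (simp add: sum_distrib_right mult.assoc)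
  also have "\<dots> = (\<Sum>l\<in>{1..n}. \<Sum>j\<in>{1..n}. A i l * (B l j * v j))" by (rule sum.swap)
  finally show "mat_vec n (mat_mult {1..n} A B) v i = mat_vec n A (mat_vec n B v) i"
    by (simp add: mat_mult_def mat_vec_def sum_distrib_left)
qed

lemma mat_vec_adjoint:
  assumes "A \<in> sym_mats {1..n}"
  shows "(\<Sum>i\<in>{1..n}. mat_vec n A u i * w i) = (\<Sum>i\<in>{1..n}. u i * mat_vec n A w i)"
proof -
  have e: "A i j * u j * w i = u j * (A j i * w i)" for i j
    by (simp add: sym_matsD(1)[OF assms, of i j])
  have "(\<Sum>i\<in>{1..n}. mat_vec n A u i * w i) = (\<Sum>i\<in>{1..n}. \<Sum>j\<in>{1..n}. A i j * u j * w i)"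
    by (simp add: mat_vec_def sum_distrib_right)
  also have "\<dots> = (\<Sum>j\<in>{1..n}. \<Sum>i\<in>{1..n}. A i j * u j * w i)" by (rule sum.swap)
  also have "\<dots> = (\<Sum>i\<in>{1..n}. u i * mat_vec n A w i)"
    unfolding mat_vec_def sum_distrib_left e ..
  finally show ?thesis .
qed

lemma power_le_of_log_convex:
  fixes h :: "nat \<Rightarrow> real"
  assumes h: "\<And>s. 0 \<le> h s" "h 0 = 1" "\<And>s. (h (Suc s))\<^sup>2 \<le> h s * h (Suc (Suc s))"
  shows "(h 1) ^ p \<le> h p"
proof (cases "h 1 = 0")
  case True
  then show ?thesis using h by (cases p) auto
next
  case False
  have step: "h s > 0 \<and> h 1 * h s \<le> h (Suc s)" for s
  proof (induction s)
    case 0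
    show ?case using h by simp
  next
    case (Suc s)
    have pos: "h (Suc s) > 0"
      using Suc False h(1)[of 1] by (smt (verit) mult_pos_pos)
    have "h (Suc s) * (h 1 * h s) \<le> h (Suc s) * h (Suc s)" using Suc pos by simp
    also have "\<dots> \<le> h s * h (Suc (Suc s))" using h(3)[of s] by (simp add: power2_eq_square)
    finally have "h s * (h 1 * h (Suc s)) \<le> h s * h (Suc (Suc s))" by (simp add: mult_ac)
    then show ?case using Suc pos by simp
  qed
  show ?thesis
  proof (induction p)
    case 0 show ?case using h by simp
  next
    case (Suc p)
    have "h 1 * h 1 ^ p \<le> h 1 * h p" using Suc h by (intro mult_left_mono) auto
    then show ?case using step[of p] by simp
  qed
qed

text \<open>Without eigenvalues: s -> |X^s v|^2 is log-convex by symmetry of X and Cauchy-Schwarz,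
  hence |X v|^(2p) <= |X^p v|^2 <= tr X^(2p).\<close>

lemma mat_vec_power_le_trace:
  assumes X: "X \<in> sym_mats {1..n}" and v: "(\<Sum>i\<in>{1..n}. (v i)\<^sup>2) = 1"
  shows "(\<Sum>i\<in>{1..n}. (mat_vec n X v i)\<^sup>2) ^ p \<le> frob {1..n} (mat_pow {1..n} X p) (mat_pow {1..n} X p)"
proof -
  define y where "y = (\<lambda>s. mat_vec n (mat_pow {1..n} X s) v)"
  have yS: "y (Suc s) = mat_vec n X (y s)" for s
    unfolding y_def mat_pow.simps mat_vec_mult ..
  have y0: "y 0 i = v i" if "i \<in> {1..n}" for i
  proof -
    have "(\<Sum>j\<in>{1..n}. (if i = j \<and> i \<in> {1..n} then 1 else 0) * v j) = (\<Sum>j\<in>{1..n}. if j = i then v i else 0)"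
      by (intro sum.cong) (use that in auto)
    then show ?thesis using that by (simp add: y_def mat_vec_def)
  qed
  define h where "h = (\<lambda>s. \<Sum>i\<in>{1..n}. (y s i)\<^sup>2)"
  have "(h 1) ^ p \<le> h p"
  proof (rule power_le_of_log_convex)
    show "0 \<le> h s" for s by (simp add: h_def sum_nonneg)
    show "h 0 = 1" using v y0 by (simp add: h_def)
    fix s
    have "h (Suc s) = (\<Sum>i\<in>{1..n}. mat_vec n X (y s) i * y (Suc s) i)"
      by (simp add: h_def yS power2_eq_square)
    also have "\<dots> = (\<Sum>i\<in>{1..n}. y s i * y (Suc (Suc s)) i)"
      unfolding yS by (rule mat_vec_adjoint[OF X])
    finally have "(h (Suc s))\<^sup>2 = (\<Sum>i\<in>{1..n}. y s i * y (Suc (Suc s)) i)\<^sup>2" by simp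
    then show "(h (Suc s))\<^sup>2 \<le> h s * h (Suc (Suc s))"
      unfolding h_def using Cauchy_Schwarz_ineq_sum by metis
  qed
  moreover have "h 1 = (\<Sum>i\<in>{1..n}. (mat_vec n X v i)\<^sup>2)"
  proof -
    have "mat_vec n X (y 0) = mat_vec n X v"
      unfolding mat_vec_def[of n X] using y0 by auto
    then show ?thesis by (simp add: h_def yS)
  qed
  moreover have "h p \<le> frob {1..n} (mat_pow {1..n} X p) (mat_pow {1..n} X p)"
    using mat_vec_sq_le_frob[of n "mat_pow {1..n} X p" v] unfolding h_def y_def v by simp
  ultimately show ?thesis by simp
qed

text \<open>A linear substitute for extracting a root: with a fixed threshold \<open>t\<close> it
  can be summed over all sign patterns, and \<open>t\<close> is optimised afterwards.\<close>

lemma le_add_power_div: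
  fixes a t :: real
  assumes "a \<ge> 0" "t > 0"
  shows "a \<le> t + a ^ Suc p / t ^ p"
proof (cases "a \<le> t")
  case True
  then show ?thesis using assms by (simp add: add_increasing2)
next
  case False
  have "a * t ^ p \<le> a * a ^ p" using False assms by (intro mult_left_mono power_mono) auto
  then have "a \<le> a ^ Suc p / t ^ p" using assms by (simp add: pos_le_divide_eq)
  then show ?thesis using assms by simp
qed

text \<open>Bounding the operator norm by the trace moment of order \<open>2p\<close> with \<open>p\<close> about \<open>ln n\<close> costs only the constant factor \<open>n\<^bsup>1/p\<^esup>\<close>.\<close>

lemma matrix_khintchine:
  fixes A :: "'k \<Rightarrow> nat \<Rightarrow> nat \<Rightarrow> real"
  assumes K: "finite K" and n: "n \<ge> 3" and A: "\<And>k. k \<in> K \<Longrightarrow> A k \<in> sym_mats {1..n}"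
    and v: "\<And>u. (\<Sum>k\<in>K. \<Sum>i\<in>{1..n}. (\<Sum>j\<in>{1..n}. A k i j * u j)\<^sup>2) \<le> v * (\<Sum>j\<in>{1..n}. (u j)\<^sup>2)"
  shows "(\<Sum>J\<in>Pow K. (op_norm n (signed_sum K A J))\<^sup>2) \<le> 2 ^ card K * (16 * exp 1 * ln (real n) * v)"
proof -
  have ln3: "ln (real n) > 1"
  proof -
    have "exp 1 < real n" using e_less_272 n by linarith
    then show ?thesis using n by (metis exp_gt_zero exp_less_cancel_iff exp_ln order_less_trans)
  qed
  \<comment> \<open>The moment order is \<open>Suc p\<close>, which is ln n rounded up. It lies
    between ln n and 2 ln n because ln n > 1.\<close>
  define p where "p = nat \<lceil>ln (real n)\<rceil> - 1"
  have p: "real (Suc p) \<ge> ln (real n)" "real (Suc p) \<le> 2 * ln (real n)"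
    using ln3 unfolding p_def by linarith+
  \<comment> \<open>The threshold \<open>t\<close> must be positive, but \<open>v\<close> may be 0.
    The bound is proved for every positive \<open>w >= v\<close>, and \<open>w\<close> then tends to
    \<open>v\<close> from the right.\<close>
  have main: "(\<Sum>J\<in>Pow K. (op_norm n (signed_sum K A J))\<^sup>2) \<le> 2 ^ card K * (16 * exp 1 * ln (real n) * w)"
    if w: "w > 0" "w \<ge> v" for w
  proof -
    have vw: "(\<Sum>k\<in>K. \<Sum>i\<in>{1..n}. (\<Sum>j\<in>{1..n}. A k i j * u j)\<^sup>2) \<le> w * (\<Sum>j\<in>{1..n}. (u j)\<^sup>2)" for u
      using v[of u] mult_right_mono[OF w(2), of "\<Sum>j\<in>{1..n}. (u j)\<^sup>2"] by (simp add: sum_nonneg)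
    define s where "s = 4 * real (Suc p) * w"
    \<comment> \<open>With \<open>t = e * s\<close> the trace term n s^(p+1) / t^p equals t n /
      e^(p+1), which is at most \<open>t\<close>, so the two terms of the bound balance.\<close>
    define t where "t = exp 1 * s"
    have st: "s > 0" "t > 0" using w by (auto simp: s_def t_def)
    define T where "T = (\<lambda>J. frob {1..n} (mat_pow {1..n} (signed_sum K A J) (Suc p)) (mat_pow {1..n} (signed_sum K A J) (Suc p)))"
    have "(op_norm n (signed_sum K A J))\<^sup>2 \<le> t + T J / t ^ p" for J
    proof (rule op_norm_sq_le)
      fix u :: "nat \<Rightarrow> real" assume u: "(\<Sum>i\<in>{1..n}. (u i)\<^sup>2) = 1"
      let ?a = "\<Sum>i\<in>{1..n}. (mat_vec n (signed_sum K A J) u i)\<^sup>2"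
      have "?a \<le> t + ?a ^ Suc p / t ^ p" by (rule le_add_power_div) (auto simp: st sum_nonneg)
      also have "\<dots> \<le> t + T J / t ^ p"
        unfolding T_def using st
        by (intro add_left_mono divide_right_mono mat_vec_power_le_trace signed_sum_sym A u) auto
      finally show "?a \<le> t + T J / t ^ p" .
    qed (use n in auto)
    then have "(\<Sum>J\<in>Pow K. (op_norm n (signed_sum K A J))\<^sup>2) \<le> (\<Sum>J\<in>Pow K. t + T J / t ^ p)"
      by (intro sum_mono)
    also have "\<dots> = 2 ^ card K * t + (\<Sum>J\<in>Pow K. T J) / t ^ p"
      using K by (simp add: sum.distrib sum_divide_distrib card_Pow)
    also have "(\<Sum>J\<in>Pow K. T J) / t ^ p \<le> 2 ^ card K * real n * s ^ Suc p / t ^ p"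
      using trace_moment_bound[OF K _ A vw, of "Suc p" "Suc p"] w st
      unfolding T_def s_def by (intro divide_right_mono) (auto simp del: mat_pow.simps)
    also have "2 ^ card K * real n * s ^ Suc p / t ^ p = 2 ^ card K * (t * (real n / exp (real (Suc p))))"
    proof -
      have "exp (real (Suc p)) = exp 1 * exp 1 ^ p"
        by (metis exp_of_nat_mult mult.right_neutral power_Suc)
      then show ?thesis using st by (simp add: t_def power_mult_distrib field_simps)
    qed
    also have "\<dots> \<le> 2 ^ card K * (t * 1)"
    proof -
      have "real n \<le> exp (real (Suc p))"
        using p(1) n by (metis exp_le_cancel_iff exp_ln of_nat_0_less_iff less_le_trans zero_less_numeral)
      then have "real n / exp (real (Suc p)) \<le> 1" by simp
      then show ?thesis using st by (intro mult_left_mono) auto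
    qed
    finally have "(\<Sum>J\<in>Pow K. (op_norm n (signed_sum K A J))\<^sup>2) \<le> 2 ^ card K * (2 * t)" by (simp add: mult_ac)
    also have "2 * t \<le> 16 * exp 1 * ln (real n) * w"
      using p(2) w by (simp add: t_def s_def)
    finally show ?thesis by simp
  qed
  have v0: "v \<ge> 0"
  proof -
    have "0 \<le> (\<Sum>k\<in>K. \<Sum>i\<in>{1..n}. (\<Sum>j\<in>{1..n}. A k i j * 1)\<^sup>2)" by (intro sum_nonneg) auto
    also have "\<dots> \<le> v * (\<Sum>j\<in>{1..n}. 1\<^sup>2)" by (rule v)
    finally show ?thesis using n by (simp add: zero_le_mult_iff)
  qed
  have "((\<lambda>w. 2 ^ card K * (16 * exp 1 * ln (real n) * w)) \<longlongrightarrow> 2 ^ card K * (16 * exp 1 * ln (real n) * v)) (at_right v)"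
    by (intro tendsto_intros)
  moreover have "eventually (\<lambda>w. (\<Sum>J\<in>Pow K. (op_norm n (signed_sum K A J))\<^sup>2) \<le> 2 ^ card K * (16 * exp 1 * ln (real n) * w)) (at_right v)"
    using eventually_at_right_less by (rule eventually_mono) (use v0 in \<open>auto intro!: main\<close>)
  ultimately show ?thesis by (rule tendsto_lowerbound) simp
qed

section \<open>Sums of independent random matrices\<close>

declare One_nat_def [simp del]

section \<open>Measurability and convexity of the operator norm\<close>

lemma op_norm_cong:
  assumes "\<And>i j. i \<in> {1..n} \<Longrightarrow> j \<in> {1..n} \<Longrightarrow> A i j = B i j"
  shows "op_norm n A = op_norm n B"
proof -
  have "L2_set (mat_vec n A v) {1..n} = L2_set (mat_vec n B v) {1..n}" for v
    unfolding mat_vec_def using assms by (intro L2_set_cong sum.cong refl) simp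
  then show ?thesis by (simp add: op_norm_def)
qed

text \<open>Rational vectors suffice by density and continuity, which leaves countably many
  conditions; measurability of the norm rests on this. The use of \<open>PiE\<close> fixes the
  irrelevant coordinates and so keeps the set of test vectors countable.\<close>

lemma op_norm_le_iff:
  assumes n: "n \<ge> 1" and c: "c \<ge> 0"
  shows "op_norm n A \<le> c \<longleftrightarrow>
    (\<forall>v\<in>PiE {1..n} (\<lambda>_. \<rat>). (\<Sum>i\<in>{1..n}. (mat_vec n A v i)\<^sup>2) \<le> c\<^sup>2 * (\<Sum>i\<in>{1..n}. (v i)\<^sup>2))"
proof
  assume "op_norm n A \<le> c"
  then have "(op_norm n A)\<^sup>2 \<le> c\<^sup>2" using op_norm_nonneg[OF n] by (intro power_mono) auto
  then have "(op_norm n A)\<^sup>2 * (\<Sum>i\<in>{1..n}. (v i)\<^sup>2) \<le> c\<^sup>2 * (\<Sum>i\<in>{1..n}. (v i)\<^sup>2)" for v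
    by (intro mult_right_mono sum_nonneg) auto
  then show "\<forall>v\<in>PiE {1..n} (\<lambda>_. \<rat>). (\<Sum>i\<in>{1..n}. (mat_vec n A v i)\<^sup>2) \<le> c\<^sup>2 * (\<Sum>i\<in>{1..n}. (v i)\<^sup>2)"
    using mat_vec_sq_le_op_norm[OF n] order_trans by blast
next
  assume R: "\<forall>v\<in>PiE {1..n} (\<lambda>_. \<rat>). (\<Sum>i\<in>{1..n}. (mat_vec n A v i)\<^sup>2) \<le> c\<^sup>2 * (\<Sum>i\<in>{1..n}. (v i)\<^sup>2)"
  have "(\<Sum>i\<in>{1..n}. (mat_vec n A v i)\<^sup>2) \<le> c\<^sup>2 * (\<Sum>i\<in>{1..n}. (v i)\<^sup>2)" for v :: "nat \<Rightarrow> real"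
  proof -
    have "\<exists>q. (\<forall>m. q m \<in> \<rat>) \<and> q \<longlonglongrightarrow> v i" for i
      using closure_sequential[of "v i" \<rat>] by (simp add: Rats_closure_real)
    then obtain q where q: "\<And>i m. q i m \<in> \<rat>" "\<And>i. q i \<longlonglongrightarrow> v i" by metis
    define w where "w = (\<lambda>m. restrict (\<lambda>i. q i m) {1..n})"
    have w: "(\<lambda>m. w m i) \<longlonglongrightarrow> v i" if "i \<in> {1..n}" for i
      using q(2)[of i] that by (simp add: w_def)
    have "w m \<in> PiE {1..n} (\<lambda>_. \<rat>)" for m using q by (auto simp: w_def)
    then have "(\<Sum>i\<in>{1..n}. (mat_vec n A (w m) i)\<^sup>2) \<le> c\<^sup>2 * (\<Sum>i\<in>{1..n}. (w m i)\<^sup>2)" for m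
      using R by blast
    moreover have "(\<lambda>m. \<Sum>i\<in>{1..n}. (mat_vec n A (w m) i)\<^sup>2) \<longlonglongrightarrow> (\<Sum>i\<in>{1..n}. (mat_vec n A v i)\<^sup>2)"
      unfolding mat_vec_def by (intro tendsto_intros w)
    moreover have "(\<lambda>m. c\<^sup>2 * (\<Sum>i\<in>{1..n}. (w m i)\<^sup>2)) \<longlonglongrightarrow> c\<^sup>2 * (\<Sum>i\<in>{1..n}. (v i)\<^sup>2)"
      by (intro tendsto_intros w)
    ultimately show ?thesis by (intro LIMSEQ_le) auto
  qed
  then have "(op_norm n A)\<^sup>2 \<le> c\<^sup>2" by (intro op_norm_sq_le[OF n]) (metis mult.right_neutral)
  then show "op_norm n A \<le> c" using c power2_le_imp_le by blast
qed

lemma measurable_op_norm: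
  assumes n: "n \<ge> 1"
    and f: "\<And>i j. i \<in> {1..n} \<Longrightarrow> j \<in> {1..n} \<Longrightarrow> (\<lambda>\<omega>. f \<omega> i j) \<in> borel_measurable M"
  shows "(\<lambda>\<omega>. op_norm n (f \<omega>)) \<in> borel_measurable M"
proof (rule borel_measurableI_le)
  fix c :: real
  show "{\<omega> \<in> space M. op_norm n (f \<omega>) \<le> c} \<in> sets M"
  proof (cases "c \<ge> 0")
    case False
    then have "\<not> op_norm n (f \<omega>) \<le> c" for \<omega>
      using op_norm_nonneg[OF n, of "f \<omega>"] by linarith
    then show ?thesis by simp
  next
    case True
    have [measurable]: "(\<lambda>\<omega>. mat_vec n (f \<omega>) v i) \<in> borel_measurable M" if "i \<in> {1..n}" for v i
      unfolding mat_vec_def using f that by (intro borel_measurable_sum borel_measurable_times) auto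
    have "countable (PiE {1..n} (\<lambda>_. \<rat> :: real set))"
      by (intro countable_PiE) (auto simp: countable_rat)
    moreover have "{\<omega> \<in> space M. (\<Sum>i\<in>{1..n}. (mat_vec n (f \<omega>) v i)\<^sup>2) \<le> c\<^sup>2 * (\<Sum>i\<in>{1..n}. (v i)\<^sup>2)} \<in> sets M" for v
      by measurable
    moreover have all: "{\<omega> \<in> space M. \<forall>v\<in>R. Q \<omega> v} = space M - (\<Union>v\<in>R. space M - {\<omega> \<in> space M. Q \<omega> v})"
      for R :: "(nat \<Rightarrow> real) set" and Q by auto
    ultimately show ?thesis
      unfolding op_norm_le_iff[OF n True] all
      by (intro sets.Diff sets.countable_UN') auto
  qed
qed

text \<open>Convexity of the squared norm in the one form that symmetrisation uses, applied to each
  vector separately.\<close>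

lemma op_norm_sq_midpoint:
  assumes n: "n \<ge> 1"
    and C: "\<And>i j. i \<in> {1..n} \<Longrightarrow> j \<in> {1..n} \<Longrightarrow> 2 * C i j = A i j + B i j"
  shows "2 * (op_norm n C)\<^sup>2 \<le> (op_norm n A)\<^sup>2 + (op_norm n B)\<^sup>2"
proof -
  have "(op_norm n C)\<^sup>2 \<le> ((op_norm n A)\<^sup>2 + (op_norm n B)\<^sup>2) / 2"
  proof (rule op_norm_sq_le[OF n])
    fix v :: "nat \<Rightarrow> real" assume v: "(\<Sum>i\<in>{1..n}. (v i)\<^sup>2) = 1"
    have "mat_vec n C v i = (mat_vec n A v i + mat_vec n B v i) / 2" if "i \<in> {1..n}" for i
    proof -
      have "C i j = (A i j + B i j) / 2" if "j \<in> {1..n}" for j using C[OF \<open>i \<in> {1..n}\<close> that] by simp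
      then have "mat_vec n C v i = (\<Sum>j\<in>{1..n}. (A i j + B i j) / 2 * v j)"
        unfolding mat_vec_def by (intro sum.cong refl) auto
      also have "\<dots> = (\<Sum>j\<in>{1..n}. (A i j * v j + B i j * v j) / 2)"
        by (intro sum.cong refl) (simp add: algebra_simps add_divide_distrib)
      finally show ?thesis by (simp add: mat_vec_def sum_divide_distrib[symmetric] sum.distrib)
    qed
    then have "(\<Sum>i\<in>{1..n}. (mat_vec n C v i)\<^sup>2) = (\<Sum>i\<in>{1..n}. ((mat_vec n A v i + mat_vec n B v i) / 2)\<^sup>2)"
      by (intro sum.cong refl arg_cong[of _ _ "\<lambda>z. z\<^sup>2"])
    also have "\<dots> \<le> (\<Sum>i\<in>{1..n}. ((mat_vec n A v i)\<^sup>2 + (mat_vec n B v i)\<^sup>2) / 2)"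
    proof (rule sum_mono)
      fix i
      show "((mat_vec n A v i + mat_vec n B v i) / 2)\<^sup>2 \<le> ((mat_vec n A v i)\<^sup>2 + (mat_vec n B v i)\<^sup>2) / 2"
        using sum_squares_bound[of "mat_vec n A v i" "mat_vec n B v i"]
        by (simp add: power2_eq_square field_simps)
    qed
    also have "\<dots> = ((\<Sum>i\<in>{1..n}. (mat_vec n A v i)\<^sup>2) + (\<Sum>i\<in>{1..n}. (mat_vec n B v i)\<^sup>2)) / 2"
      by (simp add: sum_divide_distrib[symmetric] sum.distrib)
    also have "\<dots> \<le> ((op_norm n A)\<^sup>2 + (op_norm n B)\<^sup>2) / 2"
      using mat_vec_sq_le_op_norm[OF n, of A v] mat_vec_sq_le_op_norm[OF n, of B v] unfolding v by simp
    finally show "(\<Sum>i\<in>{1..n}. (mat_vec n C v i)\<^sup>2) \<le> ((op_norm n A)\<^sup>2 + (op_norm n B)\<^sup>2) / 2" .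
  qed
  then show ?thesis by simp
qed

lemma op_norm_scale_sq:
  assumes n: "n \<ge> 1"
  shows "(op_norm n (\<lambda>i j. c * A i j))\<^sup>2 \<le> c\<^sup>2 * (op_norm n A)\<^sup>2"
proof (rule op_norm_sq_le[OF n])
  fix v :: "nat \<Rightarrow> real" assume v: "(\<Sum>i\<in>{1..n}. (v i)\<^sup>2) = 1"
  have "mat_vec n (\<lambda>i j. c * A i j) v i = c * mat_vec n A v i" for i
    by (simp add: mat_vec_def sum_distrib_left mult.assoc)
  then have "(\<Sum>i\<in>{1..n}. (mat_vec n (\<lambda>i j. c * A i j) v i)\<^sup>2) = c\<^sup>2 * (\<Sum>i\<in>{1..n}. (mat_vec n A v i)\<^sup>2)"
    by (simp add: power_mult_distrib sum_distrib_left)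
  also have "\<dots> \<le> c\<^sup>2 * ((op_norm n A)\<^sup>2 * 1)"
    using mat_vec_sq_le_op_norm[OF n, of A v] unfolding v by (intro mult_left_mono) auto
  finally show "(\<Sum>i\<in>{1..n}. (mat_vec n (\<lambda>i j. c * A i j) v i)\<^sup>2) \<le> c\<^sup>2 * (op_norm n A)\<^sup>2" by simp
qed

section \<open>Jensen's inequality and symmetrisation\<close>

lemma (in prob_space) square_expectation_le:
  fixes Z :: "'a \<Rightarrow> real"
  assumes "Z \<in> borel_measurable M" "integrable M (\<lambda>\<omega>. (Z \<omega>)\<^sup>2)"
  shows "(expectation Z)\<^sup>2 \<le> expectation (\<lambda>\<omega>. (Z \<omega>)\<^sup>2)"
  using variance_eq[OF square_integrable_imp_integrable[OF assms] assms(2)] variance_positive[of Z] by simp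

lemma integrable_square_sum:
  fixes f :: "'i \<Rightarrow> 'a \<Rightarrow> real"
  assumes I: "finite I" and m: "\<And>i. i \<in> I \<Longrightarrow> f i \<in> borel_measurable M"
    and s: "\<And>i. i \<in> I \<Longrightarrow> integrable M (\<lambda>\<omega>. (f i \<omega>)\<^sup>2)"
  shows "integrable M (\<lambda>\<omega>. (\<Sum>i\<in>I. f i \<omega>)\<^sup>2)"
proof (rule Bochner_Integration.integrable_bound)
  show "integrable M (\<lambda>\<omega>. (\<Sum>i\<in>I. (f i \<omega>)\<^sup>2) * real (card I))"
    using s by (intro integrable_mult_left Bochner_Integration.integrable_sum) auto
  show "(\<lambda>\<omega>. (\<Sum>i\<in>I. f i \<omega>)\<^sup>2) \<in> borel_measurable M" using m by measurable
  show "AE \<omega> in M. norm ((\<Sum>i\<in>I. f i \<omega>)\<^sup>2) \<le> norm ((\<Sum>i\<in>I. (f i \<omega>)\<^sup>2) * real (card I))"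
  proof (rule AE_I2)
    fix \<omega>
    have "(\<Sum>i\<in>I. f i \<omega> * 1)\<^sup>2 \<le> (\<Sum>i\<in>I. (f i \<omega>)\<^sup>2) * (\<Sum>i\<in>I. 1\<^sup>2)"
      by (rule Cauchy_Schwarz_ineq_sum)
    then show "norm ((\<Sum>i\<in>I. f i \<omega>)\<^sup>2) \<le> norm ((\<Sum>i\<in>I. (f i \<omega>)\<^sup>2) * real (card I))"
      by (simp add: sum_nonneg)
  qed
qed

text \<open>For a fixed unit vector, scalar Jensen is applied to each coordinate of H v. The sum of
  the resulting second moments is at most the mean of the squared norm, a bound free of v, so the
  supremum can be taken. Integrability comes from the Frobenius norm.\<close>

lemma (in prob_space) op_norm_sq_jensen:
  fixes H :: "'a \<Rightarrow> nat \<Rightarrow> nat \<Rightarrow> real"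
  assumes n: "n \<ge> 1"
    and m: "\<And>i j. i \<in> {1..n} \<Longrightarrow> j \<in> {1..n} \<Longrightarrow> (\<lambda>\<omega>. H \<omega> i j) \<in> borel_measurable M"
    and s: "\<And>i j. i \<in> {1..n} \<Longrightarrow> j \<in> {1..n} \<Longrightarrow> integrable M (\<lambda>\<omega>. (H \<omega> i j)\<^sup>2)"
  shows "integrable M (\<lambda>\<omega>. (op_norm n (H \<omega>))\<^sup>2)"
    and "(op_norm n (\<lambda>i j. expectation (\<lambda>\<omega>. H \<omega> i j)))\<^sup>2 \<le> expectation (\<lambda>\<omega>. (op_norm n (H \<omega>))\<^sup>2)"
proof -
  have frob_int: "integrable M (\<lambda>\<omega>. frob {1..n} (H \<omega>) (H \<omega>))"
    unfolding frob_self using s by (intro Bochner_Integration.integrable_sum) auto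
  have [measurable]: "(\<lambda>\<omega>. op_norm n (H \<omega>)) \<in> borel_measurable M"
    by (rule measurable_op_norm[OF n m])
  show int: "integrable M (\<lambda>\<omega>. (op_norm n (H \<omega>))\<^sup>2)"
    by (rule Bochner_Integration.integrable_bound[OF frob_int])
      (use op_norm_sq_le_frob[OF n] in \<open>auto simp: frob_self_nonneg intro!: AE_I2\<close>)
  show "(op_norm n (\<lambda>i j. expectation (\<lambda>\<omega>. H \<omega> i j)))\<^sup>2 \<le> expectation (\<lambda>\<omega>. (op_norm n (H \<omega>))\<^sup>2)"
  proof (rule op_norm_sq_le[OF n])
    fix v :: "nat \<Rightarrow> real" assume v: "(\<Sum>i\<in>{1..n}. (v i)\<^sup>2) = 1"
    have mv: "(\<lambda>\<omega>. mat_vec n (H \<omega>) v i) \<in> borel_measurable M" if "i \<in> {1..n}" for i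
      unfolding mat_vec_def using m that by (intro borel_measurable_sum borel_measurable_times) auto
    have sv: "integrable M (\<lambda>\<omega>. (mat_vec n (H \<omega>) v i)\<^sup>2)" if "i \<in> {1..n}" for i
      unfolding mat_vec_def using m s that
      by (intro integrable_square_sum) (auto simp: power_mult_distrib)
    have E: "mat_vec n (\<lambda>i j. expectation (\<lambda>\<omega>. H \<omega> i j)) v i = expectation (\<lambda>\<omega>. mat_vec n (H \<omega>) v i)"
      if "i \<in> {1..n}" for i
      unfolding mat_vec_def using square_integrable_imp_integrable[OF m s] that
      by (subst Bochner_Integration.integral_sum) auto
    have "(\<Sum>i\<in>{1..n}. (mat_vec n (\<lambda>i j. expectation (\<lambda>\<omega>. H \<omega> i j)) v i)\<^sup>2)
        \<le> (\<Sum>i\<in>{1..n}. expectation (\<lambda>\<omega>. (mat_vec n (H \<omega>) v i)\<^sup>2))"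
      by (intro sum_mono) (simp add: E square_expectation_le mv sv del: atLeastAtMost_iff)
    also have "\<dots> = expectation (\<lambda>\<omega>. \<Sum>i\<in>{1..n}. (mat_vec n (H \<omega>) v i)\<^sup>2)"
      using sv by (subst Bochner_Integration.integral_sum) auto
    also have "\<dots> \<le> expectation (\<lambda>\<omega>. (op_norm n (H \<omega>))\<^sup>2)"
      using sv int mat_vec_sq_le_op_norm[OF n, of _ v] unfolding v
      by (intro integral_mono Bochner_Integration.integrable_sum) auto
    finally show "(\<Sum>i\<in>{1..n}. (mat_vec n (\<lambda>i j. expectation (\<lambda>\<omega>. H \<omega> i j)) v i)\<^sup>2)
        \<le> expectation (\<lambda>\<omega>. (op_norm n (H \<omega>))\<^sup>2)" .
  qed
qed

text \<open>No independent copy is introduced: B + (H - E H) is the midpoint of B + 2 H and B - 2 E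
  H, and Jensen draws the expectation out of the latter. The right-hand side is twice the average
  over a random sign in front of 2 H. The matrix \<open>B\<close> stands for all other
  summands.\<close>

lemma (in prob_space) symmetrize_one:
  fixes H :: "'a \<Rightarrow> nat \<Rightarrow> nat \<Rightarrow> real"
  assumes n: "n \<ge> 1"
    and m: "\<And>i j. i \<in> {1..n} \<Longrightarrow> j \<in> {1..n} \<Longrightarrow> (\<lambda>\<omega>. H \<omega> i j) \<in> borel_measurable M"
    and s: "\<And>i j. i \<in> {1..n} \<Longrightarrow> j \<in> {1..n} \<Longrightarrow> integrable M (\<lambda>\<omega>. (H \<omega> i j)\<^sup>2)"
  shows "2 * (\<integral>\<^sup>+\<omega>. ennreal ((op_norm n (\<lambda>i j. B i j + (H \<omega> i j - expectation (\<lambda>\<omega>. H \<omega> i j))))\<^sup>2) \<partial>M)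
    \<le> (\<integral>\<^sup>+\<omega>. ennreal ((op_norm n (\<lambda>i j. B i j + 2 * H \<omega> i j))\<^sup>2) \<partial>M)
      + (\<integral>\<^sup>+\<omega>. ennreal ((op_norm n (\<lambda>i j. B i j - 2 * H \<omega> i j))\<^sup>2) \<partial>M)"
proof -
  let ?E = "\<lambda>i j. expectation (\<lambda>\<omega>. H \<omega> i j)"
  let ?D = "(op_norm n (\<lambda>i j. B i j - 2 * ?E i j))\<^sup>2"
  have [measurable]: "(\<lambda>\<omega>. op_norm n (\<lambda>i j. B i j + (H \<omega> i j - ?E i j))) \<in> borel_measurable M"
    "(\<lambda>\<omega>. op_norm n (\<lambda>i j. B i j + 2 * H \<omega> i j)) \<in> borel_measurable M"
    "(\<lambda>\<omega>. op_norm n (\<lambda>i j. B i j - 2 * H \<omega> i j)) \<in> borel_measurable M"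
    using m by (auto intro!: measurable_op_norm[OF n] borel_measurable_add borel_measurable_diff borel_measurable_times)
  have HI: "integrable M (\<lambda>\<omega>. H \<omega> i j)" if "i \<in> {1..n}" "j \<in> {1..n}" for i j
    using square_integrable_imp_integrable[OF m s] that by blast
  have sq: "integrable M (\<lambda>\<omega>. (B i j - 2 * H \<omega> i j)\<^sup>2)" if "i \<in> {1..n}" "j \<in> {1..n}" for i j
    unfolding power2_diff using HI[OF that] s[OF that]
    by (intro Bochner_Integration.integrable_add Bochner_Integration.integrable_diff)
       (auto simp: power_mult_distrib)
  have mm: "(\<lambda>\<omega>. B i j - 2 * H \<omega> i j) \<in> borel_measurable M" if "i \<in> {1..n}" "j \<in> {1..n}" for i j
    using m[OF that] by simp
  have "op_norm n (\<lambda>i j. B i j - 2 * ?E i j) = op_norm n (\<lambda>i j. expectation (\<lambda>\<omega>. B i j - 2 * H \<omega> i j))"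
    using HI by (intro op_norm_cong) (auto simp: prob_space)
  then have "?D \<le> expectation (\<lambda>\<omega>. (op_norm n (\<lambda>i j. B i j - 2 * H \<omega> i j))\<^sup>2)"
    using op_norm_sq_jensen(2)[OF n mm sq] by simp
  then have D: "ennreal ?D \<le> (\<integral>\<^sup>+\<omega>. ennreal ((op_norm n (\<lambda>i j. B i j - 2 * H \<omega> i j))\<^sup>2) \<partial>M)"
    by (subst nn_integral_eq_integral[OF op_norm_sq_jensen(1)[OF n mm sq]]) (auto intro!: ennreal_leI)
  have mid: "2 * (op_norm n (\<lambda>i j. B i j + (H \<omega> i j - ?E i j)))\<^sup>2
      \<le> (op_norm n (\<lambda>i j. B i j + 2 * H \<omega> i j))\<^sup>2 + ?D" for \<omega>
    by (rule op_norm_sq_midpoint[OF n]) simp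
  have "2 * (\<integral>\<^sup>+\<omega>. ennreal ((op_norm n (\<lambda>i j. B i j + (H \<omega> i j - ?E i j)))\<^sup>2) \<partial>M)
    = (\<integral>\<^sup>+\<omega>. ennreal (2 * (op_norm n (\<lambda>i j. B i j + (H \<omega> i j - ?E i j)))\<^sup>2) \<partial>M)"
    by (subst nn_integral_cmult[symmetric]) (auto simp: ennreal_mult intro!: nn_integral_cong)
  also have "\<dots> \<le> (\<integral>\<^sup>+\<omega>. ennreal ((op_norm n (\<lambda>i j. B i j + 2 * H \<omega> i j))\<^sup>2) + ennreal ?D \<partial>M)"
    using mid by (intro nn_integral_mono) (auto simp: ennreal_plus[symmetric] simp del: ennreal_plus intro!: ennreal_leI)
  also have "\<dots> = (\<integral>\<^sup>+\<omega>. ennreal ((op_norm n (\<lambda>i j. B i j + 2 * H \<omega> i j))\<^sup>2) \<partial>M) + ennreal ?D"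
    by (subst nn_integral_add) (auto simp: emeasure_space_1)
  finally show ?thesis using D by (meson add_left_mono order_trans)
qed

text \<open>Summands are symmetrised one by one, using Fubini on the product measure.
  \<open>B\<close> is arbitrary so that a summand whose variable is frozen can be put into it.
  Nonnegative integrals allow every exchange of integrals without integrability of the
  norms.\<close>

lemma symmetrize:
  fixes \<mu> :: "'b measure" and H :: "'k \<Rightarrow> 'b \<Rightarrow> nat \<Rightarrow> nat \<Rightarrow> real"
  assumes \<mu>: "prob_space \<mu>" and n: "n \<ge> 1" and K: "finite K"
    and m: "\<And>k i j. k \<in> K \<Longrightarrow> i \<in> {1..n} \<Longrightarrow> j \<in> {1..n} \<Longrightarrow> (\<lambda>\<omega>. H k \<omega> i j) \<in> borel_measurable \<mu>"
    and s: "\<And>k i j. k \<in> K \<Longrightarrow> i \<in> {1..n} \<Longrightarrow> j \<in> {1..n} \<Longrightarrow> integrable \<mu> (\<lambda>\<omega>. (H k \<omega> i j)\<^sup>2)"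
  shows "2 ^ card K * (\<integral>\<^sup>+x. ennreal ((op_norm n (\<lambda>i j. B i j
        + (\<Sum>k\<in>K. H k (x k) i j - (\<integral>\<omega>. H k \<omega> i j \<partial>\<mu>))))\<^sup>2) \<partial>Pi\<^sub>M K (\<lambda>_. \<mu>))
    \<le> (\<Sum>J\<in>Pow K. \<integral>\<^sup>+x. ennreal ((op_norm n (\<lambda>i j. B i j
        + 2 * signed_sum K (\<lambda>k. H k (x k)) J i j))\<^sup>2) \<partial>Pi\<^sub>M K (\<lambda>_. \<mu>))"
  using K m s
proof (induction K arbitrary: B)
  case empty
  then show ?case by (simp add: signed_sum_def)
next
  case (insert a K)
  interpret \<mu>: prob_space \<mu> by fact
  interpret product_sigma_finite "\<lambda>_::'k. \<mu>" by standard
  let ?P = "\<lambda>K. Pi\<^sub>M K (\<lambda>_. \<mu>)"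
  define E where "E = (\<lambda>k i j. \<integral>\<omega>. H k \<omega> i j \<partial>\<mu>)"
  define S where "S = (\<lambda>J x i j. 2 * signed_sum K (\<lambda>k. H k (x k)) J i j)"
  note fin = insert(1,2)
  have mK: "\<And>k i j. k \<in> K \<Longrightarrow> i \<in> {1..n} \<Longrightarrow> j \<in> {1..n} \<Longrightarrow> (\<lambda>\<omega>. H k \<omega> i j) \<in> borel_measurable \<mu>"
    and sK: "\<And>k i j. k \<in> K \<Longrightarrow> i \<in> {1..n} \<Longrightarrow> j \<in> {1..n} \<Longrightarrow> integrable \<mu> (\<lambda>\<omega>. (H k \<omega> i j)\<^sup>2)"
    and ma: "\<And>i j. i \<in> {1..n} \<Longrightarrow> j \<in> {1..n} \<Longrightarrow> (\<lambda>\<omega>. H a \<omega> i j) \<in> borel_measurable \<mu>"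
    and sa: "\<And>i j. i \<in> {1..n} \<Longrightarrow> j \<in> {1..n} \<Longrightarrow> integrable \<mu> (\<lambda>\<omega>. (H a \<omega> i j)\<^sup>2)"
    using insert.prems by auto
  have mH: "(\<lambda>x. H k (x k) i j) \<in> borel_measurable (?P L)"
    if "k \<in> insert a K" "k \<in> L" "i \<in> {1..n}" "j \<in> {1..n}" for k i j L
    using measurable_compose[OF measurable_component_singleton[OF that(2)] insert.prems(1)[OF that(1,3,4)]] .
  have mS: "(\<lambda>x. S J x i j) \<in> borel_measurable (?P L)"
    if "K \<subseteq> L" "i \<in> {1..n}" "j \<in> {1..n}" for J i j L
    unfolding S_def signed_sum_def using that
    by (intro borel_measurable_times borel_measurable_sum measurable_const mH) auto
  have S_upd: "S J (x(a := y)) = S J x" for J x y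
    unfolding S_def signed_sum_def using fin by (intro ext arg_cong[of _ _ "(*) 2"] sum.cong) auto
  have meas: "(\<lambda>x. ennreal ((op_norm n (\<lambda>i j. F x i j))\<^sup>2)) \<in> borel_measurable (?P L)"
    if "\<And>i j. i \<in> {1..n} \<Longrightarrow> j \<in> {1..n} \<Longrightarrow> (\<lambda>x. F x i j) \<in> borel_measurable (?P L)" for F L
    by (intro measurable_compose[OF _ measurable_ennreal] borel_measurable_power measurable_op_norm[OF n] that)
  define F0 where "F0 = (\<lambda>x. ennreal ((op_norm n (\<lambda>i j. B i j + (\<Sum>k\<in>insert a K. H k (x k) i j - E k i j)))\<^sup>2))"
  define F1 where "F1 = (\<lambda>J x. ennreal ((op_norm n (\<lambda>i j. (B i j + (H a (x a) i j - E a i j)) + S J x i j))\<^sup>2))"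
  define F2 where "F2 = (\<lambda>J x. ennreal ((op_norm n (\<lambda>i j. (B i j + S J x i j) + 2 * H a (x a) i j))\<^sup>2))"
  define F3 where "F3 = (\<lambda>J x. ennreal ((op_norm n (\<lambda>i j. (B i j + S J x i j) - 2 * H a (x a) i j))\<^sup>2))"
  have m0: "F0 \<in> borel_measurable (?P (insert a K))"
    unfolding F0_def
    by (intro meas borel_measurable_add borel_measurable_diff borel_measurable_sum mH borel_measurable_const) auto
  have m1: "F1 J \<in> borel_measurable (?P (insert a K))" for J
    unfolding F1_def
    by (intro meas borel_measurable_add borel_measurable_diff mH mS borel_measurable_const) auto
  have m2: "F2 J \<in> borel_measurable (?P (insert a K))" for J
    unfolding F2_def
    by (intro meas borel_measurable_add borel_measurable_times mH mS borel_measurable_const) auto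
  have m3: "F3 J \<in> borel_measurable (?P (insert a K))" for J
    unfolding F3_def
    by (intro meas borel_measurable_add borel_measurable_diff borel_measurable_times mH mS borel_measurable_const) auto
  have mx: "(\<lambda>x. \<integral>\<^sup>+y. f (x(a := y)) \<partial>\<mu>) \<in> borel_measurable (?P K)"
    if "f \<in> borel_measurable (?P (insert a K))" for f :: "('k \<Rightarrow> 'b) \<Rightarrow> ennreal"
    using measurable_compose[OF measurable_add_dim that]
    by (intro \<mu>.borel_measurable_nn_integral) (simp add: split_beta')
  interpret PK: sigma_finite_measure "?P K" by (rule sigma_finite[OF fin(1)])
  have my: "(\<lambda>y. \<integral>\<^sup>+x. f (x(a := y)) \<partial>?P K) \<in> borel_measurable \<mu>"
    if "f \<in> borel_measurable (?P (insert a K))" for f :: "('k \<Rightarrow> 'b) \<Rightarrow> ennreal"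
    using measurable_compose[OF measurable_pair_swap' measurable_compose[OF measurable_add_dim that]]
    by (intro PK.borel_measurable_nn_integral) (simp add: split_beta')
  have u0: "F0 (x(a := y)) = ennreal ((op_norm n (\<lambda>i j. (B i j + (H a y i j - E a i j))
      + (\<Sum>k\<in>K. H k (x k) i j - E k i j)))\<^sup>2)" for x y
  proof -
    have "(\<Sum>k\<in>insert a K. H k ((x(a := y)) k) i j - E k i j)
      = (H a y i j - E a i j) + (\<Sum>k\<in>K. H k (x k) i j - E k i j)" for i j
    proof -
      have "(\<Sum>k\<in>K. H k ((x(a := y)) k) i j - E k i j) = (\<Sum>k\<in>K. H k (x k) i j - E k i j)"
        using fin by (intro sum.cong) auto
      then show ?thesis using fin by simp
    qed
    then show ?thesis by (simp add: F0_def add.assoc)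
  qed
  have "2 ^ card (insert a K) * integral\<^sup>N (?P (insert a K)) F0
    = 2 * (\<integral>\<^sup>+y. 2 ^ card K * (\<integral>\<^sup>+x. F0 (x(a := y)) \<partial>?P K) \<partial>\<mu>)"
    using fin by (simp add: product_nn_integral_insert_rev[OF fin m0] nn_integral_cmult[OF my[OF m0]] mult.assoc)
  \<comment> \<open>For frozen \<open>y\<close> the centred summand of \<open>a\<close> becomes part
    of \<open>B\<close> in the induction hypothesis.\<close>
  also have "\<dots> \<le> 2 * (\<integral>\<^sup>+y. (\<Sum>J\<in>Pow K. \<integral>\<^sup>+x. F1 J (x(a := y)) \<partial>?P K) \<partial>\<mu>)"
    unfolding u0 unfolding F1_def S_upd unfolding fun_upd_same E_def S_def
    by (intro mult_left_mono nn_integral_mono insert.IH mK sK) auto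
  also have "\<dots> = (\<Sum>J\<in>Pow K. 2 * integral\<^sup>N (?P (insert a K)) (F1 J))"
    using my[OF m1] by (simp add: nn_integral_sum sum_distrib_left product_nn_integral_insert_rev[OF fin m1])
  \<comment> \<open>The order of integration is reversed. Now the variable of \<open>a\<close> is
    innermost, and the signed sum over \<open>K\<close> is the constant matrix to which
    \<open>symmetrize_one\<close> applies.\<close>
  also have "\<dots> = (\<Sum>J\<in>Pow K. \<integral>\<^sup>+x. 2 * (\<integral>\<^sup>+y. F1 J (x(a := y)) \<partial>\<mu>) \<partial>?P K)"
    by (simp add: product_nn_integral_insert[OF fin m1] nn_integral_cmult[OF mx[OF m1]])
  also have "\<dots> \<le> (\<Sum>J\<in>Pow K. \<integral>\<^sup>+x. (\<integral>\<^sup>+y. F2 J (x(a := y)) \<partial>\<mu>) + (\<integral>\<^sup>+y. F3 J (x(a := y)) \<partial>\<mu>) \<partial>?P K)"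
  proof (intro sum_mono nn_integral_mono)
    fix J x
    have "F1 J (x(a := y)) = ennreal ((op_norm n (\<lambda>i j. (B i j + S J x i j) + (H a y i j - E a i j)))\<^sup>2)" for y
      by (simp add: F1_def S_upd algebra_simps)
    then show "2 * (\<integral>\<^sup>+y. F1 J (x(a := y)) \<partial>\<mu>) \<le> (\<integral>\<^sup>+y. F2 J (x(a := y)) \<partial>\<mu>) + (\<integral>\<^sup>+y. F3 J (x(a := y)) \<partial>\<mu>)"
      using \<mu>.symmetrize_one[OF n ma sa, where B = "\<lambda>i j. B i j + S J x i j"]
      by (simp add: F2_def F3_def S_upd E_def)
  qed
  also have "\<dots> = (\<Sum>J\<in>Pow K. integral\<^sup>N (?P (insert a K)) (F2 J) + integral\<^sup>N (?P (insert a K)) (F3 J))"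
    by (simp add: product_nn_integral_insert[OF fin m2] product_nn_integral_insert[OF fin m3]
        nn_integral_add[OF mx[OF m2] mx[OF m3]])
  \<comment> \<open>\<open>F2\<close> belongs to the patterns that contain \<open>a\<close> and
    \<open>F3\<close> to those that do not.\<close>
  also have "\<dots> = (\<Sum>J\<in>Pow (insert a K). \<integral>\<^sup>+x. ennreal ((op_norm n (\<lambda>i j. B i j
      + 2 * signed_sum (insert a K) (\<lambda>k. H k (x k)) J i j))\<^sup>2) \<partial>?P (insert a K))" (is "_ = (\<Sum>J\<in>_. ?R J)")
  proof -
    have R2: "?R (insert a J) = integral\<^sup>N (?P (insert a K)) (F2 J)" for J
    proof -
      have "(\<Sum>k\<in>K. sign_of (insert a J) k * H k (x k) i j) = (\<Sum>k\<in>K. sign_of J k * H k (x k) i j)" for x i j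
        using fin by (intro sum.cong) (auto simp: sign_of_def)
      then have "signed_sum (insert a K) (\<lambda>k. H k (x k)) (insert a J) i j
        = H a (x a) i j + signed_sum K (\<lambda>k. H k (x k)) J i j" for x i j
        using fin by (simp add: signed_sum_def sign_of_def)
      then have "B i j + 2 * signed_sum (insert a K) (\<lambda>k. H k (x k)) (insert a J) i j
        = (B i j + S J x i j) + 2 * H a (x a) i j" for x i j by (simp add: S_def)
      then show ?thesis by (simp add: F2_def add.assoc)
    qed
    have R3: "?R J = integral\<^sup>N (?P (insert a K)) (F3 J)" if "J \<in> Pow K" for J
    proof -
      have "a \<notin> J" using that fin by auto
      then have "signed_sum (insert a K) (\<lambda>k. H k (x k)) J i j
        = signed_sum K (\<lambda>k. H k (x k)) J i j - H a (x a) i j" for x i j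
        using fin by (simp add: signed_sum_def sign_of_def)
      then have "B i j + 2 * signed_sum (insert a K) (\<lambda>k. H k (x k)) J i j
        = (B i j + S J x i j) - 2 * H a (x a) i j" for x i j by (simp add: S_def)
      then show ?thesis by (simp add: F3_def add_diff_eq)
    qed
    have inj: "inj_on (insert a) (Pow K)" using fin by (auto simp: inj_on_def)
    have "(\<Sum>J\<in>Pow (insert a K). ?R J) = (\<Sum>J\<in>Pow K. ?R J) + (\<Sum>J\<in>insert a ` Pow K. ?R J)"
      unfolding Pow_insert using fin by (intro sum.union_disjoint) auto
    also have "\<dots> = (\<Sum>J\<in>Pow K. ?R J) + (\<Sum>J\<in>Pow K. ?R (insert a J))"
      by (simp only: sum.reindex[OF inj] o_def)
    also have "\<dots> = (\<Sum>J\<in>Pow K. integral\<^sup>N (?P (insert a K)) (F3 J)) + (\<Sum>J\<in>Pow K. integral\<^sup>N (?P (insert a K)) (F2 J))"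
      by (simp only: R2 R3 cong: sum.cong)
    finally show ?thesis by (simp add: sum.distrib add.commute)
  qed
  finally show ?case by (simp only: E_def F0_def)
qed

text \<open>Khintchine is applied with the sample frozen and integrated only afterwards, so the
  variance proxy \<open>v\<close> may depend on the sample. The constant is 64 = 4 * 16, where the 4
  is the square of the factor 2 left by symmetrisation. Finiteness of the resulting bound also
  yields integrability.\<close>

lemma matrix_variance_bound:
  fixes \<mu> :: "'b measure" and H :: "'k \<Rightarrow> 'b \<Rightarrow> nat \<Rightarrow> nat \<Rightarrow> real"
  assumes \<mu>: "prob_space \<mu>" and n: "n \<ge> 3" and K: "finite K"
    and sym: "\<And>k \<omega>. k \<in> K \<Longrightarrow> H k \<omega> \<in> sym_mats {1..n}"
    and m: "\<And>k i j. k \<in> K \<Longrightarrow> i \<in> {1..n} \<Longrightarrow> j \<in> {1..n} \<Longrightarrow> (\<lambda>\<omega>. H k \<omega> i j) \<in> borel_measurable \<mu>"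
    and s: "\<And>k i j. k \<in> K \<Longrightarrow> i \<in> {1..n} \<Longrightarrow> j \<in> {1..n} \<Longrightarrow> integrable \<mu> (\<lambda>\<omega>. (H k \<omega> i j)\<^sup>2)"
    and v: "AE x in Pi\<^sub>M K (\<lambda>_. \<mu>). \<forall>u. (\<Sum>k\<in>K. \<Sum>i\<in>{1..n}. (\<Sum>j\<in>{1..n}. H k (x k) i j * u j)\<^sup>2) \<le> v x * (\<Sum>j\<in>{1..n}. (u j)\<^sup>2)"
    and vint: "integrable (Pi\<^sub>M K (\<lambda>_. \<mu>)) v"
  defines "Y \<equiv> \<lambda>x. (op_norm n (\<lambda>i j. \<Sum>k\<in>K. H k (x k) i j - (\<integral>\<omega>. H k \<omega> i j \<partial>\<mu>)))\<^sup>2"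
  shows "integrable (Pi\<^sub>M K (\<lambda>_. \<mu>)) Y"
    and "integral\<^sup>L (Pi\<^sub>M K (\<lambda>_. \<mu>)) Y \<le> 64 * exp 1 * ln (real n) * integral\<^sup>L (Pi\<^sub>M K (\<lambda>_. \<mu>)) v"
proof -
  have n1: "n \<ge> 1" using n by simp
  let ?P = "Pi\<^sub>M K (\<lambda>_. \<mu>)"
  let ?c = "64 * exp 1 * ln (real n)"
  have c: "?c > 0" using n by simp
  have mH: "(\<lambda>x. H k (x k) i j) \<in> borel_measurable ?P" if "k \<in> K" "i \<in> {1..n}" "j \<in> {1..n}" for k i j
    using measurable_compose[OF measurable_component_singleton[OF that(1)] m[OF that]] .
  have meas: "(\<lambda>x. ennreal ((op_norm n (\<lambda>i j. F x i j))\<^sup>2)) \<in> borel_measurable ?P"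
    if "\<And>i j. i \<in> {1..n} \<Longrightarrow> j \<in> {1..n} \<Longrightarrow> (\<lambda>x. F x i j) \<in> borel_measurable ?P" for F
    by (intro measurable_compose[OF _ measurable_ennreal] borel_measurable_power measurable_op_norm[OF n1] that)
  have Ym: "Y \<in> borel_measurable ?P"
    unfolding Y_def
    by (intro borel_measurable_power measurable_op_norm[OF n1] borel_measurable_sum borel_measurable_diff mH) auto
  have v0: "AE x in ?P. 0 \<le> v x"
    using v
  proof eventually_elim
    case (elim x)
    have "0 \<le> (\<Sum>k\<in>K. \<Sum>i\<in>{1..n}. (\<Sum>j\<in>{1..n}. H k (x k) i j * 1)\<^sup>2)" by (intro sum_nonneg) auto
    also have "\<dots> \<le> v x * (\<Sum>j\<in>{1..n}. 1\<^sup>2)" using elim[rule_format, of "\<lambda>_. 1"] by simp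
    finally show ?case using n by (simp add: zero_le_mult_iff)
  qed
  have "2 ^ card K * (\<integral>\<^sup>+x. ennreal (Y x) \<partial>?P)
    \<le> (\<Sum>J\<in>Pow K. \<integral>\<^sup>+x. ennreal ((op_norm n (\<lambda>i j. 2 * signed_sum K (\<lambda>k. H k (x k)) J i j))\<^sup>2) \<partial>?P)"
    using symmetrize[OF \<mu> n1 K m s, where B = "\<lambda>_ _. 0"] unfolding Y_def by simp
  also have "\<dots> = (\<integral>\<^sup>+x. (\<Sum>J\<in>Pow K. ennreal ((op_norm n (\<lambda>i j. 2 * signed_sum K (\<lambda>k. H k (x k)) J i j))\<^sup>2)) \<partial>?P)"
    unfolding signed_sum_def
    by (intro nn_integral_sum[symmetric] meas borel_measurable_times borel_measurable_sum mH) auto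
  also have "\<dots> \<le> (\<integral>\<^sup>+x. ennreal (2 ^ card K * (?c * v x)) \<partial>?P)"
  proof (rule nn_integral_mono_AE, use v in eventually_elim)
    case (elim x)
    have "(\<Sum>J\<in>Pow K. ennreal ((op_norm n (\<lambda>i j. 2 * signed_sum K (\<lambda>k. H k (x k)) J i j))\<^sup>2))
      = ennreal (\<Sum>J\<in>Pow K. (op_norm n (\<lambda>i j. 2 * signed_sum K (\<lambda>k. H k (x k)) J i j))\<^sup>2)"
      by (intro sum_ennreal) auto
    also have "\<dots> \<le> ennreal (2 ^ card K * (?c * v x))"
    proof (rule ennreal_leI)
      have "(\<Sum>J\<in>Pow K. (op_norm n (\<lambda>i j. 2 * signed_sum K (\<lambda>k. H k (x k)) J i j))\<^sup>2)
        \<le> (\<Sum>J\<in>Pow K. 2\<^sup>2 * (op_norm n (signed_sum K (\<lambda>k. H k (x k)) J))\<^sup>2)"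
        by (intro sum_mono op_norm_scale_sq n1)
      also have "\<dots> = 4 * (\<Sum>J\<in>Pow K. (op_norm n (signed_sum K (\<lambda>k. H k (x k)) J))\<^sup>2)"
        by (simp add: sum_distrib_left)
      also have "\<dots> \<le> 4 * (2 ^ card K * (16 * exp 1 * ln (real n) * v x))"
        using elim by (intro mult_left_mono matrix_khintchine K n sym) auto
      finally show "(\<Sum>J\<in>Pow K. (op_norm n (\<lambda>i j. 2 * signed_sum K (\<lambda>k. H k (x k)) J i j))\<^sup>2)
        \<le> 2 ^ card K * (?c * v x)" by (simp add: mult_ac)
    qed
    finally show ?case .
  qed
  also have "\<dots> = ennreal (2 ^ card K * (?c * integral\<^sup>L ?P v))"
  proof (subst nn_integral_eq_integral)
    show "AE x in ?P. 0 \<le> 2 ^ card K * (?c * v x)"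
      using v0 by eventually_elim (intro mult_nonneg_nonneg, use n in auto)
  qed (use vint in auto)
  also have "\<dots> = 2 ^ card K * ennreal (?c * integral\<^sup>L ?P v)"
    using c integral_nonneg_AE[OF v0] by (simp add: ennreal_mult ennreal_power[symmetric])
  finally have main: "(\<integral>\<^sup>+x. ennreal (Y x) \<partial>?P) \<le> ennreal (?c * integral\<^sup>L ?P v)"
    by (subst (asm) ennreal_mult_le_mult_iff) (auto simp: power_eq_top_ennreal)
  have "(\<integral>\<^sup>+x. ennreal (Y x) \<partial>?P) < \<infinity>" using le_less_trans[OF main ennreal_less_top] by simp
  then show int: "integrable ?P Y"
    using Ym by (intro integrableI_nonneg) (auto simp: Y_def)
  show "integral\<^sup>L ?P Y \<le> ?c * integral\<^sup>L ?P v"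
    using main c integral_nonneg_AE[OF v0]
    by (subst (asm) nn_integral_eq_integral[OF int]) (auto simp: Y_def)
qed

section \<open>A Rosenthal-type inequality\<close>

lemma mat_mult_self_sym:
  assumes "A \<in> sym_mats I"
  shows "mat_mult I A A \<in> sym_mats I"
  using mat_mult_flip[OF assms assms] by (auto simp: sym_mats_def mat_mult_def sym_matsD[OF assms])

lemma quadratic_form_le_op_norm:
  assumes n: "n \<ge> 1"
  shows "(\<Sum>i\<in>{1..n}. u i * mat_vec n A u i) \<le> op_norm n A * (\<Sum>i\<in>{1..n}. (u i)\<^sup>2)"
proof -
  let ?s = "\<Sum>i\<in>{1..n}. (u i)\<^sup>2"
  have "(\<Sum>i\<in>{1..n}. u i * mat_vec n A u i)\<^sup>2 \<le> ?s * (\<Sum>i\<in>{1..n}. (mat_vec n A u i)\<^sup>2)"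
    by (rule Cauchy_Schwarz_ineq_sum)
  also have "\<dots> \<le> ?s * ((op_norm n A)\<^sup>2 * ?s)"
    by (intro mult_left_mono mat_vec_sq_le_op_norm n sum_nonneg) auto
  also have "\<dots> = (op_norm n A * ?s)\<^sup>2" by (simp add: power2_eq_square)
  finally show ?thesis
    by (rule power2_le_imp_le) (intro mult_nonneg_nonneg op_norm_nonneg n sum_nonneg, simp)
qed

text \<open>Here \<open>\<rho>\<close> bounds the matrix variance and \<open>m\<close> the largest
  squared norm of a summand.  The random matrix \<open>\<Sum>\<^sub>k H\<^sub>k\<^sup>2\<close> that enters the Khintchine bound is
  controlled by applying the same bound to the matrices \<open>H\<^sub>k\<^sup>2\<close>.\<close>

lemma matrix_rosenthal:
  fixes \<mu> :: "'b measure" and H :: "'k \<Rightarrow> 'b \<Rightarrow> nat \<Rightarrow> nat \<Rightarrow> real"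
  assumes \<mu>: "prob_space \<mu>" and n: "n \<ge> 3" and K: "finite K"
    and sym: "\<And>k \<omega>. k \<in> K \<Longrightarrow> H k \<omega> \<in> sym_mats {1..n}"
    and meas: "\<And>k i j. k \<in> K \<Longrightarrow> i \<in> {1..n} \<Longrightarrow> j \<in> {1..n} \<Longrightarrow> (\<lambda>\<omega>. H k \<omega> i j) \<in> borel_measurable \<mu>"
    and sq: "\<And>k i j. k \<in> K \<Longrightarrow> i \<in> {1..n} \<Longrightarrow> j \<in> {1..n} \<Longrightarrow> integrable \<mu> (\<lambda>\<omega>. (H k \<omega> i j)\<^sup>2)"
    and sq2: "\<And>k i j. k \<in> K \<Longrightarrow> i \<in> {1..n} \<Longrightarrow> j \<in> {1..n} \<Longrightarrow>
      integrable \<mu> (\<lambda>\<omega>. (mat_mult {1..n} (H k \<omega>) (H k \<omega>) i j)\<^sup>2)"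
    and \<rho>: "\<And>u. (\<Sum>k\<in>K. \<integral>\<omega>. (\<Sum>i\<in>{1..n}. (mat_vec n (H k \<omega>) u i)\<^sup>2) \<partial>\<mu>) \<le> \<rho> * (\<Sum>j\<in>{1..n}. (u j)\<^sup>2)"
    and \<rho>0: "\<rho> \<ge> 0"
    and m0: "\<And>x. m x \<ge> 0" and mmeas: "m \<in> borel_measurable (Pi\<^sub>M K (\<lambda>_. \<mu>))"
    and m2: "integrable (Pi\<^sub>M K (\<lambda>_. \<mu>)) (\<lambda>x. (m x)\<^sup>2)"
    and m: "AE x in Pi\<^sub>M K (\<lambda>_. \<mu>). \<forall>k\<in>K. frob {1..n} (H k (x k)) (H k (x k)) \<le> m x"
  defines "Y \<equiv> \<lambda>x. (op_norm n (\<lambda>i j. \<Sum>k\<in>K. H k (x k) i j - (\<integral>\<omega>. H k \<omega> i j \<partial>\<mu>)))\<^sup>2"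
    and "\<kappa> \<equiv> 64 * exp 1 * ln (real n)"
  shows "integrable (Pi\<^sub>M K (\<lambda>_. \<mu>)) Y"
    and "integral\<^sup>L (Pi\<^sub>M K (\<lambda>_. \<mu>)) Y
      \<le> 2 * \<kappa> * \<rho> + 2 * \<kappa>\<^sup>2 * sqrt (\<integral>x. (m x)\<^sup>2 \<partial>Pi\<^sub>M K (\<lambda>_. \<mu>))"
proof -
  interpret \<mu>: prob_space \<mu> by fact
  let ?P = "Pi\<^sub>M K (\<lambda>_. \<mu>)"
  interpret P: prob_space ?P by (intro prob_space_PiM \<mu>)
  have n1: "n \<ge> 1" using n by simp
  have \<kappa>0: "\<kappa> \<ge> 0" using n by (simp add: \<kappa>_def)
  define G where "G = (\<lambda>k \<omega>. mat_mult {1..n} (H k \<omega>) (H k \<omega>))"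
  define D where "D = (\<lambda>x i j. \<Sum>k\<in>K. G k (x k) i j - (\<integral>\<omega>. G k \<omega> i j \<partial>\<mu>))"
  define Z where "Z = (\<lambda>x. op_norm n (D x))"
  have Gsym: "G k \<omega> \<in> sym_mats {1..n}" if "k \<in> K" for k \<omega>
    unfolding G_def by (rule mat_mult_self_sym[OF sym[OF that]])
  have Gmeas: "(\<lambda>\<omega>. G k \<omega> i j) \<in> borel_measurable \<mu>" if "k \<in> K" "i \<in> {1..n}" "j \<in> {1..n}" for k i j
    unfolding G_def mat_mult_def using that
    by (intro borel_measurable_sum borel_measurable_times meas) auto
  have Gsq: "integrable \<mu> (\<lambda>\<omega>. (G k \<omega> i j)\<^sup>2)" if "k \<in> K" "i \<in> {1..n}" "j \<in> {1..n}" for k i j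
    unfolding G_def by (rule sq2[OF that])
  have Gint: "integrable \<mu> (\<lambda>\<omega>. G k \<omega> i j)" if "k \<in> K" "i \<in> {1..n}" "j \<in> {1..n}" for k i j
    by (rule \<mu>.square_integrable_imp_integrable[OF Gmeas[OF that] Gsq[OF that]])
  have comp: "(\<lambda>x. f (x k)) \<in> borel_measurable ?P" if "k \<in> K" "f \<in> borel_measurable \<mu>" for k and f :: "'b \<Rightarrow> real"
    using measurable_compose[OF measurable_component_singleton[OF that(1)] that(2)] .
  have compi: "integrable ?P (\<lambda>x. f (x k))" if "k \<in> K" "integrable \<mu> f" for k and f :: "'b \<Rightarrow> real"
  proof -
    have "distr ?P \<mu> (\<lambda>x. x k) = \<mu>" by (rule distr_PiM_component[OF \<mu> that(1)])
    then show ?thesis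
      using that(2) integrable_distr[OF measurable_component_singleton[OF that(1)], of "\<lambda>_. \<mu>" f] by simp
  qed
  have Dsq: "integrable ?P (\<lambda>x. (D x i j)\<^sup>2)" if "i \<in> {1..n}" "j \<in> {1..n}" for i j
    unfolding D_def
  proof (rule integrable_square_sum[OF K])
    fix k assume k: "k \<in> K"
    show "(\<lambda>x. G k (x k) i j - (\<integral>\<omega>. G k \<omega> i j \<partial>\<mu>)) \<in> borel_measurable ?P"
      by (intro borel_measurable_diff comp Gmeas k that) auto
    have "integrable ?P (\<lambda>x. (G k (x k) i j)\<^sup>2 + (\<integral>\<omega>. G k \<omega> i j \<partial>\<mu>)\<^sup>2 - 2 * G k (x k) i j * (\<integral>\<omega>. G k \<omega> i j \<partial>\<mu>))"
      using compi[OF k Gsq[OF k that]] compi[OF k Gint[OF k that]] by auto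
    then show "integrable ?P (\<lambda>x. (G k (x k) i j - (\<integral>\<omega>. G k \<omega> i j \<partial>\<mu>))\<^sup>2)"
      by (simp add: power2_diff)
  qed
  have Dmeas: "(\<lambda>x. D x i j) \<in> borel_measurable ?P" if "i \<in> {1..n}" "j \<in> {1..n}" for i j
    unfolding D_def by (intro borel_measurable_sum borel_measurable_diff comp Gmeas that) auto
  have Zm: "Z \<in> borel_measurable ?P" unfolding Z_def by (rule measurable_op_norm[OF n1 Dmeas])
  have Z2: "integrable ?P (\<lambda>x. (Z x)\<^sup>2)" unfolding Z_def by (rule P.op_norm_sq_jensen(1)[OF n1 Dmeas Dsq])
  have Z1: "integrable ?P Z" by (rule P.square_integrable_imp_integrable[OF Zm Z2])
  have m1: "integrable ?P m" by (rule P.square_integrable_imp_integrable[OF mmeas m2])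
  have Z0: "Z x \<ge> 0" for x unfolding Z_def by (rule op_norm_nonneg[OF n1])
  have Gquad: "(\<Sum>i\<in>{1..n}. (mat_vec n (H k \<omega>) u i)\<^sup>2) = (\<Sum>i\<in>{1..n}. u i * mat_vec n (G k \<omega>) u i)"
    if "k \<in> K" for k \<omega> u
    using mat_vec_adjoint[OF sym[OF that], where u = u and w = "mat_vec n (H k \<omega>) u"]
    by (simp add: G_def mat_vec_mult power2_eq_square)
  \<comment> \<open>The quadratic form of the sum of the H_k^2 is its mean, at most \<rho> |u|^2,
    plus that of the deviation \<open>D x\<close>, at most \<open>Z x\<close> |u|^2.\<close>
  have var: "(\<Sum>k\<in>K. \<Sum>i\<in>{1..n}. (mat_vec n (H k (x k)) u i)\<^sup>2) \<le> (\<rho> + Z x) * (\<Sum>j\<in>{1..n}. (u j)\<^sup>2)" for x u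
  proof -
    have E: "(\<integral>\<omega>. (\<Sum>i\<in>{1..n}. (mat_vec n (H k \<omega>) u i)\<^sup>2) \<partial>\<mu>)
      = (\<Sum>i\<in>{1..n}. u i * mat_vec n (\<lambda>i j. \<integral>\<omega>. G k \<omega> i j \<partial>\<mu>) u i)" if k: "k \<in> K" for k
    proof -
      have "(\<integral>\<omega>. (\<Sum>i\<in>{1..n}. u i * mat_vec n (G k \<omega>) u i) \<partial>\<mu>)
        = (\<Sum>i\<in>{1..n}. u i * (\<integral>\<omega>. mat_vec n (G k \<omega>) u i \<partial>\<mu>))"
        unfolding mat_vec_def using Gint[OF k] by (subst Bochner_Integration.integral_sum) auto
      also have "\<dots> = (\<Sum>i\<in>{1..n}. u i * mat_vec n (\<lambda>i j. \<integral>\<omega>. G k \<omega> i j \<partial>\<mu>) u i)"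
        unfolding mat_vec_def using Gint[OF k]
        by (intro sum.cong refl, subst Bochner_Integration.integral_sum) auto
      finally show ?thesis by (simp add: Gquad[OF k])
    qed
    have "mat_vec n (D x) u i = (\<Sum>k\<in>K. mat_vec n (G k (x k)) u i - mat_vec n (\<lambda>i j. \<integral>\<omega>. G k \<omega> i j \<partial>\<mu>) u i)" for i
    proof -
      have "mat_vec n (D x) u i = (\<Sum>j\<in>{1..n}. \<Sum>k\<in>K. G k (x k) i j * u j - (\<integral>\<omega>. G k \<omega> i j \<partial>\<mu>) * u j)"
        by (simp add: mat_vec_def D_def sum_distrib_right left_diff_distrib)
      also have "\<dots> = (\<Sum>k\<in>K. \<Sum>j\<in>{1..n}. G k (x k) i j * u j - (\<integral>\<omega>. G k \<omega> i j \<partial>\<mu>) * u j)"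
        by (rule sum.swap)
      finally show ?thesis by (simp add: mat_vec_def sum_subtractf)
    qed
    then have "(\<Sum>i\<in>{1..n}. u i * mat_vec n (D x) u i)
      = (\<Sum>i\<in>{1..n}. \<Sum>k\<in>K. u i * mat_vec n (G k (x k)) u i - u i * mat_vec n (\<lambda>i j. \<integral>\<omega>. G k \<omega> i j \<partial>\<mu>) u i)"
      by (simp add: sum_distrib_left right_diff_distrib)
    also have "\<dots> = (\<Sum>k\<in>K. \<Sum>i\<in>{1..n}. u i * mat_vec n (G k (x k)) u i - u i * mat_vec n (\<lambda>i j. \<integral>\<omega>. G k \<omega> i j \<partial>\<mu>) u i)"
      by (rule sum.swap)
    also have "\<dots> = (\<Sum>k\<in>K. \<Sum>i\<in>{1..n}. (mat_vec n (H k (x k)) u i)\<^sup>2) - (\<Sum>k\<in>K. \<integral>\<omega>. (\<Sum>i\<in>{1..n}. (mat_vec n (H k \<omega>) u i)\<^sup>2) \<partial>\<mu>)"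
      unfolding sum_subtractf using E Gquad by (simp cong: sum.cong)
    finally show ?thesis
      using quadratic_form_le_op_norm[OF n1, of u "D x"] \<rho>[of u] by (simp add: Z_def distrib_right)
  qed
  \<comment> \<open>Since |H_k H_k u|^2 <= m |H_k u|^2, the matrices H_k^2 have \<open>m\<close>
    times the previous variance proxy as theirs.\<close>
  have mv2: "AE x in ?P. \<forall>u. (\<Sum>k\<in>K. \<Sum>i\<in>{1..n}. (\<Sum>j\<in>{1..n}. G k (x k) i j * u j)\<^sup>2)
      \<le> (m x * (\<rho> + Z x)) * (\<Sum>j\<in>{1..n}. (u j)\<^sup>2)"
    using m
  proof eventually_elim
    case (elim x)
    show ?case
    proof
      fix u :: "nat \<Rightarrow> real"
      have "(\<Sum>k\<in>K. \<Sum>i\<in>{1..n}. (\<Sum>j\<in>{1..n}. G k (x k) i j * u j)\<^sup>2)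
        = (\<Sum>k\<in>K. \<Sum>i\<in>{1..n}. (mat_vec n (H k (x k)) (mat_vec n (H k (x k)) u) i)\<^sup>2)"
        unfolding mat_vec_mult[symmetric] by (simp add: mat_vec_def G_def)
      also have "\<dots> \<le> (\<Sum>k\<in>K. m x * (\<Sum>i\<in>{1..n}. (mat_vec n (H k (x k)) u i)\<^sup>2))"
      proof (rule sum_mono)
        fix k assume k: "k \<in> K"
        show "(\<Sum>i\<in>{1..n}. (mat_vec n (H k (x k)) (mat_vec n (H k (x k)) u) i)\<^sup>2)
          \<le> m x * (\<Sum>i\<in>{1..n}. (mat_vec n (H k (x k)) u i)\<^sup>2)"
          using elim k by (intro order_trans[OF mat_vec_sq_le_frob] mult_right_mono sum_nonneg) auto
      qed
      also have "\<dots> = m x * (\<Sum>k\<in>K. \<Sum>i\<in>{1..n}. (mat_vec n (H k (x k)) u i)\<^sup>2)"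
        by (simp add: sum_distrib_left)
      also have "\<dots> \<le> m x * ((\<rho> + Z x) * (\<Sum>j\<in>{1..n}. (u j)\<^sup>2))"
        by (intro mult_left_mono var m0)
      finally show "(\<Sum>k\<in>K. \<Sum>i\<in>{1..n}. (\<Sum>j\<in>{1..n}. G k (x k) i j * u j)\<^sup>2)
        \<le> (m x * (\<rho> + Z x)) * (\<Sum>j\<in>{1..n}. (u j)\<^sup>2)" by (simp add: mult.assoc)
    qed
  qed
  have mZ: "integrable ?P (\<lambda>x. m x * Z x)"
  proof (rule Bochner_Integration.integrable_bound)
    show "integrable ?P (\<lambda>x. (m x)\<^sup>2 + (Z x)\<^sup>2)" using m2 Z2 by simp
    show "(\<lambda>x. m x * Z x) \<in> borel_measurable ?P" using mmeas Zm by simp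
    show "AE x in ?P. norm (m x * Z x) \<le> norm ((m x)\<^sup>2 + (Z x)\<^sup>2)"
    proof (rule AE_I2)
      fix x
      have "2 * m x * Z x \<le> (m x)\<^sup>2 + (Z x)\<^sup>2" by (rule sum_squares_bound)
      moreover have "0 \<le> m x * Z x" using m0 Z0 by simp
      ultimately have "m x * Z x \<le> (m x)\<^sup>2 + (Z x)\<^sup>2" by linarith
      then show "norm (m x * Z x) \<le> norm ((m x)\<^sup>2 + (Z x)\<^sup>2)" using m0[of x] Z0[of x] by simp
    qed
  qed
  have v2int: "integrable ?P (\<lambda>x. m x * (\<rho> + Z x))"
    unfolding distrib_left using m1 mZ by auto
  define M where "M = (\<integral>x. (m x)\<^sup>2 \<partial>?P)"
  have M0: "M \<ge> 0" by (simp add: M_def)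
  \<comment> \<open>\<open>Z\<close> is bounded through itself. The arithmetic-geometric mean
    inequality below leaves only half of E Z^2 on the right; it can be moved to the left because it
    is already known to be finite.\<close>
  have "(\<integral>x. (Z x)\<^sup>2 \<partial>?P) \<le> \<kappa> * (\<integral>x. m x * (\<rho> + Z x) \<partial>?P)"
    using matrix_variance_bound(2)[OF \<mu> n K Gsym Gmeas Gsq mv2 v2int]
    unfolding Z_def D_def \<kappa>_def by simp
  also have "\<dots> = (\<integral>x. \<kappa> * (m x * (\<rho> + Z x)) \<partial>?P)" by simp
  also have "\<dots> \<le> (\<integral>x. \<kappa>\<^sup>2 * (m x)\<^sup>2 + (Z x)\<^sup>2 / 2 + \<rho>\<^sup>2 / 2 \<partial>?P)"
  proof (rule integral_mono)
    show "integrable ?P (\<lambda>x. \<kappa> * (m x * (\<rho> + Z x)))" using v2int by simp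
    show "integrable ?P (\<lambda>x. \<kappa>\<^sup>2 * (m x)\<^sup>2 + (Z x)\<^sup>2 / 2 + \<rho>\<^sup>2 / 2)" using m2 Z2 by simp
    fix x
    have "2 * (\<kappa> * m x) * Z x \<le> (\<kappa> * m x)\<^sup>2 + (Z x)\<^sup>2" "2 * (\<kappa> * m x) * \<rho> \<le> (\<kappa> * m x)\<^sup>2 + \<rho>\<^sup>2"
      by (rule sum_squares_bound)+
    then show "\<kappa> * (m x * (\<rho> + Z x)) \<le> \<kappa>\<^sup>2 * (m x)\<^sup>2 + (Z x)\<^sup>2 / 2 + \<rho>\<^sup>2 / 2"
      by (simp add: power_mult_distrib algebra_simps)
  qed
  also have "\<dots> = \<kappa>\<^sup>2 * M + (\<integral>x. (Z x)\<^sup>2 \<partial>?P) / 2 + \<rho>\<^sup>2 / 2"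
    using m2 Z2 by (simp add: M_def P.prob_space)
  finally have EZ2: "(\<integral>x. (Z x)\<^sup>2 \<partial>?P) \<le> 2 * \<kappa>\<^sup>2 * M + \<rho>\<^sup>2" by simp
  have "(\<integral>x. Z x \<partial>?P)\<^sup>2 \<le> (\<rho> + 2 * \<kappa> * sqrt M)\<^sup>2"
  proof -
    have "(\<integral>x. Z x \<partial>?P)\<^sup>2 \<le> 2 * \<kappa>\<^sup>2 * M + \<rho>\<^sup>2"
      using P.square_expectation_le[OF Zm Z2] EZ2 by simp
    also have "\<dots> \<le> \<rho>\<^sup>2 + 4 * \<kappa> * \<rho> * sqrt M + 4 * \<kappa>\<^sup>2 * M"
      using M0 \<rho>0 \<kappa>0 by simp
    also have "\<dots> = (\<rho> + 2 * \<kappa> * sqrt M)\<^sup>2"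
      using M0 by (simp add: power2_sum power_mult_distrib)
    finally show ?thesis .
  qed
  then have EZ: "(\<integral>x. Z x \<partial>?P) \<le> \<rho> + 2 * \<kappa> * sqrt M"
    by (rule power2_le_imp_le) (use M0 \<rho>0 \<kappa>0 in simp)
  have v1int: "integrable ?P (\<lambda>x. \<rho> + Z x)" using Z1 by simp
  have mv1: "AE x in ?P. \<forall>u. (\<Sum>k\<in>K. \<Sum>i\<in>{1..n}. (\<Sum>j\<in>{1..n}. H k (x k) i j * u j)\<^sup>2)
      \<le> (\<rho> + Z x) * (\<Sum>j\<in>{1..n}. (u j)\<^sup>2)"
    using var unfolding mat_vec_def by (intro AE_I2) blast
  note bound = matrix_variance_bound[OF \<mu> n K sym meas sq mv1 v1int, folded Y_def \<kappa>_def]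
  show "integrable ?P Y" by (rule bound(1))
  have "integral\<^sup>L ?P Y \<le> \<kappa> * (\<integral>x. \<rho> + Z x \<partial>?P)" by (rule bound(2))
  also have "\<dots> = \<kappa> * (\<rho> + (\<integral>x. Z x \<partial>?P))" using Z1 by (simp add: P.prob_space)
  also have "\<dots> \<le> \<kappa> * (\<rho> + (\<rho> + 2 * \<kappa> * sqrt M))" using EZ \<kappa>0 by (intro mult_left_mono) auto
  finally show "integral\<^sup>L ?P Y \<le> 2 * \<kappa> * \<rho> + 2 * \<kappa>\<^sup>2 * sqrt (\<integral>x. (m x)\<^sup>2 \<partial>?P)"
    by (simp add: M_def algebra_simps power2_eq_square)
qed

text \<open>The square of a^2 <= 8 exp (a / 2), which is the quadratic Taylor bound at a /
  2.\<close>

lemma pow4_le_exp: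
  assumes "0 \<le> (a::real)"
  shows "a ^ 4 \<le> 64 * exp a"
proof -
  have "1 + a / 2 + (a / 2)\<^sup>2 / 2 \<le> exp (a / 2)"
    using assms by (intro exp_lower_Taylor_quadratic) simp
  then have "a\<^sup>2 \<le> 8 * exp (a / 2)" using assms by (simp add: power2_eq_square)
  then have "(a\<^sup>2)\<^sup>2 \<le> (8 * exp (a / 2))\<^sup>2" by (intro power_mono) auto
  then show ?thesis by (simp add: power_mult_distrib exp_double[symmetric])
qed

text \<open>Beyond ln N write a = ln N + b, so that exp b = exp a / N. The division by N is the
  point: when the exponentials of N samples are summed, they contribute only a bounded amount in the
  mean.\<close>

lemma pow4_le_log_exp:
  assumes "0 \<le> (a::real)" "N > 0" "ln N \<ge> 0"
  shows "a ^ 4 \<le> 8 * (ln N) ^ 4 + 512 * exp a / N"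
proof (cases "a \<le> ln N")
  case True
  then have "a ^ 4 \<le> (ln N) ^ 4" using assms by (intro power_mono) auto
  moreover have "0 \<le> 512 * exp a / N" "0 \<le> (ln N) ^ 4" using assms by auto
  ultimately show ?thesis by linarith
next
  case False
  define b where "b = a - ln N"
  have b: "b \<ge> 0" "a = ln N + b" using False by (auto simp: b_def)
  have "a ^ 4 = ((ln N + b)\<^sup>2)\<^sup>2" using b by simp
  also have "\<dots> \<le> (2 * (ln N)\<^sup>2 + 2 * b\<^sup>2)\<^sup>2"
    using sum_squares_bound[of "ln N" b] assms b by (intro power_mono) (auto simp: power2_sum)
  also have "\<dots> \<le> 8 * (ln N) ^ 4 + 8 * b ^ 4"
    using sum_squares_bound[of "(ln N)\<^sup>2" "b\<^sup>2"] by (simp add: power2_sum power_mult_distrib algebra_simps)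
  also have "8 * b ^ 4 \<le> 8 * (64 * exp b)" using pow4_le_exp[OF b(1)] by simp
  also have "exp b = exp a / N" using assms by (simp add: b_def exp_diff)
  finally show ?thesis by simp
qed

section \<open>Sub-Gaussian samples under a fixed mask\<close>

text \<open>The scale is 2 / \<open>c\<^sub>0\<close> times the variance rather than 1 /
  \<open>c\<^sub>0\<close> times it, because the infimum defining the sub-Gaussian norm is reached
  only in the limit. In a direction of variance 0 the quotient is 0 by convention and the
  exponential conditions are trivial.\<close>

locale sub_gaussian_law = prob_space \<mu> for \<mu> :: "(nat \<Rightarrow> real) measure" +
  fixes n :: nat and c\<^sub>0 :: real
  assumes sets_law: "sets \<mu> = sets (vec_space n)"
    and c0: "c\<^sub>0 > 0"
    and second_moment: "\<And>u. integrable \<mu> (\<lambda>y. (inner_on n u y)\<^sup>2)"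
    and exp_moment: "\<And>u. integrable \<mu> (\<lambda>y. exp ((inner_on n u y)\<^sup>2 / (2 / c\<^sub>0 * (\<integral>y. (inner_on n u y)\<^sup>2 \<partial>\<mu>))))"
    and exp_moment_le: "\<And>u. (\<integral>y. exp ((inner_on n u y)\<^sup>2 / (2 / c\<^sub>0 * (\<integral>y. (inner_on n u y)\<^sup>2 \<partial>\<mu>))) \<partial>\<mu>) \<le> 2"
begin

definition scale :: "(nat \<Rightarrow> real) \<Rightarrow> real" where
  "scale u = 2 / c\<^sub>0 * (\<integral>y. (inner_on n u y)\<^sup>2 \<partial>\<mu>)"

definition normalized_square :: "(nat \<Rightarrow> real) \<Rightarrow> (nat \<Rightarrow> real) \<Rightarrow> real" where
  "normalized_square u y = (inner_on n u y)\<^sup>2 / scale u"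

lemma coordinate_measurable: "i \<in> {1..n} \<Longrightarrow> (\<lambda>y. y i) \<in> borel_measurable \<mu>"
  using measurable_component_singleton[of i "{1..n}" "\<lambda>_. borel"]
  by (simp add: measurable_cong_sets[OF sets_law refl])

lemma inner_on_measurable: "(\<lambda>y. inner_on n u y) \<in> borel_measurable \<mu>"
  unfolding inner_on_def by (intro borel_measurable_sum borel_measurable_times coordinate_measurable) auto

lemma scale_nonneg: "0 \<le> scale u"
  using c0 by (simp add: scale_def)

lemma normalized_square_nonneg: "0 \<le> normalized_square u y"
  by (simp add: normalized_square_def scale_nonneg)

lemma normalized_square_exp:
  "integrable \<mu> (\<lambda>y. exp (normalized_square u y))" "expectation (\<lambda>y. exp (normalized_square u y)) \<le> 2"
  using exp_moment[of u] exp_moment_le[of u] by (simp_all add: normalized_square_def scale_def)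

text \<open>If \<open>scale u = 0\<close> then \<open>normalized_square u\<close> is \<open>0\<close> by \<open>x / 0 = 0\<close>, and the identity holds
  only almost everywhere.\<close>

lemma square_eq_scale_AE: "AE y in \<mu>. (inner_on n u y)\<^sup>2 = scale u * normalized_square u y"
proof (cases "scale u = 0")
  case True
  then have "(\<integral>y. (inner_on n u y)\<^sup>2 \<partial>\<mu>) = 0" using c0 by (simp add: scale_def)
  then have "AE y in \<mu>. (inner_on n u y)\<^sup>2 = 0"
    using integral_nonneg_eq_0_iff_AE[OF second_moment] by simp
  then show ?thesis using True by simp
next
  case False
  then show ?thesis by (simp add: normalized_square_def)
qed

text \<open>For the normalised squares a and b, ab <= a^2/2 + b^2/2 <= exp a + exp b, and each
  exponential has mean at most 2. This is the comparison of mixed fourth moments with products of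
  variances.\<close>

lemma product_moment:
  "integrable \<mu> (\<lambda>y. (inner_on n u y)\<^sup>2 * (inner_on n w y)\<^sup>2)"
  "expectation (\<lambda>y. (inner_on n u y)\<^sup>2 * (inner_on n w y)\<^sup>2) \<le> 4 * scale u * scale w"
proof -
  define B where "B = (\<lambda>y. scale u * scale w * (exp (normalized_square u y) + exp (normalized_square w y)))"
  have Bint: "integrable \<mu> B"
    unfolding B_def using normalized_square_exp(1) by simp
  have sq: "a\<^sup>2 / 2 \<le> exp a" if "0 \<le> a" for a :: real
    using exp_lower_Taylor_quadratic[OF that] that by simp
  have le: "AE y in \<mu>. (inner_on n u y)\<^sup>2 * (inner_on n w y)\<^sup>2 \<le> B y"
    using square_eq_scale_AE[of u] square_eq_scale_AE[of w]
  proof eventually_elim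
    case (elim y)
    have "normalized_square u y * normalized_square w y \<le> exp (normalized_square u y) + exp (normalized_square w y)"
      using sum_squares_bound[of "normalized_square u y" "normalized_square w y"]
        sq[OF normalized_square_nonneg, of u y] sq[OF normalized_square_nonneg, of w y] by simp
    then have "(scale u * scale w) * (normalized_square u y * normalized_square w y) \<le> B y"
      unfolding B_def by (intro mult_left_mono mult_nonneg_nonneg scale_nonneg)
    then show ?case unfolding elim by (simp add: mult_ac)
  qed
  show int: "integrable \<mu> (\<lambda>y. (inner_on n u y)\<^sup>2 * (inner_on n w y)\<^sup>2)"
    by (rule Bochner_Integration.integrable_bound[OF Bint])
      (use inner_on_measurable le in \<open>auto elim!: eventually_mono\<close>)
  have "expectation (\<lambda>y. (inner_on n u y)\<^sup>2 * (inner_on n w y)\<^sup>2) \<le> expectation B"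
    by (rule integral_mono_AE[OF int Bint le])
  also have "\<dots> = scale u * scale w * (expectation (\<lambda>y. exp (normalized_square u y)) + expectation (\<lambda>y. exp (normalized_square w y)))"
    unfolding B_def using normalized_square_exp(1) by simp
  also have "\<dots> \<le> scale u * scale w * (2 + 2)"
    by (intro mult_left_mono add_mono normalized_square_exp mult_nonneg_nonneg scale_nonneg)
  finally show "expectation (\<lambda>y. (inner_on n u y)\<^sup>2 * (inner_on n w y)\<^sup>2) \<le> 4 * scale u * scale w"
    by simp
qed

text \<open>Entries of H_k^2 have degree 4 in the sample, and their squares must be integrable when
  the variance bound is applied to the matrices H_k^2.\<close>

lemma eighth_moment: "integrable \<mu> (\<lambda>y. (inner_on n u y) ^ 8)"
proof (rule Bochner_Integration.integrable_bound)
  show "integrable \<mu> (\<lambda>y. scale u ^ 4 * (64 * exp (normalized_square u y)))"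
    using normalized_square_exp(1) by simp
  show "(\<lambda>y. (inner_on n u y) ^ 8) \<in> borel_measurable \<mu>" using inner_on_measurable by measurable
  show "AE y in \<mu>. norm ((inner_on n u y) ^ 8) \<le> norm (scale u ^ 4 * (64 * exp (normalized_square u y)))"
    using square_eq_scale_AE[of u]
  proof eventually_elim
    case (elim y)
    have "(inner_on n u y) ^ 8 = ((inner_on n u y)\<^sup>2) ^ 4" by (simp flip: power_mult)
    also have "\<dots> = scale u ^ 4 * (normalized_square u y) ^ 4" unfolding elim by (rule power_mult_distrib)
    also have "\<dots> \<le> scale u ^ 4 * (64 * exp (normalized_square u y))"
      by (intro mult_left_mono pow4_le_exp normalized_square_nonneg) simp
    finally show ?case by simp
  qed
qed

lemma inner_on_unit: "i \<in> {1..n} \<Longrightarrow> inner_on n (\<lambda>j. if j = i then 1 else 0) y = y i"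
proof -
  assume "i \<in> {1..n}"
  have "(\<Sum>j\<in>{1..n}. (if j = i then 1 else 0) * y j) = (\<Sum>j\<in>{1..n}. if j = i then y i else 0)"
    by (intro sum.cong) auto
  then show ?thesis using \<open>i \<in> {1..n}\<close> by (simp add: inner_on_def)
qed

end

lemma observed_pairs_iff: "(i, j) \<in> observed_pairs n P \<longleftrightarrow> i \<in> {1..n} \<and> j \<in> {1..n} \<and> P i j \<noteq> 0"
  by (simp add: observed_pairs_def)

lemma sum_observed_pairs:
  "(\<Sum>i\<in>{1..n}. \<Sum>j\<in>{1..n}. if (i, j) \<in> observed_pairs n P then f i j else 0)
    = (\<Sum>(i, j)\<in>observed_pairs n P. f i j)" for f :: "nat \<Rightarrow> nat \<Rightarrow> real"
proof -
  have "(\<Sum>i\<in>{1..n}. \<Sum>j\<in>{1..n}. if (i, j) \<in> observed_pairs n P then f i j else 0)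
    = (\<Sum>z\<in>{1..n} \<times> {1..n}. if z \<in> observed_pairs n P then (case z of (i, j) \<Rightarrow> f i j) else 0)"
    unfolding sum.cartesian_product by (intro sum.cong refl) auto
  also have "\<dots> = (\<Sum>z\<in>({1..n} \<times> {1..n}) \<inter> observed_pairs n P. (case z of (i, j) \<Rightarrow> f i j))"
    by (simp add: sum.inter_restrict)
  also have "({1..n} \<times> {1..n}) \<inter> observed_pairs n P = observed_pairs n P"
    by (auto simp: observed_pairs_def)
  finally show ?thesis by simp
qed

lemma p_hat_commute: "p_hat N d i j = p_hat N d j i"
  by (simp add: p_hat_def mult.commute)

lemma gamma_hat_commute: "gamma_hat N d i j = gamma_hat N d j i"
  by (simp add: gamma_hat_def p_hat_commute[of N d i j])

locale masked_sub_gaussian = sub_gaussian_law +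
  fixes N :: nat and d :: "nat \<Rightarrow> nat \<Rightarrow> real"
  assumes n3: "n \<ge> 3" and N: "real N \<ge> exp 2"
    and mask: "\<And>k i. k \<in> {1..N} \<Longrightarrow> i \<in> {1..n} \<Longrightarrow> d k i \<in> {0, 1}"
    and cov_nonzero: "op_norm n (\<lambda>i j. \<integral>y. y i * y j \<partial>\<mu>) > 0"
begin

definition S :: "nat \<Rightarrow> nat \<Rightarrow> real" where "S = (\<lambda>i j. \<integral>y. y i * y j \<partial>\<mu>)"
definition p :: "nat \<Rightarrow> nat \<Rightarrow> real" where "p = p_hat N d"
definition \<gamma> :: "nat \<Rightarrow> nat \<Rightarrow> real" where "\<gamma> = gamma_hat N d"
text \<open>The estimator is the average of these matrices over k. They are cut to zero outside
  \<open>{1..n}\<close> so as to belong to \<open>sym_mats\<close>.\<close>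

definition H :: "nat \<Rightarrow> (nat \<Rightarrow> real) \<Rightarrow> nat \<Rightarrow> nat \<Rightarrow> real" where
  "H k y i j = (if i \<in> {1..n} \<and> j \<in> {1..n} then \<gamma> i j * d k i * d k j * (y i * y j) else 0)"

abbreviation samples :: "(nat \<Rightarrow> nat \<Rightarrow> real) measure" where "samples \<equiv> Pi\<^sub>M {1..N} (\<lambda>_. \<mu>)"
abbreviation unit :: "nat \<Rightarrow> nat \<Rightarrow> real" where "unit i \<equiv> (\<lambda>j. if j = i then 1 else 0)"

lemma n1: "n \<ge> 1" using n3 by simp

lemma N_pos: "real N > 0" using N exp_gt_zero[of "2::real"] by linarith

lemma lnN: "ln (real N) \<ge> 2"
  using N N_pos by (simp add: ln_ge_iff)

lemma mask_nonneg: "k \<in> {1..N} \<Longrightarrow> i \<in> {1..n} \<Longrightarrow> d k i \<ge> 0"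
  using mask[of k i] by auto

lemma mask_idem: "k \<in> {1..N} \<Longrightarrow> i \<in> {1..n} \<Longrightarrow> (d k i)\<^sup>2 = d k i"
  using mask[of k i] by auto

lemma sum_mask: "(\<Sum>k\<in>{1..N}. d k i * d k j) = real N * p i j"
  using N_pos by (simp add: p_def p_hat_def)

lemma p_ge:
  assumes "i \<in> {1..n}" "j \<in> {1..n}" "k \<in> {1..N}" "d k i * d k j \<noteq> 0"
  shows "1 / real N \<le> p i j"
proof -
  have "1 \<le> d k i * d k j" using mask[of k i] mask[of k j] assms by auto
  also have "\<dots> \<le> (\<Sum>k\<in>{1..N}. d k i * d k j)"
    using assms by (intro member_le_sum mult_nonneg_nonneg mask_nonneg) auto
  finally show ?thesis using N_pos unfolding sum_mask by (simp add: field_simps)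
qed

text \<open>The frequency counts samples in which both coordinates are seen, so it is at least 1/N
  once it is nonzero. Hence the maximum in \<open>gamma_hat\<close> is inactive on observed
  pairs.\<close>

lemma p_ge_observed:
  assumes "(i, j) \<in> observed_pairs n p"
  shows "1 / real N \<le> p i j"
proof -
  have ij: "i \<in> {1..n}" "j \<in> {1..n}" "p i j \<noteq> 0" using assms by (auto simp: observed_pairs_iff)
  then have "(\<Sum>k\<in>{1..N}. d k i * d k j) \<noteq> 0" using sum_mask N_pos by simp
  then obtain k where "k \<in> {1..N}" "d k i * d k j \<noteq> 0" by (meson sum.not_neutral_contains_not_neutral)
  then show ?thesis using p_ge ij by blast
qed

lemma p_pos: "(i, j) \<in> observed_pairs n p \<Longrightarrow> 0 < p i j"
  using p_ge_observed[of i j] N_pos by (meson divide_pos_pos less_le_trans zero_less_one)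

lemma \<gamma>_observed: "(i, j) \<in> observed_pairs n p \<Longrightarrow> \<gamma> i j = 1 / p i j"
  using p_ge_observed[of i j] by (simp add: \<gamma>_def gamma_hat_def p_def[symmetric] inverse_eq_divide max_absorb1)

lemma mask_observed:
  assumes "i \<in> {1..n}" "j \<in> {1..n}" "k \<in> {1..N}" "(i, j) \<notin> observed_pairs n p"
  shows "d k i * d k j = 0"
proof (rule ccontr)
  assume "d k i * d k j \<noteq> 0"
  then have "1 / real N \<le> p i j" using p_ge assms by blast
  moreover have "p i j = 0" using assms by (simp add: observed_pairs_iff)
  ultimately show False using N_pos by (simp add: divide_le_0_iff)
qed

lemma scale_unit: "i \<in> {1..n} \<Longrightarrow> scale (unit i) = 2 / c\<^sub>0 * S i i"
  by (simp add: scale_def S_def inner_on_unit power2_eq_square)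

lemma S_diag_nonneg: "i \<in> {1..n} \<Longrightarrow> 0 \<le> S i i"
  by (simp add: S_def)

lemma product_integrable:
  assumes "i \<in> {1..n}" "j \<in> {1..n}"
  shows "integrable \<mu> (\<lambda>y. (y i * y j)\<^sup>2)" "integrable \<mu> (\<lambda>y. y i * y j)"
proof -
  show sq: "integrable \<mu> (\<lambda>y. (y i * y j)\<^sup>2)"
    using product_moment(1)[of "unit i" "unit j"] assms by (simp add: inner_on_unit power_mult_distrib)
  show "integrable \<mu> (\<lambda>y. y i * y j)"
    by (rule square_integrable_imp_integrable[OF _ sq])
      (intro borel_measurable_times coordinate_measurable assms)
qed

lemma second_moment_le: "(\<integral>y. (inner_on n u y)\<^sup>2 \<partial>\<mu>) \<le> op_norm n S * (\<Sum>i\<in>{1..n}. (u i)\<^sup>2)"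
proof -
  have "(inner_on n u y)\<^sup>2 = (\<Sum>i\<in>{1..n}. \<Sum>j\<in>{1..n}. u i * u j * (y i * y j))" for y
    unfolding inner_on_def power2_eq_square sum_product by (simp add: mult_ac)
  then have "(\<integral>y. (inner_on n u y)\<^sup>2 \<partial>\<mu>) = (\<Sum>i\<in>{1..n}. \<Sum>j\<in>{1..n}. u i * u j * S i j)"
    using product_integrable(2)
    by (simp add: S_def Bochner_Integration.integral_sum Bochner_Integration.integrable_sum del: atLeastAtMost_iff cong: sum.cong)
  also have "\<dots> = (\<Sum>i\<in>{1..n}. u i * mat_vec n S u i)"
    by (simp add: mat_vec_def sum_distrib_left mult_ac)
  finally show ?thesis using quadratic_form_le_op_norm[OF n1, of u S] by simp
qed

lemma H_sym: "H k y \<in> sym_mats {1..n}"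
  by (auto simp: sym_mats_def H_def \<gamma>_def gamma_hat_commute mult_ac)

lemma H_measurable: "(\<lambda>y. H k y i j) \<in> borel_measurable \<mu>"
proof (cases "i \<in> {1..n} \<and> j \<in> {1..n}")
  case True
  then have "(\<lambda>y. H k y i j) = (\<lambda>y. \<gamma> i j * d k i * d k j * (y i * y j))" by (simp add: H_def)
  then show ?thesis
    using True by (simp only:) (intro borel_measurable_times borel_measurable_const coordinate_measurable; simp)
next
  case False
  then show ?thesis unfolding H_def by (simp only: if_False) simp
qed

lemma H_square_integrable: "integrable \<mu> (\<lambda>y. (H k y i j)\<^sup>2)"
proof (cases "i \<in> {1..n} \<and> j \<in> {1..n}")
  case True
  have "integrable \<mu> (\<lambda>y. (\<gamma> i j * d k i * d k j)\<^sup>2 * (y i * y j)\<^sup>2)"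
    using product_integrable(1) True by (intro integrable_mult_right) auto
  then show ?thesis using True by (simp add: H_def power_mult_distrib)
next
  case False
  then show ?thesis unfolding H_def by (simp only: if_False) simp
qed

lemma H_mean: "i \<in> {1..n} \<Longrightarrow> j \<in> {1..n} \<Longrightarrow> (\<integral>y. H k y i j \<partial>\<mu>) = \<gamma> i j * d k i * d k j * S i j"
  by (simp add: H_def S_def)

lemma eighth_coordinate: "i \<in> {1..n} \<Longrightarrow> integrable \<mu> (\<lambda>y. (y i) ^ 8)"
  using eighth_moment[of "unit i"] by (simp add: inner_on_unit)

lemma product_H_square_integrable: "integrable \<mu> (\<lambda>y. (mat_mult {1..n} (H k y) (H k y) i j)\<^sup>2)"
proof -
  have "integrable \<mu> (\<lambda>y. (H k y i l * H k y l j)\<^sup>2)" if l: "l \<in> {1..n}" for l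
  proof (cases "i \<in> {1..n} \<and> j \<in> {1..n}")
    case True
    define c where "c = (\<gamma> i l * d k i * d k l * (\<gamma> l j * d k l * d k j))\<^sup>2"
    show ?thesis
    proof (rule Bochner_Integration.integrable_bound)
      show "integrable \<mu> (\<lambda>y. c * ((y i) ^ 8 + (y j) ^ 8 + (y l) ^ 8))"
        using eighth_coordinate True l by simp
      show "(\<lambda>y. (H k y i l * H k y l j)\<^sup>2) \<in> borel_measurable \<mu>"
        by (intro borel_measurable_power borel_measurable_times H_measurable)
      show "AE y in \<mu>. norm ((H k y i l * H k y l j)\<^sup>2) \<le> norm (c * ((y i) ^ 8 + (y j) ^ 8 + (y l) ^ 8))"
      proof (rule AE_I2)
        fix y
        have ag: "2 * (a * b) \<le> a\<^sup>2 + b\<^sup>2" for a b :: real using sum_squares_bound[of a b] by simp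
        \<comment> \<open>The monomial has degrees 2, 2 and 4 in the three coordinates; two
          applications of the arithmetic-geometric mean inequality reduce it to eighth
          powers.\<close>
        have "(H k y i l * H k y l j)\<^sup>2 = c * (((y i)\<^sup>2 * (y j)\<^sup>2) * (y l) ^ 4)"
          using True l by (simp add: H_def c_def power_mult_distrib power2_eq_square power4_eq_xxxx mult_ac)
        also have "\<dots> \<le> c * ((y i) ^ 8 + (y j) ^ 8 + (y l) ^ 8)"
        proof (rule mult_left_mono)
          have "2 * (((y i)\<^sup>2 * (y j)\<^sup>2) * (y l) ^ 4) \<le> ((y i) ^ 4 * (y j) ^ 4) + (y l) ^ 8"
            using ag[of "(y i)\<^sup>2 * (y j)\<^sup>2" "(y l) ^ 4"] by (simp add: power_mult_distrib flip: power_mult)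
          moreover have "2 * ((y i) ^ 4 * (y j) ^ 4) \<le> (y i) ^ 8 + (y j) ^ 8"
            using ag[of "(y i) ^ 4" "(y j) ^ 4"] by (simp flip: power_mult)
          moreover have "0 \<le> (y i) ^ 8" "0 \<le> (y j) ^ 8" "0 \<le> (y l) ^ 8" by auto
          ultimately show "((y i)\<^sup>2 * (y j)\<^sup>2) * (y l) ^ 4 \<le> (y i) ^ 8 + (y j) ^ 8 + (y l) ^ 8" by linarith
        qed (simp add: c_def)
        finally show "norm ((H k y i l * H k y l j)\<^sup>2) \<le> norm (c * ((y i) ^ 8 + (y j) ^ 8 + (y l) ^ 8))"
          by simp
      qed
    qed
  next
    case False
    then have "(\<lambda>y. (H k y i l * H k y l j)\<^sup>2) = (\<lambda>_. 0)" by (auto simp: H_def)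
    then show ?thesis by simp
  qed
  then show ?thesis
    unfolding mat_mult_def
    by (intro integrable_square_sum borel_measurable_times H_measurable) auto
qed

text \<open>This is \<open>r_min\<close> without its division by the norm of \<open>S\<close>;
  likewise \<open>total\<close> below is the square of that norm times \<open>r_2\<close>.\<close>

definition row_max :: real where
  "row_max = Max ((\<lambda>j. \<Sum>i | (i, j) \<in> observed_pairs n p. S i i / p i j) ` {1..n})"

definition total :: real where
  "total = (\<Sum>(i, j)\<in>observed_pairs n p. S i i * S j j / (p i j)\<^sup>2)"

lemma column_sum: "(\<Sum>i | (i, j) \<in> observed_pairs n p. f i) = (\<Sum>i\<in>{1..n}. if (i, j) \<in> observed_pairs n p then f i else 0)"
  for f :: "nat \<Rightarrow> real"
proof -
  have "{i. (i, j) \<in> observed_pairs n p} = {i\<in>{1..n}. (i, j) \<in> observed_pairs n p}"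
    by (auto simp: observed_pairs_def)
  then show ?thesis by (simp only: sum.inter_filter[OF finite_atLeastAtMost])
qed

lemma row_max_ge: "j \<in> {1..n} \<Longrightarrow> (\<Sum>i | (i, j) \<in> observed_pairs n p. S i i / p i j) \<le> row_max"
  unfolding row_max_def by (intro Max_ge) auto

lemma row_max_nonneg: "0 \<le> row_max"
proof -
  have "0 \<le> (\<Sum>i | (i, 1) \<in> observed_pairs n p. S i i / p i 1)"
    by (intro sum_nonneg divide_nonneg_nonneg S_diag_nonneg less_imp_le[OF p_pos])
      (auto simp: observed_pairs_iff)
  also have "\<dots> \<le> row_max" using n1 by (intro row_max_ge) auto
  finally show ?thesis .
qed

lemma total_nonneg: "0 \<le> total"
  unfolding total_def by (intro sum_nonneg) (auto simp: observed_pairs_iff intro!: divide_nonneg_nonneg mult_nonneg_nonneg S_diag_nonneg)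

text \<open>Row i of H_k y applied to u is d_ki y_i (w . y) with w_j = \<gamma>_ij d_kj u_j. Its
  second moment is at most 4 scale(e_i) scale(w), which gives 16 / \<open>c\<^sub>0\<close>^2 times
  S_ii times the norm of S times |w|^2. Summing over k turns the products of mask entries into N
  p_ij, and \<gamma>_ij^2 p_ij = 1 / p_ij on observed pairs leaves the column sums of
  \<open>row_max\<close>.\<close>

lemma variance_le:
  "(\<Sum>k\<in>{1..N}. \<integral>y. (\<Sum>i\<in>{1..n}. (mat_vec n (H k y) u i)\<^sup>2) \<partial>\<mu>)
    \<le> (16 / c\<^sub>0\<^sup>2 * op_norm n S * real N * row_max) * (\<Sum>j\<in>{1..n}. (u j)\<^sup>2)"
proof -
  let ?c = "16 / c\<^sub>0\<^sup>2 * op_norm n S"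
  have c: "?c \<ge> 0" using op_norm_nonneg[OF n1, of S] by simp
  define w where "w = (\<lambda>k i j. \<gamma> i j * d k j * u j)"
  have mv: "(mat_vec n (H k y) u i)\<^sup>2 = d k i * ((inner_on n (unit i) y)\<^sup>2 * (inner_on n (w k i) y)\<^sup>2)"
    if "k \<in> {1..N}" "i \<in> {1..n}" for k y i
  proof -
    have "mat_vec n (H k y) u i = d k i * (y i * inner_on n (w k i) y)"
      unfolding mat_vec_def inner_on_def w_def sum_distrib_left
      using that by (intro sum.cong) (auto simp: H_def)
    then show ?thesis using that by (simp add: inner_on_unit power_mult_distrib mask_idem)
  qed
  have "(\<Sum>k\<in>{1..N}. \<integral>y. (\<Sum>i\<in>{1..n}. (mat_vec n (H k y) u i)\<^sup>2) \<partial>\<mu>)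
    \<le> (\<Sum>k\<in>{1..N}. \<Sum>i\<in>{1..n}. \<Sum>j\<in>{1..n}. ?c * (S i i * ((\<gamma> i j)\<^sup>2 * (u j)\<^sup>2) * (d k i * d k j)))"
  proof (rule sum_mono)
    fix k assume k: "k \<in> {1..N}"
    have "(\<integral>y. (\<Sum>i\<in>{1..n}. (mat_vec n (H k y) u i)\<^sup>2) \<partial>\<mu>)
      = (\<integral>y. (\<Sum>i\<in>{1..n}. d k i * ((inner_on n (unit i) y)\<^sup>2 * (inner_on n (w k i) y)\<^sup>2)) \<partial>\<mu>)"
      by (intro Bochner_Integration.integral_cong refl sum.cong mv k)
    also have "\<dots> = (\<Sum>i\<in>{1..n}. d k i * (\<integral>y. (inner_on n (unit i) y)\<^sup>2 * (inner_on n (w k i) y)\<^sup>2 \<partial>\<mu>))"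
      using product_moment(1) by (subst Bochner_Integration.integral_sum) auto
    also have "\<dots> \<le> (\<Sum>i\<in>{1..n}. \<Sum>j\<in>{1..n}. ?c * (S i i * ((\<gamma> i j)\<^sup>2 * (u j)\<^sup>2) * (d k i * d k j)))"
    proof (rule sum_mono)
      fix i assume i: "i \<in> {1..n}"
      have "(\<integral>y. (inner_on n (unit i) y)\<^sup>2 * (inner_on n (w k i) y)\<^sup>2 \<partial>\<mu>) \<le> 4 * scale (unit i) * scale (w k i)"
        by (rule product_moment(2))
      also have "\<dots> \<le> 4 * scale (unit i) * (2 / c\<^sub>0 * (op_norm n S * (\<Sum>j\<in>{1..n}. (w k i j)\<^sup>2)))"
        unfolding scale_def[of "w k i"] using c0 scale_nonneg
        by (intro mult_left_mono second_moment_le) auto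
      also have "\<dots> = ?c * (S i i * (\<Sum>j\<in>{1..n}. (w k i j)\<^sup>2))"
        unfolding scale_unit[OF i] by (simp add: power2_eq_square)
      also have "(\<Sum>j\<in>{1..n}. (w k i j)\<^sup>2) = (\<Sum>j\<in>{1..n}. (\<gamma> i j)\<^sup>2 * (u j)\<^sup>2 * d k j)"
        using k by (intro sum.cong refl) (simp add: w_def power_mult_distrib mask_idem)
      finally have "d k i * (\<integral>y. (inner_on n (unit i) y)\<^sup>2 * (inner_on n (w k i) y)\<^sup>2 \<partial>\<mu>)
        \<le> d k i * (?c * (S i i * (\<Sum>j\<in>{1..n}. (\<gamma> i j)\<^sup>2 * (u j)\<^sup>2 * d k j)))"
        by (intro mult_left_mono mask_nonneg k i)
      also have "\<dots> = (\<Sum>j\<in>{1..n}. ?c * (S i i * ((\<gamma> i j)\<^sup>2 * (u j)\<^sup>2) * (d k i * d k j)))"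
        by (simp add: sum_distrib_left mult_ac)
      finally show "d k i * (\<integral>y. (inner_on n (unit i) y)\<^sup>2 * (inner_on n (w k i) y)\<^sup>2 \<partial>\<mu>)
        \<le> (\<Sum>j\<in>{1..n}. ?c * (S i i * ((\<gamma> i j)\<^sup>2 * (u j)\<^sup>2) * (d k i * d k j)))" .
    qed
    finally show "(\<integral>y. (\<Sum>i\<in>{1..n}. (mat_vec n (H k y) u i)\<^sup>2) \<partial>\<mu>)
      \<le> (\<Sum>i\<in>{1..n}. \<Sum>j\<in>{1..n}. ?c * (S i i * ((\<gamma> i j)\<^sup>2 * (u j)\<^sup>2) * (d k i * d k j)))" .
  qed
  also have "\<dots> = (\<Sum>i\<in>{1..n}. \<Sum>k\<in>{1..N}. \<Sum>j\<in>{1..n}. ?c * (S i i * ((\<gamma> i j)\<^sup>2 * (u j)\<^sup>2) * (d k i * d k j)))"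
    by (rule sum.swap)
  also have "\<dots> = (\<Sum>i\<in>{1..n}. \<Sum>j\<in>{1..n}. \<Sum>k\<in>{1..N}. ?c * (S i i * ((\<gamma> i j)\<^sup>2 * (u j)\<^sup>2) * (d k i * d k j)))"
    by (rule sum.cong[OF refl], rule sum.swap)
  also have "\<dots> = (\<Sum>j\<in>{1..n}. \<Sum>i\<in>{1..n}. \<Sum>k\<in>{1..N}. ?c * (S i i * ((\<gamma> i j)\<^sup>2 * (u j)\<^sup>2) * (d k i * d k j)))"
    by (rule sum.swap)
  also have "\<dots> = (\<Sum>j\<in>{1..n}. ?c * real N * (u j)\<^sup>2 * (\<Sum>i | (i, j) \<in> observed_pairs n p. S i i / p i j))"
  proof (rule sum.cong[OF refl])
    fix j assume j: "j \<in> {1..n}"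
    have "(\<Sum>k\<in>{1..N}. ?c * (S i i * ((\<gamma> i j)\<^sup>2 * (u j)\<^sup>2) * (d k i * d k j)))
      = ?c * real N * (u j)\<^sup>2 * (if (i, j) \<in> observed_pairs n p then S i i / p i j else 0)"
      if i: "i \<in> {1..n}" for i
    proof -
      have "(\<Sum>k\<in>{1..N}. ?c * (S i i * ((\<gamma> i j)\<^sup>2 * (u j)\<^sup>2) * (d k i * d k j)))
        = ?c * (S i i * ((\<gamma> i j)\<^sup>2 * (u j)\<^sup>2) * (real N * p i j))"
        unfolding sum_mask[symmetric] by (simp only: sum_distrib_left)
      also have "\<dots> = ?c * real N * (u j)\<^sup>2 * (S i i * ((\<gamma> i j)\<^sup>2 * p i j))" by (simp add: mult_ac)
      also have "S i i * ((\<gamma> i j)\<^sup>2 * p i j) = (if (i, j) \<in> observed_pairs n p then S i i / p i j else 0)"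
        using i j p_pos[of i j] by (auto simp: \<gamma>_observed power2_eq_square) (simp add: observed_pairs_iff)
      finally show ?thesis .
    qed
    then show "(\<Sum>i\<in>{1..n}. \<Sum>k\<in>{1..N}. ?c * (S i i * ((\<gamma> i j)\<^sup>2 * (u j)\<^sup>2) * (d k i * d k j)))
      = ?c * real N * (u j)\<^sup>2 * (\<Sum>i | (i, j) \<in> observed_pairs n p. S i i / p i j)"
      unfolding column_sum sum_distrib_left by (intro sum.cong refl)
  qed
  also have "\<dots> \<le> (\<Sum>j\<in>{1..n}. ?c * real N * (u j)\<^sup>2 * row_max)"
    by (intro sum_mono mult_left_mono row_max_ge mult_nonneg_nonneg c) auto
  also have "\<dots> = (?c * real N * row_max) * (\<Sum>j\<in>{1..n}. (u j)\<^sup>2)"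
    unfolding sum_distrib_left by (intro sum.cong refl) (simp only: mult_ac)
  finally show ?thesis .
qed

text \<open>Since \<open>a\<^sup>4 \<le> 8 (ln N)\<^sup>4 + 512 e\<^sup>a / N\<close>, the random variable \<open>max_sq\<close> dominates all \<open>N\<close> squared
  Frobenius norms at once.\<close>

definition weight :: "nat \<Rightarrow> nat \<Rightarrow> real" where
  "weight i j = scale (unit i) * scale (unit j) / (p i j)\<^sup>2"

text \<open>A sum over k in place of a maximum: it dominates the squared product of the normalised
  squares of coordinates i and j for every sample. The 256 is half of the 512 in
  \<open>pow4_le_log_exp\<close>, by 2 (ab)^2 <= a^4 + b^4.\<close>

definition fourth_bound :: "nat \<Rightarrow> nat \<Rightarrow> (nat \<Rightarrow> nat \<Rightarrow> real) \<Rightarrow> real" where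
  "fourth_bound i j x = 8 * (ln (real N)) ^ 4 + 256 / real N *
     (\<Sum>k\<in>{1..N}. exp (normalized_square (unit i) (x k)) + exp (normalized_square (unit j) (x k)))"

text \<open>Weighted Cauchy-Schwarz bounds the sum of weight times a_i a_j by this root. Its square
  is linear in \<open>fourth_bound\<close>, so the second moment needs nothing beyond the mean of
  \<open>fourth_bound\<close>.\<close>

definition max_sq :: "(nat \<Rightarrow> nat \<Rightarrow> real) \<Rightarrow> real" where
  "max_sq x = sqrt ((\<Sum>(i, j)\<in>observed_pairs n p. weight i j)
     * (\<Sum>(i, j)\<in>observed_pairs n p. weight i j * fourth_bound i j x))"

lemma weight_nonneg: "0 \<le> weight i j"
  by (simp add: weight_def scale_nonneg)

lemma weight_sum: "(\<Sum>(i, j)\<in>observed_pairs n p. weight i j) = 4 / c\<^sub>0\<^sup>2 * total"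
  unfolding total_def sum_distrib_left
  by (intro sum.cong refl) (auto simp: weight_def scale_unit observed_pairs_iff power2_eq_square)

lemma fourth_bound_nonneg: "0 \<le> fourth_bound i j x"
  unfolding fourth_bound_def
  by (intro add_nonneg_nonneg mult_nonneg_nonneg sum_nonneg) auto

lemma max_sq_square:
  "(max_sq x)\<^sup>2 = (\<Sum>(i, j)\<in>observed_pairs n p. weight i j)
     * (\<Sum>(i, j)\<in>observed_pairs n p. weight i j * fourth_bound i j x)"
  unfolding max_sq_def
  by (intro real_sqrt_pow2 mult_nonneg_nonneg sum_nonneg)
    (auto intro: mult_nonneg_nonneg weight_nonneg fourth_bound_nonneg)

lemma max_sq_nonneg: "0 \<le> max_sq x"
  unfolding max_sq_def
  by (intro real_sqrt_ge_zero mult_nonneg_nonneg sum_nonneg)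
    (auto intro: mult_nonneg_nonneg weight_nonneg fourth_bound_nonneg)

text \<open>The identity \<open>sq\<close> is a hypothesis because for coordinates of variance 0 it
  holds only almost surely; this keeps the estimate itself pointwise.\<close>

lemma frob_le_max_sq:
  assumes k: "k \<in> {1..N}" and sq: "\<And>i. i \<in> {1..n} \<Longrightarrow> (x k i)\<^sup>2 = scale (unit i) * normalized_square (unit i) (x k)"
  shows "frob {1..n} (H k (x k)) (H k (x k)) \<le> max_sq x"
proof -
  define a where "a = (\<lambda>i. normalized_square (unit i) (x k))"
  have a0: "0 \<le> a i" for i by (simp add: a_def normalized_square_nonneg)
  let ?E = "observed_pairs n p"
  have entry: "(H k (x k) i j)\<^sup>2 \<le> (if (i, j) \<in> ?E then weight i j * (a i * a j) else 0)"
    if ij: "i \<in> {1..n}" "j \<in> {1..n}" for i j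
  proof (cases "(i, j) \<in> ?E")
    case True
    have "(H k (x k) i j)\<^sup>2 = (\<gamma> i j)\<^sup>2 * ((x k i)\<^sup>2 * (x k j)\<^sup>2) * (d k i * d k j)"
      using ij k by (simp add: H_def power_mult_distrib mask_idem)
    also have "\<dots> \<le> (\<gamma> i j)\<^sup>2 * ((x k i)\<^sup>2 * (x k j)\<^sup>2) * 1"
      using mask[OF k ij(1)] mask[OF k ij(2)] by (intro mult_left_mono) auto
    also have "\<dots> = weight i j * (a i * a j)"
      unfolding sq[OF ij(1)] sq[OF ij(2)] \<gamma>_observed[OF True] weight_def a_def by (simp add: power_divide)
    finally show ?thesis using True by simp
  next
    case False
    then have "H k (x k) i j = 0" using mask_observed[OF ij k False] ij by (auto simp: H_def)
    then show ?thesis using False by simp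
  qed
  have "frob {1..n} (H k (x k)) (H k (x k)) \<le> (\<Sum>i\<in>{1..n}. \<Sum>j\<in>{1..n}. if (i, j) \<in> ?E then weight i j * (a i * a j) else 0)"
    unfolding frob_self by (intro sum_mono entry)
  also have "\<dots> = (\<Sum>(i, j)\<in>?E. weight i j * (a i * a j))"
    by (rule sum_observed_pairs)
  also have "\<dots> \<le> max_sq x"
    unfolding max_sq_def
  proof (rule real_le_rsqrt)
    have "(\<Sum>(i, j)\<in>?E. weight i j * (a i * a j))\<^sup>2
      = (\<Sum>z\<in>?E. sqrt (weight (fst z) (snd z)) * (sqrt (weight (fst z) (snd z)) * (a (fst z) * a (snd z))))\<^sup>2"
      by (simp add: split_beta' mult.assoc[symmetric] weight_nonneg)
    also have "\<dots> \<le> (\<Sum>z\<in>?E. (sqrt (weight (fst z) (snd z)))\<^sup>2)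
      * (\<Sum>z\<in>?E. (sqrt (weight (fst z) (snd z)) * (a (fst z) * a (snd z)))\<^sup>2)"
      by (rule Cauchy_Schwarz_ineq_sum)
    also have "\<dots> = (\<Sum>(i, j)\<in>?E. weight i j) * (\<Sum>(i, j)\<in>?E. weight i j * (a i * a j)\<^sup>2)"
      by (simp add: split_beta' power_mult_distrib weight_nonneg)
    also have "\<dots> \<le> (\<Sum>(i, j)\<in>?E. weight i j) * (\<Sum>(i, j)\<in>?E. weight i j * fourth_bound i j x)"
    proof (intro mult_left_mono sum_mono)
      have "(a i * a j)\<^sup>2 \<le> fourth_bound i j x" for i j
      proof -
        have e: "a i ^ 4 \<le> 8 * (ln (real N)) ^ 4 + 512 * exp (a i) / real N" for i
          using lnN N_pos by (intro pow4_le_log_exp a0) auto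
        have "2 * (a i * a j)\<^sup>2 \<le> a i ^ 4 + a j ^ 4"
          using sum_squares_bound[of "(a i)\<^sup>2" "(a j)\<^sup>2"] by (simp add: power_mult_distrib flip: power_mult)
        also have "\<dots> \<le> (8 * (ln (real N)) ^ 4 + 512 * exp (a i) / real N) + (8 * (ln (real N)) ^ 4 + 512 * exp (a j) / real N)"
          by (intro add_mono e)
        also have "\<dots> = 2 * (8 * (ln (real N)) ^ 4 + 256 / real N * (exp (a i) + exp (a j)))"
          by (simp add: distrib_left)
        finally have "(a i * a j)\<^sup>2 \<le> 8 * (ln (real N)) ^ 4 + 256 / real N * (exp (a i) + exp (a j))"
          by (simp only: mult_le_cancel_left_pos[OF zero_less_numeral])
        also have "\<dots> \<le> 8 * (ln (real N)) ^ 4 + 256 / real N *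
          (\<Sum>k\<in>{1..N}. exp (normalized_square (unit i) (x k)) + exp (normalized_square (unit j) (x k)))"
          unfolding a_def using k N_pos
          by (intro add_left_mono mult_left_mono member_le_sum[of k "{1..N}" "\<lambda>k. exp (normalized_square (unit i) (x k)) + exp (normalized_square (unit j) (x k))"]) (auto intro: add_nonneg_nonneg)
        finally show ?thesis
          by (simp only: fourth_bound_def)
      qed
      then show "(case z of (i, j) \<Rightarrow> weight i j * (a i * a j)\<^sup>2) \<le> (case z of (i, j) \<Rightarrow> weight i j * fourth_bound i j x)" for z
        by (auto simp: split_beta' intro!: mult_left_mono weight_nonneg)
      show "0 \<le> (\<Sum>(i, j)\<in>?E. weight i j)" by (intro sum_nonneg) (auto simp: weight_nonneg)
    qed
    finally show "(\<Sum>(i, j)\<in>?E. weight i j * (a i * a j))\<^sup>2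
      \<le> (\<Sum>(i, j)\<in>?E. weight i j) * (\<Sum>(i, j)\<in>?E. weight i j * fourth_bound i j x)" .
  qed
  finally show ?thesis .
qed

section \<open>Integrals over the sample\<close>

lemma component_integral:
  fixes f :: "(nat \<Rightarrow> real) \<Rightarrow> real"
  assumes "k \<in> {1..N}" "f \<in> borel_measurable \<mu>"
  shows "(\<integral>x. f (x k) \<partial>samples) = (\<integral>y. f y \<partial>\<mu>)"
proof -
  have "distr samples \<mu> (\<lambda>x. x k) = \<mu>"
    by (rule distr_PiM_component[OF _ assms(1)]) (rule prob_space_axioms)
  then show ?thesis
    using integral_distr[OF measurable_component_singleton[OF assms(1)] assms(2)] by metis
qed

lemma component_integrable:
  fixes f :: "(nat \<Rightarrow> real) \<Rightarrow> real"
  assumes "k \<in> {1..N}" "integrable \<mu> f"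
  shows "integrable samples (\<lambda>x. f (x k))"
proof -
  have "distr samples \<mu> (\<lambda>x. x k) = \<mu>"
    by (rule distr_PiM_component[OF _ assms(1)]) (rule prob_space_axioms)
  then show ?thesis
    using assms(2) integrable_distr[OF measurable_component_singleton[OF assms(1)], of "\<lambda>_. \<mu>" f] by simp
qed

lemma samples_prob: "prob_space samples"
  by (intro prob_space_PiM prob_space_axioms)

lemma fourth_bound_integral:
  "integrable samples (fourth_bound i j)" "(\<integral>x. fourth_bound i j x \<partial>samples) \<le> 72 * (ln (real N)) ^ 4"
proof -
  interpret P: prob_space samples by (rule samples_prob)
  let ?e = "\<lambda>k x. exp (normalized_square (unit i) (x k)) + exp (normalized_square (unit j) (x k))"
  have ie1: "integrable samples (\<lambda>x. exp (normalized_square u (x k)))" if "k \<in> {1..N}" for u k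
    by (rule component_integrable[OF that normalized_square_exp(1)])
  have val: "(\<integral>x. exp (normalized_square u (x k)) \<partial>samples) \<le> 2" if "k \<in> {1..N}" for u k
    using component_integral[OF that borel_measurable_integrable[OF normalized_square_exp(1)], of u]
      normalized_square_exp(2)[of u] by simp
  have ie: "integrable samples (?e k)" if "k \<in> {1..N}" for k
    by (intro Bochner_Integration.integrable_add ie1 that)
  have isum: "integrable samples (\<lambda>x. \<Sum>k\<in>{1..N}. ?e k x)"
    by (intro Bochner_Integration.integrable_sum ie)
  show "integrable samples (fourth_bound i j)"
    unfolding fourth_bound_def using isum by simp
  have le: "(\<integral>x. ?e k x \<partial>samples) \<le> 4" if k: "k \<in> {1..N}" for k
    using val[OF k, of "unit i"] val[OF k, of "unit j"]
    by (simp add: Bochner_Integration.integral_add[OF ie1[OF k] ie1[OF k]])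
  have "(\<integral>x. fourth_bound i j x \<partial>samples) = 8 * (ln (real N)) ^ 4 + 256 / real N * (\<integral>x. (\<Sum>k\<in>{1..N}. ?e k x) \<partial>samples)"
    unfolding fourth_bound_def using isum by (subst Bochner_Integration.integral_add) (simp_all add: P.prob_space)
  also have "(\<integral>x. (\<Sum>k\<in>{1..N}. ?e k x) \<partial>samples) = (\<Sum>k\<in>{1..N}. \<integral>x. ?e k x \<partial>samples)"
    by (intro Bochner_Integration.integral_sum ie)
  also have "8 * (ln (real N)) ^ 4 + 256 / real N * (\<Sum>k\<in>{1..N}. \<integral>x. ?e k x \<partial>samples)
      \<le> 8 * (ln (real N)) ^ 4 + 256 / real N * (\<Sum>k\<in>{1..N}. 4)"
    by (intro add_left_mono mult_left_mono sum_mono le) auto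
  also have "\<dots> = 8 * (ln (real N)) ^ 4 + 1024" using N_pos by simp
  \<comment> \<open>1024 = 64 * 2^4, and 2 <= ln N.\<close>
  also have "\<dots> \<le> 72 * (ln (real N)) ^ 4"
    using power_mono[OF lnN, of 4] by simp
  finally show "(\<integral>x. fourth_bound i j x \<partial>samples) \<le> 72 * (ln (real N)) ^ 4" .
qed

lemma max_sq_second_moment:
  "integrable samples (\<lambda>x. (max_sq x)\<^sup>2)"
  "sqrt (\<integral>x. (max_sq x)\<^sup>2 \<partial>samples) \<le> 36 / c\<^sub>0\<^sup>2 * total * (ln (real N))\<^sup>2"
proof -
  let ?E = "observed_pairs n p"
  let ?W = "\<Sum>(i, j)\<in>?E. weight i j"
  have W0: "?W \<ge> 0" by (intro sum_nonneg) (auto simp: weight_nonneg)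
  have i: "integrable samples (\<lambda>x. case z of (i, j) \<Rightarrow> weight i j * fourth_bound i j x)" for z
    using fourth_bound_integral(1) by (auto simp: split_beta')
  show "integrable samples (\<lambda>x. (max_sq x)\<^sup>2)"
    unfolding max_sq_square by (intro integrable_mult_right Bochner_Integration.integrable_sum i)
  have "(\<integral>x. (max_sq x)\<^sup>2 \<partial>samples) = ?W * (\<Sum>z\<in>?E. \<integral>x. (case z of (i, j) \<Rightarrow> weight i j * fourth_bound i j x) \<partial>samples)"
    unfolding max_sq_square using i by (simp add: Bochner_Integration.integral_sum)
  also have "\<dots> \<le> ?W * (\<Sum>(i, j)\<in>?E. weight i j * (72 * (ln (real N)) ^ 4))"
    using fourth_bound_integral W0
    by (intro mult_left_mono sum_mono) (auto simp: split_beta' intro!: mult_left_mono weight_nonneg)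
  also have "\<dots> = 72 * (?W * (ln (real N))\<^sup>2)\<^sup>2"
  proof -
    have "(\<Sum>(i, j)\<in>?E. weight i j * (72 * (ln (real N)) ^ 4)) = ?W * (72 * (ln (real N)) ^ 4)"
      by (simp add: split_beta' sum_distrib_right)
    then show ?thesis by (simp add: power2_eq_square power4_eq_xxxx)
  qed
  \<comment> \<open>72 <= 81; together with the factor 4 / \<open>c\<^sub>0\<close>^2 of
    \<open>weight_sum\<close> this gives the 36.\<close>
  also have "\<dots> \<le> (9 * (?W * (ln (real N))\<^sup>2))\<^sup>2" by (simp add: power_mult_distrib)
  finally have "sqrt (\<integral>x. (max_sq x)\<^sup>2 \<partial>samples) \<le> 9 * (?W * (ln (real N))\<^sup>2)"
    using W0 by (intro real_le_lsqrt) auto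
  then show "sqrt (\<integral>x. (max_sq x)\<^sup>2 \<partial>samples) \<le> 36 / c\<^sub>0\<^sup>2 * total * (ln (real N))\<^sup>2"
    unfolding weight_sum by simp
qed

lemma max_sq_measurable: "max_sq \<in> borel_measurable samples"
proof -
  have "(\<lambda>x. case z of (i, j) \<Rightarrow> weight i j * fourth_bound i j x) \<in> borel_measurable samples" for z
    using borel_measurable_integrable[OF fourth_bound_integral(1)] by (cases z) simp
  then have [measurable]: "(\<lambda>x. \<Sum>(i, j)\<in>observed_pairs n p. weight i j * fourth_bound i j x) \<in> borel_measurable samples"
    by (rule borel_measurable_sum)
  show ?thesis unfolding max_sq_def by measurable
qed

lemma frob_le_max_sq_AE:
  "AE x in samples. \<forall>k\<in>{1..N}. frob {1..n} (H k (x k)) (H k (x k)) \<le> max_sq x"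
proof -
  have "AE x in samples. \<forall>k\<in>{1..N}. \<forall>i\<in>{1..n}. (inner_on n (unit i) (x k))\<^sup>2 = scale (unit i) * normalized_square (unit i) (x k)"
    by (intro AE_finite_allI finite_atLeastAtMost AE_PiM_component square_eq_scale_AE prob_space_axioms)
  then show ?thesis
  proof eventually_elim
    case (elim x)
    show ?case
    proof
      fix k assume k: "k \<in> {1..N}"
      have "(x k i)\<^sup>2 = scale (unit i) * normalized_square (unit i) (x k)" if i: "i \<in> {1..n}" for i
      proof -
        have "(inner_on n (unit i) (x k))\<^sup>2 = scale (unit i) * normalized_square (unit i) (x k)"
          using elim k i by blast
        then show ?thesis unfolding inner_on_unit[OF i] .
      qed
      then show "frob {1..n} (H k (x k)) (H k (x k)) \<le> max_sq x" by (rule frob_le_max_sq[OF k])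
    qed
  qed
qed

section \<open>The estimator and its error for a fixed mask\<close>

definition err :: "(nat \<Rightarrow> nat \<Rightarrow> real) \<Rightarrow> real" where
  "err x = op_norm n (\<lambda>i j. sigma_hat N d x i j - restrict_mat (observed_pairs n (p_hat N d)) S i j)"

lemma sigma_hat_eq:
  "i \<in> {1..n} \<Longrightarrow> j \<in> {1..n} \<Longrightarrow> sigma_hat N d x i j = 1 / real N * (\<Sum>k\<in>{1..N}. H k (x k) i j)"
  by (simp add: sigma_hat_def observation_def H_def \<gamma>_def sum_distrib_right sum_distrib_left mult_ac)

lemma restrict_mat_eq:
  assumes "i \<in> {1..n}" "j \<in> {1..n}"
  shows "restrict_mat (observed_pairs n (p_hat N d)) S i j = 1 / real N * (\<Sum>k\<in>{1..N}. \<integral>y. H k y i j \<partial>\<mu>)"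
proof -
  have "(\<Sum>k\<in>{1..N}. \<integral>y. H k y i j \<partial>\<mu>) = (\<Sum>k\<in>{1..N}. \<gamma> i j * S i j * (d k i * d k j))"
    by (intro sum.cong refl) (simp add: H_mean[OF assms])
  also have "\<dots> = \<gamma> i j * S i j * (real N * p i j)" by (simp only: sum_distrib_left[symmetric] sum_mask)
  finally have "1 / real N * (\<Sum>k\<in>{1..N}. \<integral>y. H k y i j \<partial>\<mu>) = S i j * (\<gamma> i j * p i j)"
    using N_pos by simp
  moreover have "\<gamma> i j * p i j = (if (i, j) \<in> observed_pairs n p then 1 else 0)"
    using p_pos[of i j] \<gamma>_observed[of i j] assms by (auto simp: observed_pairs_iff)
  ultimately show ?thesis by (simp add: restrict_mat_def p_def)
qed

lemma sigma_hat_mean: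
  assumes ij: "i \<in> {1..n}" "j \<in> {1..n}"
  shows "integrable samples (\<lambda>x. sigma_hat N d x i j)"
    and "(\<integral>x. sigma_hat N d x i j \<partial>samples) = restrict_mat (observed_pairs n (p_hat N d)) S i j"
proof -
  have H1: "integrable \<mu> (\<lambda>y. H k y i j)" for k
    by (rule square_integrable_imp_integrable[OF H_measurable H_square_integrable])
  have H1': "integrable samples (\<lambda>x. H k (x k) i j)" if "k \<in> {1..N}" for k
    by (rule component_integrable[OF that H1])
  show "integrable samples (\<lambda>x. sigma_hat N d x i j)"
    unfolding sigma_hat_eq[OF ij] by (intro integrable_mult_right Bochner_Integration.integrable_sum H1')
  have "(\<integral>x. sigma_hat N d x i j \<partial>samples) = 1 / real N * (\<Sum>k\<in>{1..N}. \<integral>x. H k (x k) i j \<partial>samples)"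
    unfolding sigma_hat_eq[OF ij] using H1' by (simp add: Bochner_Integration.integral_sum)
  also have "\<dots> = 1 / real N * (\<Sum>k\<in>{1..N}. \<integral>y. H k y i j \<partial>\<mu>)"
    by (intro arg_cong2[of _ _ _ _ "(*)"] refl sum.cong component_integral H_measurable)
  finally show "(\<integral>x. sigma_hat N d x i j \<partial>samples) = restrict_mat (observed_pairs n (p_hat N d)) S i j"
    by (simp add: restrict_mat_eq[OF ij])
qed

lemma error_bound:
  "integrable samples (\<lambda>x. (err x)\<^sup>2)"
  "sqrt (\<integral>x. (err x)\<^sup>2 \<partial>samples) \<le> 144 / c\<^sub>0 * op_norm n S *
     (sqrt (8 * exp 1 * ln (real n) * r_min n S (p_hat N d) / real N)
      + 4 * exp 2 * ln (real n) * ln (real N) * r_2 n S (p_hat N d) / real N)"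
proof -
  define Y where "Y = (\<lambda>x. (op_norm n (\<lambda>i j. \<Sum>k\<in>{1..N}. H k (x k) i j - (\<integral>y. H k y i j \<partial>\<mu>)))\<^sup>2)"
  define s where "s = op_norm n S"
  define l where "l = ln (real n)"
  define L where "L = ln (real N)"
  define r1 where "r1 = r_min n S p"
  define r2 where "r2 = r_2 n S p"
  have s: "s > 0" using cov_nonzero by (simp add: s_def S_def)
  have l: "l > 0" using n3 by (simp add: l_def)
  have L: "L > 0" using lnN by (simp add: L_def)
  have r1: "row_max = s * r1" using s by (simp add: r1_def r_min_def s_def row_max_def)
  have r1': "r1 \<ge> 0" using row_max_nonneg s r1 by (simp add: zero_le_mult_iff)
  have "r2 = 1 / s * sqrt total" by (simp add: r2_def r_2_def s_def total_def)
  then have r2: "total = (s * r2)\<^sup>2" using s total_nonneg by (simp add: power_mult_distrib power_divide)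
  have r2': "r2 \<ge> 0" using \<open>r2 = 1 / s * sqrt total\<close> s total_nonneg by simp
  have rho0: "0 \<le> 16 / c\<^sub>0\<^sup>2 * op_norm n S * real N * row_max"
    by (intro mult_nonneg_nonneg op_norm_nonneg n1 row_max_nonneg) auto
  note ros = matrix_rosenthal[OF prob_space_axioms n3 finite_atLeastAtMost H_sym H_measurable
      H_square_integrable product_H_square_integrable variance_le rho0 max_sq_nonneg max_sq_measurable
      max_sq_second_moment(1) frob_le_max_sq_AE, folded Y_def]
  have err: "(err x)\<^sup>2 \<le> (1 / real N)\<^sup>2 * Y x" for x
  proof -
    have "err x = op_norm n (\<lambda>i j. 1 / real N * (\<Sum>k\<in>{1..N}. H k (x k) i j - (\<integral>y. H k y i j \<partial>\<mu>)))"
      unfolding err_def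
      by (rule op_norm_cong) (simp add: sigma_hat_eq restrict_mat_eq sum_subtractf right_diff_distrib)
    then show ?thesis unfolding Y_def by (simp only: op_norm_scale_sq[OF n1])
  qed
  have errm: "err \<in> borel_measurable samples"
    unfolding err_def
    by (rule measurable_op_norm[OF n1])
      (intro borel_measurable_diff borel_measurable_const borel_measurable_integrable sigma_hat_mean(1))
  show int: "integrable samples (\<lambda>x. (err x)\<^sup>2)"
  proof (rule Bochner_Integration.integrable_bound)
    show "integrable samples (\<lambda>x. (1 / real N)\<^sup>2 * Y x)" using ros(1) by simp
    show "AE x in samples. norm ((err x)\<^sup>2) \<le> norm ((1 / real N)\<^sup>2 * Y x)"
      using err by (intro AE_I2) (auto intro: order_trans[OF _ abs_ge_self])
  qed (use errm in measurable)
  define a where "a = sqrt (8 * exp 1 * l * r1 / real N)"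
  define b where "b = 4 * exp 2 * l * L * r2 / real N"
  have ab: "a \<ge> 0" "b \<ge> 0" using l L r1' r2' by (auto simp: a_def b_def)
  define \<kappa> where "\<kappa> = 64 * exp 1 * l"
  have \<kappa>: "\<kappa> \<ge> 0" using l by (simp add: \<kappa>_def)
  have "(\<integral>x. (err x)\<^sup>2 \<partial>samples) \<le> (\<integral>x. (1 / real N)\<^sup>2 * Y x \<partial>samples)"
    using ros(1) int err by (intro integral_mono) auto
  also have "\<dots> = (1 / real N)\<^sup>2 * integral\<^sup>L samples Y" by simp
  also have "\<dots> \<le> (1 / real N)\<^sup>2 * (2 * \<kappa> * (16 / c\<^sub>0\<^sup>2 * s * real N * row_max)
      + 2 * \<kappa>\<^sup>2 * sqrt (\<integral>x. (max_sq x)\<^sup>2 \<partial>samples))"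
    using ros(2) by (intro mult_left_mono) (simp_all add: \<kappa>_def l_def s_def)
  also have "\<dots> \<le> (1 / real N)\<^sup>2 * (2 * \<kappa> * (16 / c\<^sub>0\<^sup>2 * s * real N * row_max)
      + 2 * \<kappa>\<^sup>2 * (36 / c\<^sub>0\<^sup>2 * total * L\<^sup>2))"
    using max_sq_second_moment(2) by (intro mult_left_mono add_left_mono) (auto simp: L_def)
  also have "\<dots> = s\<^sup>2 / c\<^sub>0\<^sup>2 * (256 * (8 * exp 1 * l * r1 / real N))
      + s\<^sup>2 / c\<^sub>0\<^sup>2 * (72 * 4096 * ((exp 1)\<^sup>2 * l\<^sup>2 * L\<^sup>2 * r2\<^sup>2 / (real N)\<^sup>2))"
    unfolding r1 r2 \<kappa>_def using N_pos c0 by (simp add: field_simps power2_eq_square)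
  \<comment> \<open>The number 144 is set by the second comparison, 72 * 4096 <= 144^2 * 16, where
    16 is the square of the 4 in \<open>b\<close>; the first only asks for 256 <= 144^2.\<close>
  also have "\<dots> \<le> s\<^sup>2 / c\<^sub>0\<^sup>2 * (144\<^sup>2 * a\<^sup>2) + s\<^sup>2 / c\<^sub>0\<^sup>2 * (144\<^sup>2 * b\<^sup>2)"
  proof (intro add_mono mult_left_mono)
    have a2: "a\<^sup>2 = 8 * exp 1 * l * r1 / real N" using l r1' by (simp add: a_def)
    show "256 * (8 * exp 1 * l * r1 / real N) \<le> 144\<^sup>2 * a\<^sup>2"
      unfolding a2[symmetric] by simp
    have e: "(exp 1 :: real)\<^sup>2 \<le> (exp 2)\<^sup>2" by (intro power_mono) auto
    have "72 * 4096 * ((exp 1)\<^sup>2 * l\<^sup>2 * L\<^sup>2 * r2\<^sup>2 / (real N)\<^sup>2)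
      = (72 * 4096 * (l\<^sup>2 * L\<^sup>2 * r2\<^sup>2 / (real N)\<^sup>2)) * (exp 1)\<^sup>2" by simp
    also have "\<dots> \<le> (144\<^sup>2 * 16 * (l\<^sup>2 * L\<^sup>2 * r2\<^sup>2 / (real N)\<^sup>2)) * (exp 2)\<^sup>2"
      by (rule mult_mono[OF mult_right_mono e]) auto
    also have "\<dots> = 144\<^sup>2 * b\<^sup>2" by (simp add: b_def power_mult_distrib power_divide)
    finally show "72 * 4096 * ((exp 1)\<^sup>2 * l\<^sup>2 * L\<^sup>2 * r2\<^sup>2 / (real N)\<^sup>2) \<le> 144\<^sup>2 * b\<^sup>2" .
  qed auto
  also have "\<dots> = (144 / c\<^sub>0 * s)\<^sup>2 * (a\<^sup>2 + b\<^sup>2)"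
  proof -
    have "(144 / c\<^sub>0 * s)\<^sup>2 = s\<^sup>2 / c\<^sub>0\<^sup>2 * 144\<^sup>2" by (simp add: power_mult_distrib power_divide)
    then show ?thesis by (simp only: distrib_left mult.assoc)
  qed
  also have "\<dots> \<le> (144 / c\<^sub>0 * s)\<^sup>2 * (a + b)\<^sup>2"
    using ab by (intro mult_left_mono) (auto simp: power2_sum)
  also have "\<dots> = (144 / c\<^sub>0 * s * (a + b))\<^sup>2" by (simp only: power_mult_distrib)
  finally have "sqrt (\<integral>x. (err x)\<^sup>2 \<partial>samples) \<le> 144 / c\<^sub>0 * s * (a + b)"
    using ab c0 s by (intro real_le_lsqrt) auto
  then show "sqrt (\<integral>x. (err x)\<^sup>2 \<partial>samples) \<le> 144 / c\<^sub>0 * op_norm n S *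
     (sqrt (8 * exp 1 * ln (real n) * r_min n S (p_hat N d) / real N)
      + 4 * exp 2 * ln (real n) * ln (real N) * r_2 n S (p_hat N d) / real N)"
    by (simp add: a_def b_def s_def l_def L_def r1_def r2_def p_def)
qed

end

section \<open>Conditioning on the mask\<close>

text \<open>Independence makes the joint law a product. Fubini then shows that both sides have the
  same integral over every event \<open>D \<in> B\<close>, and these events make up the conditioning
  sigma-algebra. So conditioning on the mask amounts to freezing it.\<close>

lemma (in prob_space) real_cond_exp_indep:
  fixes h :: "'d \<times> 'd \<Rightarrow> real"
  assumes indep: "indep_var SX X SD D"
    and h: "h \<in> borel_measurable (SD \<Otimes>\<^sub>M SX)"
    and int: "integrable M (\<lambda>\<omega>. h (D \<omega>, X \<omega>))"
  shows "AE \<omega> in M. real_cond_exp M (vimage_algebra (space M) D SD) (\<lambda>\<omega>. h (D \<omega>, X \<omega>)) \<omega>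
    = (\<integral>x. h (D \<omega>, x) \<partial>distr M SX X)"
proof -
  let ?F = "vimage_algebra (space M) D SD"
  define PX where "PX = distr M SX X"
  define PD where "PD = distr M SD D"
  define g where "g = (\<lambda>\<delta>. \<integral>x. h (\<delta>, x) \<partial>PX)"
  have X: "X \<in> measurable M SX" and D: "D \<in> measurable M SD"
    using indep by (auto dest: indep_var_rv1 indep_var_rv2)
  interpret PX: prob_space PX unfolding PX_def by (rule prob_space_distr[OF X])
  interpret PD: prob_space PD unfolding PD_def by (rule prob_space_distr[OF D])
  interpret XD: pair_sigma_finite PX PD by unfold_locales
  define f where "f = (\<lambda>x \<delta>. h (\<delta>, x))"
  have prod: "PX \<Otimes>\<^sub>M PD = distr M (SX \<Otimes>\<^sub>M SD) (\<lambda>\<omega>. (X \<omega>, D \<omega>))"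
    using indep unfolding PD_def PX_def indep_var_distribution_eq by simp
  have XDm: "(\<lambda>\<omega>. (X \<omega>, D \<omega>)) \<in> measurable M (SX \<Otimes>\<^sub>M SD)" using D X by simp
  have f: "case_prod f \<in> borel_measurable (SX \<Otimes>\<^sub>M SD)"
    using measurable_compose[OF measurable_pair_swap' h] by (simp add: f_def split_beta')
  have sets_prod: "sets (PX \<Otimes>\<^sub>M PD) = sets (SX \<Otimes>\<^sub>M SD)"
    by (intro sets_pair_measure_cong) (auto simp: PX_def PD_def)
  have fint: "integrable (PX \<Otimes>\<^sub>M PD) (case_prod f)"
    unfolding prod using int f XDm by (simp add: integrable_distr_eq f_def)
  have gint: "integrable PD g"
    using XD.integrable_snd[OF fint] by (simp add: g_def f_def)
  have gm: "g \<in> borel_measurable SD"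
    using borel_measurable_integrable[OF gint] by (simp add: PD_def)
  have sub: "subalgebra M ?F"
    unfolding subalgebra_def using sets_image_in_sets[OF refl D] by simp
  interpret F: finite_measure_subalgebra M ?F by unfold_locales (rule sub)
  have Dsp: "D \<in> space M \<rightarrow> space SD" using D by (auto simp: measurable_def)
  have "AE \<omega> in M. real_cond_exp M ?F (\<lambda>\<omega>. h (D \<omega>, X \<omega>)) \<omega> = g (D \<omega>)"
  proof (rule F.real_cond_exp_charact)
    show "integrable M (\<lambda>\<omega>. g (D \<omega>))"
      using gint gm D unfolding PD_def by (simp add: integrable_distr_eq)
    show "(\<lambda>\<omega>. g (D \<omega>)) \<in> borel_measurable ?F"
      by (rule measurable_compose[OF measurable_vimage_algebra1[OF Dsp] gm])
    fix A assume "A \<in> sets ?F"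
    then obtain B where B: "B \<in> sets SD" "A = D -` B \<inter> space M"
      using sets_vimage_algebra2[OF Dsp] by auto
    have ind: "indicator A \<omega> = (indicator B (D \<omega>) :: real)" if "\<omega> \<in> space M" for \<omega>
      using that B by (auto simp: indicator_def)
    define fB where "fB = (\<lambda>x \<delta>. indicator B \<delta> * f x \<delta>)"
    have "(\<lambda>z. indicator B (snd z) * case_prod f z) \<in> borel_measurable (SX \<Otimes>\<^sub>M SD)"
      using f B by measurable
    then have fBm: "case_prod fB \<in> borel_measurable (SX \<Otimes>\<^sub>M SD)"
      by (simp add: fB_def split_beta')
    have fBint: "integrable (PX \<Otimes>\<^sub>M PD) (case_prod fB)"
    proof (rule Bochner_Integration.integrable_bound[OF fint])
      show "case_prod fB \<in> borel_measurable (PX \<Otimes>\<^sub>M PD)"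
        using fBm by (simp cong: measurable_cong_sets add: measurable_cong_sets[OF sets_prod refl])
    qed (auto simp: fB_def indicator_def)
    have "(\<integral>\<omega>\<in>A. h (D \<omega>, X \<omega>) \<partial>M) = (\<integral>\<omega>. fB (X \<omega>) (D \<omega>) \<partial>M)"
      unfolding set_lebesgue_integral_def by (intro Bochner_Integration.integral_cong) (auto simp: ind fB_def f_def)
    also have "\<dots> = (\<integral>z. case_prod fB z \<partial>(PX \<Otimes>\<^sub>M PD))"
      unfolding prod using fBm XDm by (simp add: integral_distr)
    also have "\<dots> = (\<integral>\<delta>. (\<integral>x. fB x \<delta> \<partial>PX) \<partial>PD)"
      by (rule XD.integral_snd[OF fBint, symmetric])
    also have "\<dots> = (\<integral>\<delta>. indicator B \<delta> * g \<delta> \<partial>PD)"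
      by (simp add: g_def fB_def f_def)
    also have "\<dots> = (\<integral>\<omega>. indicator B (D \<omega>) * g (D \<omega>) \<partial>M)"
      unfolding PD_def using gm B D by (subst integral_distr) auto
    also have "\<dots> = (\<integral>\<omega>\<in>A. g (D \<omega>) \<partial>M)"
      unfolding set_lebesgue_integral_def by (intro Bochner_Integration.integral_cong) (auto simp: ind)
    finally show "(\<integral>\<omega>\<in>A. h (D \<omega>, X \<omega>) \<partial>M) = (\<integral>\<omega>\<in>A. g (D \<omega>) \<partial>M)" .
  qed (rule int)
  then show ?thesis by (simp add: g_def PX_def)
qed

lemma op_norm_pos:
  assumes "i \<in> {1..n}" "j \<in> {1..n}" "A i j \<noteq> 0"
  shows "op_norm n A > 0"
proof -
  have n: "n \<ge> 1" using assms by auto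
  let ?e = "\<lambda>l. if l = j then 1 else 0 :: real"
  have "mat_vec n A ?e i = (\<Sum>l\<in>{1..n}. if l = j then A i j else 0)"
    unfolding mat_vec_def by (intro sum.cong) auto
  then have "mat_vec n A ?e i = A i j" using assms by simp
  then have "0 < (mat_vec n A ?e i)\<^sup>2" using assms by simp
  also have "\<dots> \<le> (\<Sum>i\<in>{1..n}. (mat_vec n A ?e i)\<^sup>2)"
    using assms by (intro member_le_sum) auto
  also have "\<dots> \<le> (op_norm n A)\<^sup>2 * (\<Sum>l\<in>{1..n}. (?e l)\<^sup>2)"
    by (rule mat_vec_sq_le_op_norm[OF n])
  finally have "0 < (op_norm n A)\<^sup>2 * (\<Sum>l\<in>{1..n}. (?e l)\<^sup>2)" .
  then have "op_norm n A \<noteq> 0" by auto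
  then show ?thesis using op_norm_nonneg[OF n, of A] by simp
qed

text \<open>With K = 2 q / \<open>c\<^sub>0\<close>, where q is the second moment of z, a norm of at
  least sqrt K would give 2 q <= q. Hence for q > 0 the norm lies strictly below sqrt K, and some
  admissible u < sqrt K exists even if the infimum is not attained. For q = 0 the quotient by K = 0
  is 0 and the integrand is constantly 1.\<close>

lemma psi2_normD:
  fixes z :: "'a \<Rightarrow> real"
  assumes c: "c\<^sub>0 > 0" and z: "integrable M (\<lambda>\<omega>. (z \<omega>)\<^sup>2)" and zm: "z \<in> borel_measurable M" and M: "prob_space M"
    and psi: "ennreal c\<^sub>0 * (psi2_norm M z)\<^sup>2 \<le> ennreal (\<integral>\<omega>. (z \<omega>)\<^sup>2 \<partial>M)"
  shows "integrable M (\<lambda>\<omega>. exp ((z \<omega>)\<^sup>2 / (2 / c\<^sub>0 * (\<integral>\<omega>. (z \<omega>)\<^sup>2 \<partial>M))))"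
    and "(\<integral>\<omega>. exp ((z \<omega>)\<^sup>2 / (2 / c\<^sub>0 * (\<integral>\<omega>. (z \<omega>)\<^sup>2 \<partial>M))) \<partial>M) \<le> 2"
proof -
  interpret prob_space M by fact
  define q where "q = (\<integral>\<omega>. (z \<omega>)\<^sup>2 \<partial>M)"
  define K where "K = 2 / c\<^sub>0 * q"
  have q0: "q \<ge> 0" by (simp add: q_def)
  have bound: "(\<integral>\<^sup>+\<omega>. ennreal (exp ((z \<omega>)\<^sup>2 / K)) \<partial>M) \<le> 2"
  proof (cases "q = 0")
    case True
    then show ?thesis by (simp add: K_def emeasure_space_1)
  next
    case False
    then have K: "K > 0" using q0 c by (simp add: K_def)
    have "psi2_norm M z < ennreal (sqrt K)"
    proof (rule ccontr)
      assume "\<not> psi2_norm M z < ennreal (sqrt K)"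
      then have "ennreal (sqrt K) \<le> psi2_norm M z" by simp
      then have "(ennreal (sqrt K))\<^sup>2 \<le> (psi2_norm M z)\<^sup>2" by (intro power_mono) auto
      then have "ennreal c\<^sub>0 * (ennreal (sqrt K))\<^sup>2 \<le> ennreal q"
        using psi unfolding q_def by (meson mult_left_mono order_trans zero_le)
      moreover have "ennreal c\<^sub>0 * (ennreal (sqrt K))\<^sup>2 = ennreal (c\<^sub>0 * K)"
        using K c by (simp add: ennreal_power ennreal_mult)
      ultimately have "c\<^sub>0 * K \<le> q" using q0 by (simp add: ennreal_le_iff)
      then show False using c False q0 by (simp add: K_def)
    qed
    then obtain u where u: "u > 0" "(\<integral>\<^sup>+\<omega>. ennreal (exp (\<bar>z \<omega>\<bar>\<^sup>2 / u\<^sup>2)) \<partial>M) \<le> 2" "ennreal u < ennreal (sqrt K)"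
      unfolding psi2_norm_def Inf_less_iff by blast
    have "u < sqrt K" using u by (simp add: ennreal_less_iff)
    then have "u\<^sup>2 \<le> K" using u K by (metis less_imp_le power_mono real_sqrt_pow2)
    then have "(\<integral>\<^sup>+\<omega>. ennreal (exp ((z \<omega>)\<^sup>2 / K)) \<partial>M) \<le> (\<integral>\<^sup>+\<omega>. ennreal (exp (\<bar>z \<omega>\<bar>\<^sup>2 / u\<^sup>2)) \<partial>M)"
      using u(1) K by (intro nn_integral_mono ennreal_leI) (auto intro!: divide_left_mono)
    then show ?thesis using u(2) by simp
  qed
  have "(\<lambda>\<omega>. exp ((z \<omega>)\<^sup>2 / K)) \<in> borel_measurable M" using zm by measurable
  then have int: "integrable M (\<lambda>\<omega>. exp ((z \<omega>)\<^sup>2 / K))"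
    using bound by (intro integrableI_nonneg) (auto intro: le_less_trans)
  then show "integrable M (\<lambda>\<omega>. exp ((z \<omega>)\<^sup>2 / (2 / c\<^sub>0 * (\<integral>\<omega>. (z \<omega>)\<^sup>2 \<partial>M))))" by (simp add: K_def q_def)
  have "ennreal (\<integral>\<omega>. exp ((z \<omega>)\<^sup>2 / K) \<partial>M) \<le> ennreal 2"
    using bound nn_integral_eq_integral[OF int] by simp
  then have "(\<integral>\<omega>. exp ((z \<omega>)\<^sup>2 / K) \<partial>M) \<le> 2" by (subst (asm) ennreal_le_iff) auto
  then show "(\<integral>\<omega>. exp ((z \<omega>)\<^sup>2 / (2 / c\<^sub>0 * (\<integral>\<omega>. (z \<omega>)\<^sup>2 \<partial>M))) \<partial>M) \<le> 2" by (simp add: K_def q_def)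
qed

section \<open>The law of the data and the estimator as a random matrix\<close>

context missing_data
begin

definition law :: "(nat \<Rightarrow> real) measure" where "law = distr M (vec_space n) x"

lemma law_integral:
  fixes f :: "(nat \<Rightarrow> real) \<Rightarrow> real"
  assumes "f \<in> borel_measurable (vec_space n)"
  shows "(\<integral>y. f y \<partial>law) = (\<integral>\<omega>. f (x \<omega>) \<partial>M)" "integrable law f \<longleftrightarrow> integrable M (\<lambda>\<omega>. f (x \<omega>))"
  using integral_distr[OF x_random assms] integrable_distr_eq[OF x_random assms] by (auto simp: law_def)

text \<open>Outside \<open>{1..n}\<close> the coordinates of an extensional function are constant.\<close>

lemma coordinate_borel: "(\<lambda>y. y i) \<in> borel_measurable (vec_space n)"
proof (cases "i \<in> {1..n}")
  case False
  have "y i = undefined" if "y \<in> space (vec_space n)" for y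
    using that PiE_arb[OF _ False] by (simp only: space_PiM)
  then show ?thesis by (subst measurable_cong[where g = "\<lambda>_. undefined"]) auto
qed (rule measurable_component_singleton)

lemma inner_on_borel: "(\<lambda>y. inner_on n u y) \<in> borel_measurable (vec_space n)"
  unfolding inner_on_def by (intro borel_measurable_sum borel_measurable_times borel_measurable_const coordinate_borel)

lemma covariance_law: "covariance_matrix M x = (\<lambda>i j. \<integral>y. y i * y j \<partial>law)"
  unfolding covariance_matrix_def
  by (intro ext law_integral(1)[symmetric] borel_measurable_times coordinate_borel)

lemma sub_gaussian_law:
  assumes c: "c\<^sub>0 > 0" and sg: "sub_gaussian_assumption M n x c\<^sub>0"
  shows "sub_gaussian_law law n c\<^sub>0"
proof -
  have m: "(\<lambda>\<omega>. inner_on n u (x \<omega>)) \<in> borel_measurable M" for u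
    by (rule measurable_compose[OF x_random inner_on_borel])
  have sq: "integrable M (\<lambda>\<omega>. (inner_on n u (x \<omega>))\<^sup>2)" for u
    unfolding inner_on_def
  proof (rule integrable_square_sum)
    fix i assume i: "i \<in> {1..n}"
    have "(\<lambda>\<omega>. x \<omega> i) \<in> borel_measurable M"
      by (rule measurable_compose[OF x_random coordinate_borel])
    then show "(\<lambda>\<omega>. u i * x \<omega> i) \<in> borel_measurable M" by simp
    show "integrable M (\<lambda>\<omega>. (u i * x \<omega> i)\<^sup>2)" using x_square_integrable[OF i] by (simp add: power_mult_distrib)
  qed simp
  have psi: "ennreal c\<^sub>0 * (psi2_norm M (\<lambda>\<omega>. inner_on n u (x \<omega>)))\<^sup>2 \<le> ennreal (\<integral>\<omega>. (inner_on n u (x \<omega>))\<^sup>2 \<partial>M)" for u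
    using sg by (simp add: sub_gaussian_assumption_def)
  have m2: "(\<lambda>y. (inner_on n u y)\<^sup>2) \<in> borel_measurable (vec_space n)" for u
    using inner_on_borel by measurable
  have m3: "(\<lambda>y. exp ((inner_on n u y)\<^sup>2 / r)) \<in> borel_measurable (vec_space n)" for u r
    using inner_on_borel by measurable
  note ex = psi2_normD[OF c sq m prob_space_axioms psi]
  interpret law: prob_space law unfolding law_def by (rule prob_space_distr[OF x_random])
  show ?thesis
  proof unfold_locales
    show "sets law = sets (vec_space n)" by (simp add: law_def)
    show "integrable law (\<lambda>y. (inner_on n u y)\<^sup>2)" for u
      unfolding law_integral(2)[OF m2] by (rule sq)
    show "integrable law (\<lambda>y. exp ((inner_on n u y)\<^sup>2 / (2 / c\<^sub>0 * (\<integral>y. (inner_on n u y)\<^sup>2 \<partial>law))))" for u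
      unfolding law_integral(1)[OF m2] law_integral(2)[OF m3] by (rule ex(1))
    show "(\<integral>y. exp ((inner_on n u y)\<^sup>2 / (2 / c\<^sub>0 * (\<integral>y. (inner_on n u y)\<^sup>2 \<partial>law))) \<partial>law) \<le> 2" for u
      unfolding law_integral(1)[OF m2] law_integral(1)[OF m3] by (rule ex(2))
  qed (rule c)
qed

text \<open>Measurability into the product space forces \<open>X \<omega>\<close> to be extensional,
  so it coincides with the restricted family whose joint law is the product law by
  independence.\<close>

lemma samples_law:
  assumes "N \<ge> 1"
  shows "distr M (mat_space n N) X = Pi\<^sub>M {1..N} (\<lambda>_. law)"
proof -
  have rv: "random_variable (vec_space n) (\<lambda>\<omega>. X \<omega> k)" if "k \<in> {1..N}" for k
    using samples_indep that by (simp add: indep_vars_def)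
  have X: "X \<in> measurable M (mat_space n N)" using mask_indep by (rule indep_var_rv1)
  have "distr M (mat_space n N) X = distr M (mat_space n N) (\<lambda>\<omega>. \<lambda>k\<in>{1..N}. X \<omega> k)"
  proof (rule distr_cong[OF refl refl])
    fix \<omega> assume "\<omega> \<in> space M"
    then have "X \<omega> \<in> space (mat_space n N)" using X by (rule measurable_space[rotated])
    then have "X \<omega> \<in> PiE {1..N} (\<lambda>_. space (vec_space n))" by (simp only: space_PiM)
    then show "X \<omega> = (\<lambda>k\<in>{1..N}. X \<omega> k)" by (rule PiE_restrict[symmetric])
  qed
  also have "\<dots> = Pi\<^sub>M {1..N} (\<lambda>k. distr M (vec_space n) (\<lambda>\<omega>. X \<omega> k))"
  proof (rule iffD1[OF indep_vars_iff_distr_eq_PiM' samples_indep])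
    show "{1..N} \<noteq> {}" using assms by simp
  qed (rule rv)
  also have "\<dots> = Pi\<^sub>M {1..N} (\<lambda>_. law)"
    by (intro PiM_cong refl) (simp add: samples_distr law_def)
  finally show ?thesis .
qed

text \<open>That the mask is 0/1-valued is contained in its target space, the product of copies of
  \<open>count_space {0, 1}\<close>.\<close>

lemma mask_values:
  assumes "\<omega> \<in> space M" "k \<in> {1..N}" "i \<in> {1..n}"
  shows "D \<omega> k i \<in> {0, 1}"
proof -
  have "D \<omega> \<in> space (mask_space n N)"
    using measurable_space[OF indep_var_rv2[OF mask_indep] assms(1)] .
  then have "D \<omega> \<in> PiE {1..N} (\<lambda>_. PiE {1..n} (\<lambda>_. {0, 1}))" by (simp only: space_PiM space_count_space)
  then show ?thesis using assms(2,3) PiE_mem by fast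
qed

lemma mask_entry_measurable:
  assumes "k \<in> {1..N}" "i \<in> {1..n}"
  shows "(\<lambda>\<delta>. \<delta> k i) \<in> borel_measurable (mask_space n N)"
proof -
  have "(\<lambda>\<delta>. \<delta> k i) \<in> measurable (mask_space n N) (count_space {0, 1 :: real})"
    by (rule measurable_compose[OF measurable_component_singleton[OF assms(1)] measurable_component_singleton[OF assms(2)]])
  then show ?thesis
    by (rule measurable_compose[where g = "\<lambda>z. z"]) simp
qed

lemma data_entry_measurable:
  assumes "k \<in> {1..N}"
  shows "(\<lambda>a. a k i) \<in> borel_measurable (mat_space n N)"
  by (rule measurable_compose[OF measurable_component_singleton[OF assms] coordinate_borel])

lemma sigma_hat_measurable:
  assumes "i \<in> {1..n}" "j \<in> {1..n}"
  shows "(\<lambda>z. sigma_hat N (fst z) (snd z) i j) \<in> borel_measurable (mask_space n N \<Otimes>\<^sub>M mat_space n N)"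
    and "(\<lambda>z. p_hat N (fst z) i j) \<in> borel_measurable (mask_space n N \<Otimes>\<^sub>M mat_space n N)"
proof -
  have d: "(\<lambda>z. fst z k l) \<in> borel_measurable (mask_space n N \<Otimes>\<^sub>M mat_space n N)"
    if "k \<in> {1..N}" "l \<in> {1..n}" for k l
    by (rule measurable_compose[OF measurable_fst mask_entry_measurable[OF that]])
  have a: "(\<lambda>z. snd z k l) \<in> borel_measurable (mask_space n N \<Otimes>\<^sub>M mat_space n N)"
    if "k \<in> {1..N}" for k l
    by (rule measurable_compose[OF measurable_snd data_entry_measurable[OF that]])
  show p: "(\<lambda>z. p_hat N (fst z) i j) \<in> borel_measurable (mask_space n N \<Otimes>\<^sub>M mat_space n N)"
    unfolding p_hat_def using assms
    by (intro borel_measurable_times borel_measurable_sum borel_measurable_const d)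
  have "(\<lambda>z. gamma_hat N (fst z) i j) \<in> borel_measurable (mask_space n N \<Otimes>\<^sub>M mat_space n N)"
    unfolding gamma_hat_def using p by measurable
  then show "(\<lambda>z. sigma_hat N (fst z) (snd z) i j) \<in> borel_measurable (mask_space n N \<Otimes>\<^sub>M mat_space n N)"
    unfolding sigma_hat_def observation_def using assms
    by (intro borel_measurable_times borel_measurable_sum borel_measurable_const d a)
qed

text \<open>The inverse frequency is at most N and cancels the average 1/N. The bound no longer
  involves the mask, so integrability of the estimator can be settled before conditioning.\<close>

lemma abs_sigma_hat_le:
  assumes N: "N \<ge> 1" and \<omega>: "\<omega> \<in> space M" and ij: "i \<in> {1..n}" "j \<in> {1..n}"
  shows "\<bar>sigma_hat N (D \<omega>) (X \<omega>) i j\<bar> \<le> (\<Sum>k\<in>{1..N}. \<bar>X \<omega> k i * X \<omega> k j\<bar>)"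
proof -
  let ?g = "gamma_hat N (D \<omega>) i j"
  have "inverse (max (p_hat N (D \<omega>) i j) (1 / real N)) \<le> inverse (1 / real N)"
    using N by (intro le_imp_inverse_le) auto
  moreover have "0 < max (p_hat N (D \<omega>) i j) (1 / real N)" using N by (simp add: less_max_iff_disj)
  ultimately have g: "0 \<le> ?g" "?g \<le> real N" by (auto simp: gamma_hat_def)
  have "\<bar>\<Sum>k\<in>{1..N}. observation (D \<omega>) (X \<omega>) k i * observation (D \<omega>) (X \<omega>) k j\<bar>
    \<le> (\<Sum>k\<in>{1..N}. \<bar>observation (D \<omega>) (X \<omega>) k i * observation (D \<omega>) (X \<omega>) k j\<bar>)"
    by (rule sum_abs)
  also have "\<dots> \<le> (\<Sum>k\<in>{1..N}. \<bar>X \<omega> k i * X \<omega> k j\<bar>)"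
  proof (rule sum_mono)
    fix k assume k: "k \<in> {1..N}"
    show "\<bar>observation (D \<omega>) (X \<omega>) k i * observation (D \<omega>) (X \<omega>) k j\<bar> \<le> \<bar>X \<omega> k i * X \<omega> k j\<bar>"
      using mask_values[OF \<omega> k ij(1)] mask_values[OF \<omega> k ij(2)] by (auto simp: observation_def)
  qed
  finally have le: "\<bar>\<Sum>k\<in>{1..N}. observation (D \<omega>) (X \<omega>) k i * observation (D \<omega>) (X \<omega>) k j\<bar> \<le> (\<Sum>k\<in>{1..N}. \<bar>X \<omega> k i * X \<omega> k j\<bar>)" .
  have "\<bar>sigma_hat N (D \<omega>) (X \<omega>) i j\<bar> = \<bar>\<Sum>k\<in>{1..N}. observation (D \<omega>) (X \<omega>) k i * observation (D \<omega>) (X \<omega>) k j\<bar> * (?g / real N)"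
    using g N by (simp add: sigma_hat_def abs_mult)
  also have "\<dots> \<le> (\<Sum>k\<in>{1..N}. \<bar>X \<omega> k i * X \<omega> k j\<bar>) * 1"
    using g N le by (intro mult_mono) auto
  finally show ?thesis by simp
qed

lemma data_pair_measurable: "(\<lambda>\<omega>. (D \<omega>, X \<omega>)) \<in> measurable M (mask_space n N \<Otimes>\<^sub>M mat_space n N)"
  using indep_var_rv1[OF mask_indep] indep_var_rv2[OF mask_indep] by (rule measurable_Pair[rotated])

lemma sigma_hat_square_integrable:
  assumes sg: "sub_gaussian_law law n c\<^sub>0" and N: "N \<ge> 1" and ij: "i \<in> {1..n}" "j \<in> {1..n}"
  shows "integrable M (\<lambda>\<omega>. (sigma_hat N (D \<omega>) (X \<omega>) i j)\<^sup>2)"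
    and "(\<lambda>\<omega>. sigma_hat N (D \<omega>) (X \<omega>) i j) \<in> borel_measurable M"
proof -
  interpret sg: sub_gaussian_law law n c\<^sub>0 by fact
  have rv: "random_variable (vec_space n) (\<lambda>\<omega>. X \<omega> k)" if "k \<in> {1..N}" for k
    using samples_indep that by (simp add: indep_vars_def)
  have lawint: "integrable law (\<lambda>y. (y i * y j)\<^sup>2)"
    using sg.product_moment(1)[of "\<lambda>l. if l = i then 1 else 0" "\<lambda>l. if l = j then 1 else 0"] ij
    by (simp add: sg.inner_on_unit power_mult_distrib)
  have bm: "(\<lambda>y. (y i * y j)\<^sup>2) \<in> borel_measurable (vec_space n)"
    by (intro borel_measurable_power borel_measurable_times coordinate_borel)
  have prod_int: "integrable M (\<lambda>\<omega>. (\<bar>X \<omega> k i * X \<omega> k j\<bar>)\<^sup>2)" if "k \<in> {1..N}" for k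
    using lawint integrable_distr_eq[OF rv[OF that] bm] samples_distr[OF that] by (simp add: law_def)
  have prod_meas: "(\<lambda>\<omega>. \<bar>X \<omega> k i * X \<omega> k j\<bar>) \<in> borel_measurable M" if "k \<in> {1..N}" for k
    using measurable_compose[OF rv[OF that] coordinate_borel] by (intro borel_measurable_abs borel_measurable_times)
  have bound: "integrable M (\<lambda>\<omega>. (\<Sum>k\<in>{1..N}. \<bar>X \<omega> k i * X \<omega> k j\<bar>)\<^sup>2)"
    by (rule integrable_square_sum[OF _ prod_meas prod_int]) simp
  show meas: "(\<lambda>\<omega>. sigma_hat N (D \<omega>) (X \<omega>) i j) \<in> borel_measurable M"
    using measurable_compose[OF data_pair_measurable sigma_hat_measurable(1)[OF ij]] by simp
  show "integrable M (\<lambda>\<omega>. (sigma_hat N (D \<omega>) (X \<omega>) i j)\<^sup>2)"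
  proof (rule Bochner_Integration.integrable_bound[OF bound])
    show "(\<lambda>\<omega>. (sigma_hat N (D \<omega>) (X \<omega>) i j)\<^sup>2) \<in> borel_measurable M" using meas by measurable
    show "AE \<omega> in M. norm ((sigma_hat N (D \<omega>) (X \<omega>) i j)\<^sup>2) \<le> norm ((\<Sum>k\<in>{1..N}. \<bar>X \<omega> k i * X \<omega> k j\<bar>)\<^sup>2)"
    proof (rule AE_I2)
      fix \<omega> assume "\<omega> \<in> space M"
      then have "\<bar>sigma_hat N (D \<omega>) (X \<omega>) i j\<bar>\<^sup>2 \<le> (\<Sum>k\<in>{1..N}. \<bar>X \<omega> k i * X \<omega> k j\<bar>)\<^sup>2"
        by (intro power_mono abs_sigma_hat_le N ij) auto
      then show "norm ((sigma_hat N (D \<omega>) (X \<omega>) i j)\<^sup>2) \<le> norm ((\<Sum>k\<in>{1..N}. \<bar>X \<omega> k i * X \<omega> k j\<bar>)\<^sup>2)" by simp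
    qed
  qed
qed

text \<open>Integrability over the whole space comes first, since the description of the conditional
  expectation by frozen masks requires it. For almost every outcome the conditional expectation is
  then an integral over the product law with a deterministic mask, where the estimates for a fixed
  mask apply.\<close>

lemma conditional_error_bound:
  assumes c0: "c\<^sub>0 > 0" and sg: "sub_gaussian_assumption M n x c\<^sub>0" and N2: "real N \<ge> exp 2" and n3: "n \<ge> 3"
  defines "S \<equiv> covariance_matrix M x"
    and "F \<equiv> vimage_algebra (space M) D (mask_space n N)"
  defines "err \<equiv> \<lambda>\<omega>. op_norm n (\<lambda>i j. sigma_hat N (D \<omega>) (X \<omega>) i j
    - restrict_mat (observed_pairs n (p_hat N (D \<omega>))) S i j)"
  shows "integrable M (\<lambda>\<omega>. (err \<omega>)\<^sup>2)"
    and "AE \<omega> in M. sqrt (real_cond_exp M F (\<lambda>\<omega>. (err \<omega>)\<^sup>2) \<omega>) \<le> 144 / c\<^sub>0 * op_norm n S *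
      (sqrt (8 * exp 1 * ln (real n) * r_min n S (p_hat N (D \<omega>)) / real N)
       + 4 * exp 2 * ln (real n) * ln (real N) * r_2 n S (p_hat N (D \<omega>)) / real N)"
    and "AE \<omega> in M. \<forall>i\<in>{1..n}. \<forall>j\<in>{1..n}. real_cond_exp M F (\<lambda>\<omega>. sigma_hat N (D \<omega>) (X \<omega>) i j) \<omega>
      = restrict_mat (observed_pairs n (p_hat N (D \<omega>))) S i j"
proof -
  note law = sub_gaussian_law[OF c0 sg]
  have n1: "n \<ge> 1" using n3 by simp
  have "real N > 0" using N2 exp_gt_zero[of "2::real"] by linarith
  then have N1: "N \<ge> 1" by simp
  have S: "S = (\<lambda>i j. \<integral>y. y i * y j \<partial>law)" unfolding S_def by (rule covariance_law)
  obtain i j where "i \<in> {1..n}" "j \<in> {1..n}" "S i j \<noteq> 0"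
    using covariance_nonzero unfolding S_def by blast
  then have pos: "op_norm n S > 0" by (rule op_norm_pos)
  define h where "h = (\<lambda>z. (op_norm n (\<lambda>i j. sigma_hat N (fst z) (snd z) i j
    - restrict_mat (observed_pairs n (p_hat N (fst z))) S i j))\<^sup>2)"
  have masked: "masked_sub_gaussian law n c\<^sub>0 N (D \<omega>)" if "\<omega> \<in> space M" for \<omega>
    unfolding masked_sub_gaussian_def masked_sub_gaussian_axioms_def
    using law n3 N2 pos mask_values[OF that] unfolding S by blast
  have restrict_meas: "(\<lambda>z. restrict_mat (observed_pairs n (p_hat N (fst z))) S i j)
      \<in> borel_measurable (mask_space n N \<Otimes>\<^sub>M mat_space n N)" if "i \<in> {1..n}" "j \<in> {1..n}" for i j
  proof -
    have "(\<lambda>z. if p_hat N (fst z) i j \<noteq> 0 then S i j else 0) \<in> borel_measurable (mask_space n N \<Otimes>\<^sub>M mat_space n N)"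
      using sigma_hat_measurable(2)[OF that] by measurable
    then show ?thesis using that by (simp add: restrict_mat_def observed_pairs_iff)
  qed
  have hm: "h \<in> borel_measurable (mask_space n N \<Otimes>\<^sub>M mat_space n N)"
    unfolding h_def
    by (intro borel_measurable_power measurable_op_norm[OF n1] borel_measurable_diff sigma_hat_measurable(1) restrict_meas)
  have err: "(err \<omega>)\<^sup>2 = h (D \<omega>, X \<omega>)" for \<omega> by (simp add: err_def h_def)
  have entry_int: "integrable M (\<lambda>\<omega>. (sigma_hat N (D \<omega>) (X \<omega>) i j
      - restrict_mat (observed_pairs n (p_hat N (D \<omega>))) S i j)\<^sup>2)"
    if ij: "i \<in> {1..n}" "j \<in> {1..n}" for i j
  proof (rule Bochner_Integration.integrable_bound)
    show "integrable M (\<lambda>\<omega>. 2 * (sigma_hat N (D \<omega>) (X \<omega>) i j)\<^sup>2 + 2 * (S i j)\<^sup>2)"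
      using sigma_hat_square_integrable(1)[OF law N1 ij] by simp
    show "(\<lambda>\<omega>. (sigma_hat N (D \<omega>) (X \<omega>) i j - restrict_mat (observed_pairs n (p_hat N (D \<omega>))) S i j)\<^sup>2) \<in> borel_measurable M"
      using sigma_hat_square_integrable(2)[OF law N1 ij] measurable_compose[OF data_pair_measurable restrict_meas[OF ij]]
      by simp
    have "(s - r)\<^sup>2 \<le> 2 * s\<^sup>2 + 2 * t\<^sup>2" if "r = t \<or> r = 0" for s r t :: real
      using that sum_squares_bound[of s "-t"] by (auto simp: power2_diff)
    then show "AE \<omega> in M. norm ((sigma_hat N (D \<omega>) (X \<omega>) i j - restrict_mat (observed_pairs n (p_hat N (D \<omega>))) S i j)\<^sup>2)
      \<le> norm (2 * (sigma_hat N (D \<omega>) (X \<omega>) i j)\<^sup>2 + 2 * (S i j)\<^sup>2)"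
      by (intro AE_I2) (simp add: restrict_mat_def)
  qed
  show int: "integrable M (\<lambda>\<omega>. (err \<omega>)\<^sup>2)"
    unfolding err_def
  proof (rule op_norm_sq_jensen(1)[OF n1 _ entry_int])
    show "(\<lambda>\<omega>. sigma_hat N (D \<omega>) (X \<omega>) i j - restrict_mat (observed_pairs n (p_hat N (D \<omega>))) S i j) \<in> borel_measurable M"
      if "i \<in> {1..n}" "j \<in> {1..n}" for i j
      using sigma_hat_square_integrable(2)[OF law N1 that] measurable_compose[OF data_pair_measurable restrict_meas[OF that]]
      by simp
  qed
  have "AE \<omega> in M. real_cond_exp M F (\<lambda>\<omega>. h (D \<omega>, X \<omega>)) \<omega> = (\<integral>a. h (D \<omega>, a) \<partial>distr M (mat_space n N) X)"
    unfolding F_def by (rule real_cond_exp_indep[OF mask_indep hm int[unfolded err]])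
  then show "AE \<omega> in M. sqrt (real_cond_exp M F (\<lambda>\<omega>. (err \<omega>)\<^sup>2) \<omega>) \<le> 144 / c\<^sub>0 * op_norm n S *
      (sqrt (8 * exp 1 * ln (real n) * r_min n S (p_hat N (D \<omega>)) / real N)
       + 4 * exp 2 * ln (real n) * ln (real N) * r_2 n S (p_hat N (D \<omega>)) / real N)"
    using AE_space
  proof eventually_elim
    case (elim \<omega>)
    interpret m: masked_sub_gaussian law n c\<^sub>0 N "D \<omega>" by (rule masked[OF elim(2)])
    show ?case
      using m.error_bound(2) elim(1)
      unfolding err samples_law[OF N1] h_def m.err_def m.S_def S[symmetric] by simp
  qed
  have "AE \<omega> in M. real_cond_exp M F (\<lambda>\<omega>. sigma_hat N (D \<omega>) (X \<omega>) i j) \<omega>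
      = restrict_mat (observed_pairs n (p_hat N (D \<omega>))) S i j" if ij: "i \<in> {1..n}" "j \<in> {1..n}" for i j
  proof -
    have "integrable M (\<lambda>\<omega>. sigma_hat N (D \<omega>) (X \<omega>) i j)"
      using square_integrable_imp_integrable[OF sigma_hat_square_integrable(2,1)[OF law N1 ij]] .
    then have "AE \<omega> in M. real_cond_exp M F (\<lambda>\<omega>. sigma_hat N (D \<omega>) (X \<omega>) i j) \<omega>
      = (\<integral>a. sigma_hat N (D \<omega>) a i j \<partial>distr M (mat_space n N) X)"
      using real_cond_exp_indep[OF mask_indep sigma_hat_measurable(1)[OF ij]] unfolding F_def by simp
    then show ?thesis
      using AE_space
    proof eventually_elim
      case (elim \<omega>)
      interpret m: masked_sub_gaussian law n c\<^sub>0 N "D \<omega>" by (rule masked[OF elim(2)])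
      show ?case
        using m.sigma_hat_mean(2)[OF ij] elim(1)
        unfolding samples_law[OF N1] m.S_def S[symmetric] by simp
    qed
  qed
  then show "AE \<omega> in M. \<forall>i\<in>{1..n}. \<forall>j\<in>{1..n}. real_cond_exp M F (\<lambda>\<omega>. sigma_hat N (D \<omega>) (X \<omega>) i j) \<omega>
      = restrict_mat (observed_pairs n (p_hat N (D \<omega>))) S i j"
    by (intro AE_finite_allI finite_atLeastAtMost)
qed

end

theorem theorem2:
  fixes c\<^sub>0 :: real
  assumes "c\<^sub>0 > 0"
  shows "\<exists>C>0. \<forall>(M :: 'a measure) n N x X D.
    missing_data M n N x X D \<longrightarrow>
    sub_gaussian_assumption M n x c\<^sub>0 \<longrightarrow>
    real N \<ge> exp 2 \<longrightarrow>
    n \<ge> 3 \<longrightarrow>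
    (let S = covariance_matrix M x;
         F = vimage_algebra (space M) D (mask_space n N);
         P = (\<lambda>\<omega>. p_hat N (D \<omega>));
         S_hat = (\<lambda>\<omega>. sigma_hat N (D \<omega>) (X \<omega>));
         S_E = (\<lambda>\<omega>. restrict_mat (observed_pairs n (P \<omega>)) S);
         err = (\<lambda>\<omega>. op_norm n (\<lambda>i j. S_hat \<omega> i j - S_E \<omega> i j))
     in integrable M (\<lambda>\<omega>. (err \<omega>)\<^sup>2) \<and>
        (AE \<omega> in M. (\<forall>i\<in>{1..n}. \<exists>k\<in>{1..N}. D \<omega> k i = 1) \<longrightarrow>
           sqrt (real_cond_exp M F (\<lambda>\<omega>'. (err \<omega>')\<^sup>2) \<omega>)
             \<le> C * op_norm n S *
                (sqrt (8 * exp 1 * ln (real n) * r_min n S (P \<omega>) / real N) +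
                 4 * exp 2 * ln (real n) * ln (real N) * r_2 n S (P \<omega>) / real N) \<and>
           (\<forall>i\<in>{1..n}. \<forall>j\<in>{1..n}.
              real_cond_exp M F (\<lambda>\<omega>'. S_hat \<omega>' i j) \<omega> = S_E \<omega> i j)))"
proof (intro exI[of _ "144 / c\<^sub>0"] conjI allI impI)
  fix M :: "'a measure" and n N x X D
  assume md: "missing_data M n N x X D" and sg: "sub_gaussian_assumption M n x c\<^sub>0"
    and N: "real N \<ge> exp 2" and n: "n \<ge> 3"
  interpret missing_data M n N x X D by (rule md)
  note bound = conditional_error_bound[OF assms sg N n]
  have AE: "AE \<omega> in M. Q \<omega> \<longrightarrow> A \<omega> \<and> B \<omega>" if "AE \<omega> in M. A \<omega>" "AE \<omega> in M. B \<omega>" for Q A B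
    using that by eventually_elim simp
  show "let S = covariance_matrix M x;
         F = vimage_algebra (space M) D (mask_space n N);
         P = (\<lambda>\<omega>. p_hat N (D \<omega>));
         S_hat = (\<lambda>\<omega>. sigma_hat N (D \<omega>) (X \<omega>));
         S_E = (\<lambda>\<omega>. restrict_mat (observed_pairs n (P \<omega>)) S);
         err = (\<lambda>\<omega>. op_norm n (\<lambda>i j. S_hat \<omega> i j - S_E \<omega> i j))
     in integrable M (\<lambda>\<omega>. (err \<omega>)\<^sup>2) \<and>
        (AE \<omega> in M. (\<forall>i\<in>{1..n}. \<exists>k\<in>{1..N}. D \<omega> k i = 1) \<longrightarrow>
           sqrt (real_cond_exp M F (\<lambda>\<omega>'. (err \<omega>')\<^sup>2) \<omega>)
             \<le> 144 / c\<^sub>0 * op_norm n S *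
                (sqrt (8 * exp 1 * ln (real n) * r_min n S (P \<omega>) / real N) +
                 4 * exp 2 * ln (real n) * ln (real N) * r_2 n S (P \<omega>) / real N) \<and>
           (\<forall>i\<in>{1..n}. \<forall>j\<in>{1..n}.
              real_cond_exp M F (\<lambda>\<omega>'. S_hat \<omega>' i j) \<omega> = S_E \<omega> i j))"
    unfolding Let_def by (intro conjI AE bound)
qed (use assms in simp)

end
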